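(* Let $\mathbb{F}_q$ be a finite field, $D=\mathfrak{b}_1+\cdots+\mathfrak{b}_r$ a reduced divisor on $\mathbb{P}^1_{\mathbb{F}_q}$ with $d_i=\deg(\mathfrak{b}_i)$, $l=\sum_{i=1}^rd_i$, and let $\boldsymbol{\mu}=((1,1),\dots,(1,1))$ be the $r$-tuple of partitions of $2$ all equal to $(1,1)$. Let $w\in\mathfrak{S}_l$ be of cycle type $(d_1,\dots,d_r)$. (i) If $\mathcal{E}=\mathcal{O}(a)^2$, then $$\mathcal{A}_{\boldsymbol{\mu},D}^{\mathcal{E}}(q)=\begin{cases}\displaystyle\sum_{m=0}^{l-3}\left(\sum_{i=1}^{\left[\frac{l-m-1}{2}\right]}\chi^l_{m+2i+1}(w)\right)q^m&\text{if }l\geq3,\\ 0&\text{otherwise.}\end{cases}$$ (ii) If $\mathcal{E}=\mathcal{O}(a)\oplus\mathcal{O}(b)$ with $a>b$, then $$\mathcal{A}_{\boldsymbol{\mu},D}^{\mathcal{E}}(q)=\begin{cases}\displaystyle\sum_{m=0}^{l-(a-b+2)}\left(\sum_{s=m+a-b+2}^l\chi^l_s(w)\right)q^m&\text{if }l\geq a-b+2,\\ 0&\text{otherwise.}\end{cases}$$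
   Context: For $0<m\le l$, $X^l_m$ is the set of subsets of $\{1,\dots,l\}$ of size $m$, on which $\mathfrak{S}_l$ acts naturally, and $\chi^l_m$ is the character of the corresponding permutation representation of $\mathfrak{S}_l$ on the $\mathbb{C}$-vector space with basis $X^l_m$. $[x]$ denotes the integer part. For the type $\boldsymbol{\mu}$ above, a parabolic structure of type $\boldsymbol{\mu}$ on a rank 2 bundle $\mathcal{E}$ is an $r$-tuple $E=(E_1,\dots,E_r)$ where $E_i$ is a line in the 2-dimensional fiber $\mathcal{E}(\mathfrak{b}_i)$ over the residue field $\mathbb{F}_q(\mathfrak{b}_i)\cong\mathbb{F}_{q^{d_i}}$ (i.e. full flags $\mathcal{E}(\mathfrak{b}_i)\supset E_i\supset0$). In general, parabolic bundles are pairs $(\mathcal{E},E)$ with $E$ a tuple of non-increasing sequences $\mathcal{E}(\mathfrak{b}_i)=E_{i0}\supseteq E_{i1}\supseteq\cdots$ of subspaces with finitely many non-zero terms (repetitions allowed), morphisms are vector bundle morphisms preserving the filtrations termwise, and direct sums are the obvious ones; $E$ is geometrically indecomposable if $(\mathcal{E},E)$ is indecomposable after extension of scalars to $\overline{\mathbb{F}}_q$. $\mathcal{A}_{\boldsymbol{\mu},D}^{\mathcal{E}}(q)$ is the number of $\mathrm{Aut}(\mathcal{E})$-orbits (isomorphism classes) of geometrically indecomposable parabolic structures of type $\boldsymbol{\mu}$ on $\mathcal{E}$. *)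

theory Defs
  imports
    "HOL-Algebra.Algebraic_Closure_Type"
    "HOL-Library.Poly_Mapping"
    "HOL-Combinatorics.Orbits"
    "Jordan_Normal_Form.Matrix"
begin

section \<open>Vector bundles on the projective line\<close>

text \<open>
  The projective line over a field \<open>k\<close> is covered by the charts \<open>Spec k[t]\<close> and \<open>Spec k[s]\<close>,
  glued along \<open>s = 1/t\<close>. Both coordinate rings are principal ideal domains, so every vector bundle
  of rank \<open>n\<close> is free on each chart and is given by a transition matrix \<open>g\<close> in
  \<open>GL_n(k[t,1/t])\<close>: a section is a pair \<open>(v0, v1)\<close> of a \<open>k[t]\<close>-vector and a \<open>k[s]\<close>-vector
  with \<open>v1 = g v0\<close>. The Laurent polynomial ring is the group ring of the integers.
\<close>

type_synonym 'k laurent = "int \<Rightarrow>\<^sub>0 'k"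

type_synonym 'k vbundle = "'k laurent mat"

definition laurent_t :: "'k::field poly \<Rightarrow> 'k laurent" where
  "laurent_t p = (\<Sum>i\<le>Polynomial.degree p. Poly_Mapping.single (int i) (poly.coeff p i))"

definition laurent_s :: "'k::field poly \<Rightarrow> 'k laurent" where
  "laurent_s p = (\<Sum>i\<le>Polynomial.degree p. Poly_Mapping.single (- int i) (poly.coeff p i))"

definition is_bundle :: "'k::field vbundle \<Rightarrow> bool" where
  "is_bundle g \<longleftrightarrow> invertible_mat g"

definition bundle_rank :: "'k vbundle \<Rightarrow> nat" where
  "bundle_rank g = dim_row g"

text \<open>
  With the convention \<open>v1 = g v0\<close> the transition function of \<open>O(a)\<close> is \<open>t^(-a)\<close>; the global
  sections of \<open>O(a)\<close> are then the polynomials in \<open>t\<close> of degree at most \<open>a\<close>.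
\<close>

definition twist :: "int \<Rightarrow> 'k::field vbundle" where
  "twist a = mat 1 1 (\<lambda>_. Poly_Mapping.single (- a) 1)"

definition bundle_sum :: "'k::field vbundle \<Rightarrow> 'k vbundle \<Rightarrow> 'k vbundle" where
  "bundle_sum g h = four_block_mat g (0\<^sub>m (dim_row g) (dim_col h)) (0\<^sub>m (dim_row h) (dim_col g)) h"

text \<open>A morphism is a pair of matrices, one for each chart, compatible with the gluing.\<close>

type_synonym 'k bundle_map = "'k poly mat \<times> 'k poly mat"

definition bundle_hom :: "'k::field vbundle \<Rightarrow> 'k vbundle \<Rightarrow> 'k bundle_map set" where
  "bundle_hom g h = {(A0, A1).
     A0 \<in> carrier_mat (bundle_rank h) (bundle_rank g) \<and>
     A1 \<in> carrier_mat (bundle_rank h) (bundle_rank g) \<and>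
     map_mat laurent_s A1 * g = h * map_mat laurent_t A0}"

definition bundle_comp :: "'k::field bundle_map \<Rightarrow> 'k bundle_map \<Rightarrow> 'k bundle_map" where
  "bundle_comp \<psi> \<phi> = (fst \<psi> * fst \<phi>, snd \<psi> * snd \<phi>)"

definition bundle_id :: "'k::field vbundle \<Rightarrow> 'k bundle_map" where
  "bundle_id g = (1\<^sub>m (bundle_rank g), 1\<^sub>m (bundle_rank g))"

definition bundle_aut :: "'k::field vbundle \<Rightarrow> 'k bundle_map set" where
  "bundle_aut g = {\<phi> \<in> bundle_hom g g. \<exists>\<psi> \<in> bundle_hom g g.
     bundle_comp \<psi> \<phi> = bundle_id g \<and> bundle_comp \<phi> \<psi> = bundle_id g}"


section \<open>Closed points, divisors and fibres\<close>

text \<open>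
  A closed point is either a point of the chart \<open>Spec k[t]\<close>, given by a monic irreducible
  polynomial, or the remaining point \<open>s = 0\<close> of the chart \<open>Spec k[s]\<close>.
\<close>

context notes [[typedef_overloaded]]
begin

datatype 'k point = Affine "'k::zero poly" | Infinity

end

fun closed_point :: "'k::field point \<Rightarrow> bool" where
  "closed_point (Affine p) \<longleftrightarrow> Factorial_Ring.irreducible p \<and> lead_coeff p = 1"
| "closed_point Infinity \<longleftrightarrow> True"

fun local_prime :: "'k::field point \<Rightarrow> 'k poly" where
  "local_prime (Affine p) = p"
| "local_prime Infinity = [:0, 1:]"

definition point_degree :: "'k::field point \<Rightarrow> nat" where
  "point_degree b = Polynomial.degree (local_prime b)"

text \<open>A reduced effective divisor is the same as a finite set of closed points.\<close>

definition reduced_divisor :: "'k::field point set \<Rightarrow> bool" where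
  "reduced_divisor D \<longleftrightarrow> finite D \<and> (\<forall>b\<in>D. closed_point b)"

definition divisor_degree :: "'k::field point set \<Rightarrow> nat" where
  "divisor_degree D = (\<Sum>b\<in>D. point_degree b)"

text \<open>
  The residue field at \<open>b\<close> is the polynomial ring of the chart modulo the prime of \<open>b\<close>, and the
  fibre of a rank \<open>n\<close> bundle is its \<open>n\<close>-th power. Residue classes are represented by their unique
  reduced representatives.
\<close>

definition reduce :: "'k::field point \<Rightarrow> 'k poly vec \<Rightarrow> 'k poly vec" where
  "reduce b v = map_vec (\<lambda>f. f mod local_prime b) v"

definition fibre :: "nat \<Rightarrow> 'k::field point \<Rightarrow> 'k poly vec set" where
  "fibre n b = {v \<in> carrier_vec n. reduce b v = v}"

definition fibre_subspace :: "nat \<Rightarrow> 'k::field point \<Rightarrow> 'k poly vec set \<Rightarrow> bool" where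
  "fibre_subspace n b L \<longleftrightarrow> L \<subseteq> fibre n b \<and> 0\<^sub>v n \<in> L \<and>
     (\<forall>v\<in>L. \<forall>w\<in>L. v + w \<in> L) \<and> (\<forall>f. \<forall>v\<in>L. reduce b (f \<cdot>\<^sub>v v) \<in> L)"

definition fibre_span :: "nat \<Rightarrow> 'k::field point \<Rightarrow> 'k poly vec set \<Rightarrow> 'k poly vec set" where
  "fibre_span n b S = \<Inter>{L. fibre_subspace n b L \<and> S \<subseteq> L}"

definition fibre_lines :: "nat \<Rightarrow> 'k::field point \<Rightarrow> 'k poly vec set set" where
  "fibre_lines n b = {L. \<exists>v \<in> fibre n b. v \<noteq> 0\<^sub>v n \<and> L = range (\<lambda>f. reduce b (f \<cdot>\<^sub>v v))}"

fun chart_matrix :: "'k::field bundle_map \<Rightarrow> 'k point \<Rightarrow> 'k poly mat" where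
  "chart_matrix \<phi> (Affine p) = fst \<phi>"
| "chart_matrix \<phi> Infinity = snd \<phi>"

definition fibre_map :: "'k::field bundle_map \<Rightarrow> 'k point \<Rightarrow> 'k poly vec \<Rightarrow> 'k poly vec" where
  "fibre_map \<phi> b v = reduce b (chart_matrix \<phi> b *\<^sub>v v)"


section \<open>Parabolic bundles\<close>

type_synonym 'k flags = "'k point \<Rightarrow> nat \<Rightarrow> 'k poly vec set"

type_synonym 'k parabolic = "'k vbundle \<times> 'k flags"

definition is_flag :: "nat \<Rightarrow> 'k::field point \<Rightarrow> (nat \<Rightarrow> 'k poly vec set) \<Rightarrow> bool" where
  "is_flag n b F \<longleftrightarrow> F 0 = fibre n b \<and> (\<forall>j. fibre_subspace n b (F j)) \<and>
     (\<forall>j. F (Suc j) \<subseteq> F j) \<and> finite {j. F j \<noteq> {0\<^sub>v n}}"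

definition is_parabolic :: "'k::field point set \<Rightarrow> 'k parabolic \<Rightarrow> bool" where
  "is_parabolic D M \<longleftrightarrow> is_bundle (fst M) \<and> (\<forall>b\<in>D. is_flag (bundle_rank (fst M)) b (snd M b))"

definition par_hom :: "'k::field point set \<Rightarrow> 'k parabolic \<Rightarrow> 'k parabolic \<Rightarrow> 'k bundle_map set" where
  "par_hom D M N = {\<phi> \<in> bundle_hom (fst M) (fst N).
     \<forall>b\<in>D. \<forall>j. fibre_map \<phi> b ` snd M b j \<subseteq> snd N b j}"

definition par_iso :: "'k::field point set \<Rightarrow> 'k parabolic \<Rightarrow> 'k parabolic \<Rightarrow> bool" where
  "par_iso D M N \<longleftrightarrow> (\<exists>\<phi> \<in> par_hom D M N. \<exists>\<psi> \<in> par_hom D N M.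
     bundle_comp \<psi> \<phi> = bundle_id (fst M) \<and> bundle_comp \<phi> \<psi> = bundle_id (fst N))"

definition par_sum :: "'k::field parabolic \<Rightarrow> 'k parabolic \<Rightarrow> 'k parabolic" where
  "par_sum M N = (bundle_sum (fst M) (fst N),
     \<lambda>b j. {v @\<^sub>v w | v w. v \<in> snd M b j \<and> w \<in> snd N b j})"

text \<open>A parabolic bundle is zero precisely when its rank is zero.\<close>

definition par_indecomposable :: "'k::field point set \<Rightarrow> 'k parabolic \<Rightarrow> bool" where
  "par_indecomposable D M \<longleftrightarrow> is_parabolic D M \<and> bundle_rank (fst M) > 0 \<and>
     \<not> (\<exists>N P. is_parabolic D N \<and> is_parabolic D P \<and>
          bundle_rank (fst N) > 0 \<and> bundle_rank (fst P) > 0 \<and> par_iso D M (par_sum N P))"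


section \<open>Extension of scalars\<close>

text \<open>
  Let \<open>\<iota>\<close> embed \<open>k\<close> into \<open>K\<close>. The inverse image of a closed point \<open>b\<close> consists of the closed
  points \<open>c\<close> over \<open>K\<close> whose prime divides that of \<open>b\<close>. For \<open>c\<close> over \<open>b\<close>, a subspace of the fibre
  at \<open>b\<close> induces the \<open>\<kappa>(c)\<close>-span of its image under reduction \<open>\<kappa>(b) \<rightarrow> \<kappa>(c)\<close>.
\<close>

fun lies_over :: "('k::field \<Rightarrow> 'l::field) \<Rightarrow> 'l point \<Rightarrow> 'k point \<Rightarrow> bool" where
  "lies_over \<iota> (Affine r) (Affine p) \<longleftrightarrow> r dvd map_poly \<iota> p"
| "lies_over \<iota> Infinity Infinity \<longleftrightarrow> True"
| "lies_over \<iota> _ _ \<longleftrightarrow> False"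

definition divisor_ext :: "('k::field \<Rightarrow> 'l::field) \<Rightarrow> 'k point set \<Rightarrow> 'l point set" where
  "divisor_ext \<iota> D = {c. closed_point c \<and> (\<exists>b\<in>D. lies_over \<iota> c b)}"

definition bundle_ext :: "('k::field \<Rightarrow> 'l::field) \<Rightarrow> 'k vbundle \<Rightarrow> 'l vbundle" where
  "bundle_ext \<iota> g = map_mat (Poly_Mapping.map \<iota>) g"

text \<open>The union below ranges over the single point of \<open>D\<close> lying under \<open>c\<close>.\<close>

definition flags_ext ::
    "('k::field \<Rightarrow> 'l::field) \<Rightarrow> nat \<Rightarrow> 'k point set \<Rightarrow> 'k flags \<Rightarrow> 'l flags" where
  "flags_ext \<iota> n D F c j = fibre_span n c
     (\<Union>b \<in> {b \<in> D. lies_over \<iota> c b}. (\<lambda>v. reduce c (map_vec (map_poly \<iota>) v)) ` F b j)"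

definition par_ext ::
    "('k::field \<Rightarrow> 'l::field) \<Rightarrow> 'k point set \<Rightarrow> 'k parabolic \<Rightarrow> 'l parabolic" where
  "par_ext \<iota> D M = (bundle_ext \<iota> (fst M), flags_ext \<iota> (bundle_rank (fst M)) D (snd M))"

definition geom_indecomposable :: "'k::field point set \<Rightarrow> 'k parabolic \<Rightarrow> bool" where
  "geom_indecomposable D M \<longleftrightarrow>
     par_indecomposable (divisor_ext to_ac D) (par_ext (to_ac :: 'k \<Rightarrow> 'k alg_closure) D M)"


section \<open>Counting parabolic structures of full flag type on a rank 2 bundle\<close>

definition line_structures :: "'k::field point set \<Rightarrow> 'k vbundle \<Rightarrow> ('k point \<Rightarrow> 'k poly vec set) set" where
  "line_structures D g = (\<Pi>\<^sub>E b\<in>D. fibre_lines (bundle_rank g) b)"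

definition line_flags :: "'k::field vbundle \<Rightarrow> ('k point \<Rightarrow> 'k poly vec set) \<Rightarrow> 'k flags" where
  "line_flags g L b j =
     (if j = 0 then fibre (bundle_rank g) b else if j = 1 then L b else {0\<^sub>v (bundle_rank g)})"

definition line_act :: "'k::field point set \<Rightarrow> 'k bundle_map \<Rightarrow>
    ('k point \<Rightarrow> 'k poly vec set) \<Rightarrow> ('k point \<Rightarrow> 'k poly vec set)" where
  "line_act D \<phi> L = (\<lambda>b\<in>D. fibre_map \<phi> b ` L b)"

definition num_geom_indecomposable :: "'k::field point set \<Rightarrow> 'k vbundle \<Rightarrow> nat" where
  "num_geom_indecomposable D g = card
     {(\<lambda>\<phi>. line_act D \<phi> L) ` bundle_aut g | L.
        L \<in> line_structures D g \<and> geom_indecomposable D (g, line_flags g L)}"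


section \<open>Permutation characters on subsets\<close>

definition subsets_of_size :: "nat \<Rightarrow> nat \<Rightarrow> nat set set" where
  "subsets_of_size l m = {A. A \<subseteq> {1..l} \<and> card A = m}"

text \<open>
  Vectors of the permutation module are functions on the set of \<open>m\<close>-subsets. A permutation \<open>w\<close>
  sends such an \<open>x\<close> to \<open>A \<mapsto> x (w\<inverse> A)\<close>, so it maps the basis vector of \<open>A\<close> to that of \<open>w A\<close>.
  The character is the trace with respect to this basis.
\<close>

definition subset_basis :: "nat set \<Rightarrow> nat set \<Rightarrow> complex" where
  "subset_basis A = (\<lambda>B. if B = A then 1 else 0)"

definition subset_rep :: "(nat \<Rightarrow> nat) \<Rightarrow> (nat set \<Rightarrow> complex) \<Rightarrow> (nat set \<Rightarrow> complex)" where
  "subset_rep w x = (\<lambda>A. x (w -` A))"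

definition subset_char :: "nat \<Rightarrow> nat \<Rightarrow> (nat \<Rightarrow> nat) \<Rightarrow> complex" where
  "subset_char l m w = (\<Sum>A\<in>subsets_of_size l m. subset_rep w (subset_basis A) A)"

definition cycle_type :: "'a set \<Rightarrow> ('a \<Rightarrow> 'a) \<Rightarrow> nat multiset" where
  "cycle_type S w = image_mset card (mset_set (orbit w ` S))"

end

theory Submission
  imports Defs "Jordan_Normal_Form.Char_Poly"
begin

text \<open>
  An idempotent endomorphism of a decomposable configuration splits the bundle into two line
  subbundles such that every line is a fibre of one of them. Over the algebraic closure a line at a
  closed point \<open>b\<close> of degree \<open>d\<close> is a point of the projective line over the fixed field of the
  \<open>d\<close>-th power of the Frobenius, and a configuration splits iff the conjugates of these points take
  at most two values (for \<open>O(a)\<^sup>2\<close>) or the finite ones are interpolated by a section of \<open>O(a - b)\<close>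
  (for \<open>a > b\<close>). If the configuration does not split, its stabilizer consists of the scalars, so the
  number of orbits is a count of nonsplit configurations divided by the order of the projective
  automorphism group. Expanding the product of the \<open>q\<^bsup>d\<^esup> + 1\<close> over the points of the divisor
  as a sum over subsets turns these counts into sums of \<open>\<chi>\<^sup>l\<^sub>s(w)\<close>, the number of \<open>w\<close>-stable
  subsets of size \<open>s\<close>.
\<close>

section \<open>The Frobenius and conjugate roots\<close>

hide_const (open) up_ring.coeff up_ring.monom Module.smult Coset.order Divisibility.irreducible

text \<open>Splitting is tested over the closure, while the orbits are taken over k, so it matters
  where a splitting is defined. For a > b it descends: O(a) is preserved by every automorphism, and
  a complement through at least n + 1 finite geometric values, n = a - b, is unique and hence fixed
  by Frobenius. Up to n + 1 finite values can always be interpolated, whence the threshold a - b +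
  2. For \<open>O(a)^2\<close> the two summands may be exchanged by Frobenius and exist only over
  the quadratic extension; this can happen only if every \<open>d_i\<close> is even. On the
  character side the same alternative is the difference between the numbers of subsets of even and
  of odd degree, the product of the \<open>1 + (-1)^d_i\<close>, which vanishes unless all
  \<open>d_i\<close> are even.

  The summands of a decomposition are arbitrary transition matrices. Passing to an idempotent of the
  given bundle avoids classifying them, because only the endomorphisms of O(a) + O(b) have to be
  known, and these are explicit.\<close>

interpretation ac: field_hom "to_ac :: 'k::field \<Rightarrow> 'k alg_closure"
  by unfold_locales auto

interpretation ac_poly: map_poly_inj_idom_hom "to_ac :: 'k::field \<Rightarrow> 'k alg_closure" ..

text \<open>Multiplication by x \<noteq> 0 permutes the nonzero elements, so it leaves their product
  unchanged; the extra factor x turns the exponent q - 1 into q.\<close>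

lemma pow_card_UNIV: "x ^ card (UNIV :: 'k set) = (x :: 'k::{field,finite})"
proof (cases "x = 0")
  case False
  have "x * (\<Prod>y\<in>UNIV-{0}. x * y) = x * x ^ (card (UNIV :: 'k set) - 1) * \<Prod>(UNIV-{0})"
    by (simp add: prod.distrib mult_ac)
  also have "x * x ^ (card (UNIV :: 'k set) - 1) = x ^ Suc (card (UNIV :: 'k set) - 1)"
    by (subst power_Suc) auto
  also have "Suc (card (UNIV :: 'k set) - 1) = card (UNIV :: 'k set)"
    using finite_UNIV_card_ge_0[where ?'a = 'k] by simp
  also have "(\<Prod>y\<in>UNIV-{0}. x * y) = (\<Prod>y\<in>UNIV-{0}. y)"
    by (rule prod.reindex_bij_witness[of _ "\<lambda>y. y / x" "\<lambda>y. x * y"]) (use False in auto)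
  finally show ?thesis by simp
qed (use finite_UNIV_card_ge_0[where ?'a = 'k] in auto)

lemma card_UNIV_gt_1: "card (UNIV :: 'k::{field,finite} set) > 1"
proof -
  have "card {0, 1 :: 'k} \<le> card (UNIV :: 'k set)" by (rule card_mono) auto
  thus ?thesis by simp
qed

text \<open>Translation by 1 permutes the field, so summing c + 1 and summing c give the same
  result. This makes the derivative of \<open>X^(q^2) - X\<close> equal to -1 further below.\<close>

lemma of_nat_card_UNIV: "of_nat (card (UNIV :: 'k::{field,finite} set)) = (0 :: 'k)"
proof -
  have "(\<Sum>c\<in>(UNIV::'k set). c + 1) = (\<Sum>c\<in>(UNIV::'k set). c)"
    by (rule sum.reindex_bij_witness[of _ "\<lambda>c. c - 1" "\<lambda>c. c + 1"]) auto
  thus ?thesis by (simp add: sum.distrib)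
qed

definition frob :: "'k::{field,finite} alg_closure \<Rightarrow> 'k alg_closure" where
  "frob x = x ^ card (UNIV :: 'k set)"

lemma frob_to_ac [simp]: "frob (to_ac c) = to_ac c"
  by (simp add: frob_def pow_card_UNIV flip: to_ac_power)

lemma card_range_to_ac: "card (range (to_ac :: 'k::{field,finite} \<Rightarrow> _)) = card (UNIV :: 'k set)"
  by (rule card_image) (simp add: inj_to_ac)

lemma degree_pow_minus_X:
  assumes "n > 1"
  shows "degree (monom 1 n - monom 1 1 :: 'l::field poly) = n"
    and "lead_coeff (monom 1 n - monom 1 1 :: 'l::field poly) = 1"
proof -
  have "degree (monom 1 n - monom 1 1 :: 'l poly) = degree (monom 1 n :: 'l poly)"
    by (subst diff_conv_add_uminus, rule degree_add_eq_left) (use assms in \<open>simp_all add: degree_monom_eq\<close>)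
  thus 1: "degree (monom 1 n - monom 1 1 :: 'l::field poly) = n"
    by (simp add: degree_monom_eq)
  show "lead_coeff (monom 1 n - monom 1 1 :: 'l::field poly) = 1"
    unfolding 1 using assms by (cases "n = 1") (auto simp: coeff_monom)
qed

lemma finite_pow_eq_self:
  assumes "n > 1"
  shows "finite {x :: 'l::field. x ^ n = x}" and "card {x :: 'l::field. x ^ n = x} \<le> n"
proof -
  let ?p = "monom 1 n - monom 1 1 :: 'l poly"
  have nz: "?p \<noteq> 0" using degree_pow_minus_X(1)[OF assms, where ?'l = 'l] assms by (metis degree_0 not_one_less_zero)
  have eq: "{x. poly ?p x = 0} = {x. x ^ n = x}" by (auto simp: poly_monom)
  show "finite {x :: 'l::field. x ^ n = x}"
    using poly_roots_finite[OF nz] unfolding eq .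
  show "card {x :: 'l::field. x ^ n = x} \<le> n"
    using card_poly_roots_bound[OF nz] unfolding eq degree_pow_minus_X(1)[OF assms] .
qed

text \<open>The elements of k already supply q roots of \<open>X^q - X\<close>, and there can be no
  more.\<close>

lemma frob_eq_self_iff: "frob y = y \<longleftrightarrow> y \<in> range to_ac"
proof -
  have "range to_ac = {y :: 'a alg_closure. frob y = y}"
  proof (rule card_seteq)
    show "finite {y :: 'a alg_closure. frob y = y}"
      unfolding frob_def by (rule finite_pow_eq_self) (rule card_UNIV_gt_1)
    show "card {y :: 'a alg_closure. frob y = y} \<le> card (range (to_ac :: 'a \<Rightarrow> _))"
      unfolding frob_def card_range_to_ac by (rule finite_pow_eq_self) (rule card_UNIV_gt_1)
  qed auto
  thus ?thesis by auto
qed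

text \<open>\<open>X\<^sup>q - X\<close> is the product of all \<open>X - c\<close>, hence invariant under translation by \<open>k\<close>. This makes
  the Frobenius additive without appealing to the fact that \<open>q\<close> is a prime power.\<close>

lemma frob_minus_self: "frob y - y = (\<Prod>c\<in>(UNIV :: 'k::{field,finite} set). y - to_ac c)"
proof -
  let ?q = "card (UNIV :: 'k set)"
  let ?P = "\<Prod>c\<in>(UNIV :: 'k set). [:- to_ac c, 1:]"
  have deg: "degree ?P = ?q" by (subst degree_prod_eq_sum_degree) auto
  have lc: "lead_coeff ?P = 1" by (subst lead_coeff_prod) auto
  have "monom 1 ?q - monom 1 1 = ?P"
  proof (rule poly_eqI_degree_lead_coeff[where n = ?q and A = "range to_ac"])
    show "poly.coeff (monom 1 ?q - monom 1 1) ?q = poly.coeff ?P ?q"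
      using lc degree_pow_minus_X[OF card_UNIV_gt_1[where ?'k='k], where ?'l = "'k alg_closure"] by (simp add: deg)
    show "degree (monom 1 ?q - monom 1 1 :: 'k alg_closure poly) \<le> ?q"
      using degree_pow_minus_X[OF card_UNIV_gt_1[where ?'k='k], where ?'l = "'k alg_closure"] by simp
    fix z assume "z \<in> range (to_ac :: 'k \<Rightarrow> _)"
    then obtain c :: 'k where z: "z = to_ac c" by auto
    have "poly ?P z = 0" by (auto simp: poly_prod z prod_zero_iff)
    thus "poly (monom 1 ?q - monom 1 1) z = poly ?P z"
      using frob_to_ac[of c] by (simp add: z poly_monom frob_def)
  qed (auto simp: deg card_range_to_ac)
  hence "poly (monom 1 ?q - monom 1 1) y = poly ?P y" by (rule arg_cong)
  thus ?thesis by (simp add: poly_monom frob_def poly_prod)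
qed

lemma frob_add_to_ac: "frob (to_ac c + y) = to_ac c + frob y"
proof -
  have "frob (to_ac c + y) - (to_ac c + y) = (\<Prod>d\<in>UNIV. y - to_ac (d - c))"
    unfolding frob_minus_self by (rule prod.cong) auto
  also have "\<dots> = (\<Prod>d\<in>UNIV. y - to_ac d)"
    by (rule prod.reindex_bij_witness[of _ "\<lambda>d. d + c" "\<lambda>d. d - c"]) auto
  also have "\<dots> = frob y - y" by (simp add: frob_minus_self)
  finally show ?thesis by (simp add: algebra_simps)
qed

text \<open>As polynomials in X, \<open>(X + y)^q\<close> and \<open>X^q + y^q\<close> have the same
  coefficient in degree q and agree on the q elements of k by \<open>frob_add_to_ac\<close>; their
  difference has degree below q and q roots, so it is zero.\<close>

lemma frob_add: "frob (x + y) = frob x + frob (y :: 'k::{field,finite} alg_closure)"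
proof -
  let ?q = "card (UNIV :: 'k set)"
  have q: "?q > 1" by (rule card_UNIV_gt_1)
  have "[:y, 1:] ^ ?q = monom 1 ?q + [:frob y:]"
  proof (rule poly_eqI_degree_lead_coeff[where n = ?q and A = "range to_ac"])
    have "degree ([:y, 1:] ^ ?q) = ?q" by (simp add: degree_power_eq)
    moreover have "lead_coeff ([:y, 1:] ^ ?q) = 1" by (simp add: lead_coeff_power)
    ultimately show "poly.coeff ([:y, 1:] ^ ?q) ?q = poly.coeff (monom 1 ?q + [:frob y:]) ?q"
      using q by (simp add: coeff_eq_0)
    show "degree ([:y, 1:] ^ ?q) \<le> ?q" by (simp add: degree_power_eq)
    show "degree (monom 1 ?q + [:frob y:]) \<le> ?q"
      by (rule degree_add_le) (auto simp: degree_monom_eq)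
    fix z assume "z \<in> range (to_ac :: 'k \<Rightarrow> _)"
    then obtain c :: 'k where z: "z = to_ac c" by auto
    show "poly ([:y, 1:] ^ ?q) z = poly (monom 1 ?q + [:frob y:]) z"
      using frob_add_to_ac[of c y] frob_to_ac[of c]
      by (simp add: z poly_monom frob_def poly_power add_ac)
  qed (auto simp: card_range_to_ac)
  hence "poly ([:y, 1:] ^ ?q) x = poly (monom 1 ?q + [:frob y:]) x" by (rule arg_cong)
  thus ?thesis by (simp add: poly_monom frob_def poly_power add_ac)
qed

interpretation frob: field_hom "frob :: 'k::{field,finite} alg_closure \<Rightarrow> _"
proof unfold_locales
  show "frob (0 :: 'k alg_closure) = 0"
    using card_UNIV_gt_1[where ?'k = 'k] by (simp add: frob_def)
  show "frob (1 :: 'k alg_closure) = 1" by (simp add: frob_def)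
  show "frob (x + y) = frob x + frob y" for x y :: "'k alg_closure" by (rule frob_add)
  show "frob (x * y) = frob x * frob y" for x y :: "'k alg_closure" by (simp add: frob_def power_mult_distrib)
qed

interpretation frob_poly: map_poly_inj_idom_hom "frob :: 'k::{field,finite} alg_closure \<Rightarrow> _" ..

lemma frob_funpow: "(frob ^^ j) (x :: 'k::{field,finite} alg_closure) = x ^ (card (UNIV :: 'k set) ^ j)"
proof (induction j)
  case (Suc j)
  thus ?case unfolding frob_def by (simp add: mult.commute flip: power_mult)
qed simp

lemma frob_divide: "frob (x / y) = frob x / frob y"
  by (simp add: frob_def power_divide)

lemma frob_funpow_eq_iff [simp]: "(frob ^^ j) x = (frob ^^ j) y \<longleftrightarrow> x = y"
  by (induction j) auto

lemma frob_poly: "frob (poly f x) = poly (map_poly frob f) (frob x)"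
  by simp

lemma map_poly_frob_to_ac [simp]: "map_poly frob (map_poly to_ac f) = map_poly to_ac f"
  by (rule poly_eqI) simp

text \<open>Descent from the closure to k, coefficient by coefficient.\<close>

lemma map_poly_frob_eq_self:
  assumes "map_poly frob f = f"
  obtains g where "f = map_poly to_ac g"
proof
  show "f = map_poly to_ac (map_poly of_ac f)"
  proof (rule poly_eqI)
    fix n
    have "frob (poly.coeff f n) = poly.coeff f n" by (metis assms frob.coeff_map_poly_hom)
    hence "poly.coeff f n \<in> range to_ac" by (simp add: frob_eq_self_iff)
    thus "poly.coeff f n = poly.coeff (map_poly to_ac (map_poly of_ac f)) n"
      by (simp add: coeff_map_poly to_ac_of_ac)
  qed
qed

lemma frob_poly_to_ac [simp]: "frob (poly (map_poly to_ac f) x) = poly (map_poly to_ac f) (frob x)"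
  using frob_poly[of "map_poly to_ac f" x] by simp

lemma frob_funpow_poly_to_ac:
  "(frob ^^ j) (poly (map_poly to_ac f) x) = poly (map_poly to_ac f) ((frob ^^ j) x)"
  by (induction j) auto

text \<open>A nonzero polynomial of least degree vanishing at \<theta> divides every polynomial that
  vanishes there, by division with remainder. It divides p without being a unit, so irreducibility
  makes it an associate of p.\<close>

lemma irreducible_dvd_of_root:
  fixes p g :: "'k::field poly"
  assumes "irreducible p" and "poly (map_poly to_ac p) \<theta> = 0" and "poly (map_poly to_ac g) \<theta> = 0"
  shows "p dvd g"
proof -
  define P where "P = (\<lambda>f::'k poly. f \<noteq> 0 \<and> poly (map_poly to_ac f) \<theta> = 0)"
  have p0: "p \<noteq> 0" using assms(1) by auto
  have "P p" using p0 assms(2) by (simp add: P_def)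
  define f where "f = arg_min degree P"
  have "P f \<and> (\<forall>g. P g \<longrightarrow> degree f \<le> degree g)"
    unfolding f_def by (rule arg_min_nat_lemma[of P, OF \<open>P p\<close>])
  hence Pf: "P f" and min: "\<And>g. P g \<Longrightarrow> degree f \<le> degree g" by auto
  have dvd: "f dvd h" if "poly (map_poly to_ac h) \<theta> = 0" for h
  proof (rule ccontr)
    assume "\<not> f dvd h"
    hence nz: "h mod f \<noteq> 0" by (simp add: dvd_eq_mod_eq_0)
    have "h mod f = h - (h div f) * f" by (simp add: minus_div_mult_eq_mod)
    hence "map_poly to_ac (h mod f) = map_poly to_ac (h - (h div f) * f)" by (rule arg_cong)
    also have "\<dots> = map_poly to_ac h - map_poly to_ac (h div f) * map_poly to_ac f"
      by (simp only: ac_poly.hom_minus ac_poly.hom_mult)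
    finally have "poly (map_poly to_ac (h mod f)) \<theta> =
        poly (map_poly to_ac h) \<theta> - poly (map_poly to_ac (h div f)) \<theta> * poly (map_poly to_ac f) \<theta>"
      by (simp only: poly_diff poly_mult)
    also have "\<dots> = 0" using that Pf unfolding P_def by simp
    finally have "degree f \<le> degree (h mod f)" using nz by (intro min) (simp add: P_def)
    moreover have "h mod f = 0 \<or> degree (h mod f) < degree f"
      by (rule degree_mod_less) (use Pf in \<open>simp add: P_def\<close>)
    ultimately show False using nz by simp
  qed
  have "\<exists>h. p = f * h" using dvd[OF assms(2)] by (simp only: dvd_def)
  then obtain h where h: "p = f * h" ..
  have nu: "\<not> is_unit f"
  proof
    assume "is_unit f"
    then have "\<exists>c. f = [:c:] \<and> c dvd 1" by (simp only: is_unit_poly_iff)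
    then obtain c where c: "f = [:c:]" "c \<noteq> 0" by (metis dvd_0_left zero_neq_one)
    have "P [:c:]" using Pf by (simp only: c(1))
    thus False using c(2) by (simp add: P_def)
  qed
  have "is_unit h" using Factorial_Ring.irreducibleD[OF assms(1) h] by (rule disjE) (simp_all only: nu not_False_eq_True)
  hence "p dvd f" by (subst h) (simp only: mult_unit_dvd_iff dvd_refl)
  thus ?thesis using dvd[OF assms(3)] by (rule dvd_trans)
qed

section \<open>Conjugate roots of an irreducible polynomial and its residue field\<close>

locale geometric_root =
  fixes p :: "'k::{field,finite} poly" and \<theta> :: "'k alg_closure"
  assumes irred: "irreducible p" and root: "poly (map_poly to_ac p) \<theta> = 0"
begin

lemma p_nonzero: "p \<noteq> 0"
  using irred by auto

lemma degree_pos: "degree p > 0"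
proof (rule ccontr)
  assume "\<not> degree p > 0"
  then obtain c where c: "p = [:c:]" by (metis degree_eq_zeroE gr0I)
  thus False using root p_nonzero unfolding c by simp
qed

lemma root_iff_dvd: "poly (map_poly to_ac g) \<theta> = 0 \<longleftrightarrow> p dvd g"
proof
  assume "p dvd g"
  then have "\<exists>h. g = p * h" by (simp only: dvd_def)
  then obtain h where "g = p * h" ..
  thus "poly (map_poly to_ac g) \<theta> = 0" using root by (simp add: ac_poly.hom_mult)
qed (rule irreducible_dvd_of_root[OF irred root])

lemma poly_mod: "poly (map_poly to_ac (g mod p)) \<theta> = poly (map_poly to_ac g) \<theta>"
proof -
  have "p dvd g mod p - g" by (simp add: mod_eq_dvd_iff[symmetric])
  hence "poly (map_poly to_ac (g mod p - g)) \<theta> = 0" by (simp only: root_iff_dvd)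
  hence "poly (map_poly to_ac (g mod p) - map_poly to_ac g) \<theta> = 0"
    by (simp only: ac_poly.hom_minus)
  thus ?thesis by (simp only: poly_diff right_minus_eq)
qed

abbreviation "conj_roots \<equiv> {x. poly (map_poly to_ac p) x = 0}"

lemma finite_conj_roots: "finite conj_roots"
  by (rule poly_roots_finite) (use p_nonzero in simp)

text \<open>The product of X - x over the Frobenius orbit of \<theta> is fixed by Frobenius, so it
  comes from k and is divisible by p. Hence deg p is at most the orbit size, which is at most the
  number of roots, which is at most deg p.\<close>

lemma conj_roots_eq_orbit: "conj_roots = range (\<lambda>j. (frob ^^ j) \<theta>)"
  and card_conj_roots: "card conj_roots = degree p"
proof -
  define Orb where "Orb = range (\<lambda>j. (frob ^^ j) \<theta>)"
  have sub: "Orb \<subseteq> conj_roots"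
    unfolding Orb_def
  proof safe
    fix j show "poly (map_poly to_ac p) ((frob ^^ j) \<theta>) = 0"
    proof (induction j)
      case (Suc j)
      have "poly (map_poly to_ac p) (frob ((frob ^^ j) \<theta>)) = frob (poly (map_poly to_ac p) ((frob ^^ j) \<theta>))"
        by (rule frob_poly_to_ac[symmetric])
      thus ?case using Suc by simp
    qed (use root in simp)
  qed
  have fin: "finite Orb" using finite_subset[OF sub finite_conj_roots] .
  have img: "frob ` Orb = Orb"
  proof (rule endo_inj_surj[OF fin])
    have "frob ((frob ^^ j) \<theta>) \<in> Orb" for j
      unfolding Orb_def by (rule range_eqI[of _ _ "Suc j"]) simp
    thus "frob ` Orb \<subseteq> Orb" unfolding Orb_def by auto
  qed (auto intro: inj_onI)
  define m where "m = (\<Prod>x\<in>Orb. [:- x, 1:])"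
  have "map_poly frob m = (\<Prod>x\<in>Orb. [:- frob x, 1:])"
    unfolding m_def frob_poly.hom_prod by (simp add: frob.hom_uminus)
  also have "\<dots> = (\<Prod>x\<in>frob ` Orb. [:- x, 1:])"
    by (subst prod.reindex) (auto intro: inj_onI)
  also have "\<dots> = m" by (simp add: img m_def)
  finally obtain m0 where m0: "m = map_poly to_ac m0" by (rule map_poly_frob_eq_self)
  have dm: "degree m = card Orb" unfolding m_def by (subst degree_prod_eq_sum_degree) auto
  have "\<theta> \<in> Orb" unfolding Orb_def by (rule range_eqI[of _ _ 0]) simp
  hence "poly m \<theta> = 0" using fin by (auto simp: m_def poly_prod prod_zero_iff)
  hence "p dvd m0" by (simp add: m0 root_iff_dvd)
  moreover have "m0 \<noteq> 0"
  proof
    assume "m0 = 0"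
    hence "m = 0" by (simp add: m0)
    thus False using fin by (auto simp: m_def prod_zero_iff)
  qed
  ultimately have "degree p \<le> card Orb"
    using dm dvd_imp_degree_le[of p m0] by (simp add: m0)
  moreover have "card conj_roots \<le> degree p"
    using card_poly_roots_bound[of "map_poly to_ac p"] p_nonzero by simp
  ultimately have le: "card conj_roots \<le> card Orb" "card Orb \<le> card conj_roots" "card conj_roots = degree p"
    using card_mono[OF finite_conj_roots sub] by auto
  show "conj_roots = range (\<lambda>j. (frob ^^ j) \<theta>)"
    using card_seteq[OF finite_conj_roots sub le(1)] by (simp add: Orb_def)
  show "card conj_roots = degree p" by fact
qed

text \<open>By pigeonhole the iterates up to d = deg p repeat, which gives a period e \<le> d. A
  period e bounds the orbit by e, but the orbit has d elements, so e = d.\<close>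

lemma frob_funpow_degree: "(frob ^^ degree p) \<theta> = \<theta>"
proof -
  let ?d = "degree p" and ?g = "\<lambda>j. (frob ^^ j) \<theta>"
  have "\<not> inj_on ?g {..?d}"
  proof
    assume "inj_on ?g {..?d}"
    hence "card (?g ` {..?d}) = Suc ?d" by (simp add: card_image)
    moreover have "card (?g ` {..?d}) \<le> card conj_roots"
      by (rule card_mono[OF finite_conj_roots]) (auto simp: conj_roots_eq_orbit)
    ultimately show False by (simp add: card_conj_roots)
  qed
  then obtain i j where ij: "i < j" "j \<le> ?d" "?g i = ?g j"
    unfolding inj_on_def by (metis atMost_iff linorder_neqE_nat)
  define e where "e = j - i"
  have "?g j = (frob ^^ i) (?g e)" using ij by (simp add: e_def flip: funpow_add[THEN fun_cong, unfolded o_apply])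
  hence e: "?g e = \<theta>" using ij by simp
  have epos: "e > 0" "e \<le> ?d" using ij by (auto simp: e_def)
  have "?g (j mod e) = ?g j" for j
  proof -
    have "?g (e * t) = \<theta>" for t
      by (induction t) (auto simp: e funpow_add)
    hence "?g (j mod e + e * t) = ?g (j mod e)" for t by (simp add: funpow_add)
    from this[of "j div e"] show ?thesis by (simp only: mod_mult_div_eq)
  qed
  hence "conj_roots \<subseteq> ?g ` {..<e}" unfolding conj_roots_eq_orbit using epos
    by (metis (mono_tags, lifting) image_eqI image_subsetI lessThan_iff mod_less_divisor)
  hence "card conj_roots \<le> e" by (metis card_lessThan finite_lessThan surj_card_le)
  hence "e = ?d" using epos by (simp add: card_conj_roots)
  thus ?thesis using e by simp
qed

end

lemma bij_betw_poly_coeffs: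
  "bij_betw (\<lambda>f. \<lambda>i\<in>{..n}. poly.coeff f i) {f :: 'k::zero poly. degree f \<le> n} (PiE {..n} (\<lambda>_. UNIV))"
proof (rule bij_betwI')
  fix f g :: "'k poly" assume fg: "f \<in> {f. degree f \<le> n}" "g \<in> {f. degree f \<le> n}"
  show "((\<lambda>i\<in>{..n}. poly.coeff f i) = (\<lambda>i\<in>{..n}. poly.coeff g i)) = (f = g)"
  proof
    assume eq: "(\<lambda>i\<in>{..n}. poly.coeff f i) = (\<lambda>i\<in>{..n}. poly.coeff g i)"
    show "f = g"
    proof (rule poly_eqI)
      fix i show "poly.coeff f i = poly.coeff g i"
      proof (cases "i \<le> n")
        case True thus ?thesis using fun_cong[OF eq, of i] by simp
      next
        case False thus ?thesis using fg by (simp add: coeff_eq_0)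
      qed
    qed
  qed simp
next
  fix h :: "nat \<Rightarrow> 'k" assume h: "h \<in> PiE {..n} (\<lambda>_. UNIV)"
  have nz: "finite {i. (if i \<le> n then h i else 0) \<noteq> 0}" by (rule finite_subset[of _ "{..n}"]) auto
  define f where "f = Abs_poly (\<lambda>i. if i \<le> n then h i else 0)"
  have cf: "poly.coeff f = (\<lambda>i. if i \<le> n then h i else 0)"
    unfolding f_def using nz by (intro coeff_Abs_poly[where n = n]) auto
  show "\<exists>x\<in>{f. degree f \<le> n}. h = (\<lambda>i\<in>{..n}. poly.coeff x i)"
  proof (rule bexI[of _ f])
    show "h = (\<lambda>i\<in>{..n}. poly.coeff f i)" using h by (auto simp: cf fun_eq_iff PiE_def extensional_def)
    show "f \<in> {f. degree f \<le> n}" by (auto intro!: degree_le simp: cf)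
  qed
qed auto

lemma card_degree_le: "card {f :: 'k::{zero,finite} poly. degree f \<le> n} = card (UNIV :: 'k set) ^ (n + 1)"
  using bij_betw_same_card[OF bij_betw_poly_coeffs[where ?'k='k, of n]] by (simp add: card_PiE)

lemma finite_degree_le: "finite {f :: 'k::{zero,finite} poly. degree f \<le> n}"
  using bij_betw_finite[OF bij_betw_poly_coeffs[where ?'k='k, of n]] by (simp add: finite_PiE)

context geometric_root
begin

lemma reduced_iff: "x mod p = x \<longleftrightarrow> degree x < degree p"
  using degree_mod_less'[of p x] p_nonzero degree_pos mod_poly_less[of x p] by (metis degree_0)

lemma card_reduced: "card {x. x mod p = x} = card (UNIV :: 'k set) ^ degree p"
proof -
  have "{x. x mod p = x} = {x. degree x \<le> degree p - 1}"
    using degree_pos by (auto simp: reduced_iff)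
  thus ?thesis using degree_pos by (simp add: card_degree_le)
qed

lemma reduced_root_iff:
  assumes "x mod p = x"
  shows "poly (map_poly to_ac x) \<theta> = 0 \<longleftrightarrow> x = 0"
  using assms by (auto simp: root_iff_dvd dvd_eq_mod_eq_0)

text \<open>Evaluation at \<theta> is injective on the \<open>q^d\<close> reduced residues and lands
  among the roots of \<open>X^(q^d) - X\<close>, of which there are at most \<open>q^d\<close>. This
  realises the residue field as a subfield of the closure and counts that subfield at once.\<close>

lemma bij_betw_residue:
  "bij_betw (\<lambda>x. poly (map_poly to_ac x) \<theta>) {x. x mod p = x} {y. (frob ^^ degree p) y = y}"
  and card_frob_fixed: "card {y :: 'k alg_closure. (frob ^^ degree p) y = y} = card (UNIV :: 'k set) ^ degree p"
proof -
  let ?q = "card (UNIV :: 'k set)" and ?T = "{y :: 'k alg_closure. (frob ^^ degree p) y = y}"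
  let ?e = "\<lambda>x. poly (map_poly to_ac x) \<theta>"
  have q: "?q ^ degree p > 1" by (rule one_less_power[OF card_UNIV_gt_1 degree_pos])
  have fin: "finite ?T" and le: "card ?T \<le> ?q ^ degree p"
    unfolding frob_funpow using finite_pow_eq_self[OF q, where ?'l = "'k alg_closure"] by auto
  have inj: "inj_on ?e {x. x mod p = x}"
  proof (rule inj_onI)
    fix x y assume xy: "x \<in> {x. x mod p = x}" "y \<in> {x. x mod p = x}" "?e x = ?e y"
    have "(x - y) mod p = x - y" using xy by (simp add: poly_mod_diff_left)
    moreover have "?e (x - y) = 0" using xy by (simp add: ac_poly.hom_minus)
    ultimately show "x = y" using reduced_root_iff[of "x - y"] by simp
  qed
  have img: "?e ` {x. x mod p = x} \<subseteq> ?T"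
    by (auto simp: frob_funpow_poly_to_ac frob_funpow_degree)
  have c: "card (?e ` {x. x mod p = x}) = ?q ^ degree p"
    using card_image[OF inj] card_reduced by simp
  have "?e ` {x. x mod p = x} = ?T"
    by (rule card_seteq[OF fin img]) (simp add: c le)
  thus "bij_betw ?e {x. x mod p = x} ?T" "card ?T = ?q ^ degree p"
    using inj c by (auto simp: bij_betw_def)
qed

end

text \<open>Applying \<open>card_frob_fixed\<close> would require an irreducible quadratic. Instead
  \<open>X^(q^2) - X\<close> is shown to be separable: its derivative is -1 since q = 0 in k, so no
  linear factor repeats. The exact count is used for the conjugate pairs of values.\<close>

lemma card_frob2_fixed: "card {y :: 'k::{field,finite} alg_closure. frob (frob y) = y} = card (UNIV :: 'k set) ^ 2"
proof -
  let ?Q = "card (UNIV :: 'k set) ^ 2"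
  let ?f = "monom 1 ?Q - monom 1 1 :: 'k alg_closure poly"
  have Q: "?Q > 1" by (rule one_less_power[OF card_UNIV_gt_1]) simp
  have "of_nat (card (UNIV :: 'k set)) = (0 :: 'k alg_closure)"
    using of_nat_card_UNIV[where ?'k='k] by (metis to_ac_0 to_ac_of_nat)
  hence pd: "pderiv ?f = - 1"
    by (simp add: pderiv_diff pderiv_monom power2_eq_square monom_0 one_pCons)
  have f0: "?f \<noteq> 0" using degree_pow_minus_X(1)[OF Q, where ?'l = "'k alg_closure"] Q by (metis degree_0 not_one_less_zero)
  obtain A where A: "size A = degree ?f" "?f = smult (lead_coeff ?f) (\<Prod>x\<in>#A. [:- x, 1:])"
    using alg_closed_imp_factorization[OF f0] by blast
  have fA: "?f = (\<Prod>x\<in>#A. [:- x, 1:])"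
    using A(2) unfolding degree_pow_minus_X(2)[OF Q] by simp
  have count: "count A x \<le> 1" for x
  proof (rule ccontr)
    assume "\<not> count A x \<le> 1"
    hence "{#x, x#} \<subseteq># A" by (auto simp: subseteq_mset_def)
    then obtain B where B: "A = {#x, x#} + B" by (metis subset_mset.less_eqE)
    define G where "G = (\<Prod>x\<in>#B. [:- x, 1:])"
    have "?f = [:-x,1:] * ([:-x,1:] * G)" unfolding fA B G_def by (simp only: image_mset_union prod_mset_Un image_mset_add_mset prod_mset.add_mset image_mset_empty prod_mset_empty mult_1_right mult.assoc)
    hence "pderiv ?f = pderiv ([:-x,1:] * ([:-x,1:] * G))" by (rule arg_cong)
    moreover have "poly (pderiv ([:-x,1:] * ([:-x,1:] * G))) x = 0"
      by (simp only: pderiv_mult poly_add poly_mult) simp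
    ultimately have "poly (- 1 :: 'k alg_closure poly) x = 0" by (simp only: pd)
    thus False by simp
  qed
  have "set_mset A = {y. frob (frob y) = y}"
  proof -
    have "x \<in># A \<longleftrightarrow> poly ?f x = 0" for x
      unfolding fA by (induction A) auto
    moreover have "poly ?f x = 0 \<longleftrightarrow> frob (frob x) = x" for x
      by (simp add: poly_monom frob_def power2_eq_square power_mult)
    ultimately show ?thesis by auto
  qed
  moreover have "card (set_mset A) = size A"
  proof -
    have "count A x = 1" if "x \<in># A" for x
      using count[of x] that by (metis One_nat_def Suc_leI count_greater_zero_iff le_antisym)
    thus ?thesis unfolding size_multiset_overloaded_eq by simp
  qed
  ultimately show ?thesis using A(1) degree_pow_minus_X(1)[OF Q, where ?'l = "'k alg_closure"] by simp
qed

text \<open>Newton's scheme: a new node is served by a multiple of the product of X - x over the old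
  ones. The bound is put on coefficients instead of the degree so that it says f = 0 when A is
  empty.\<close>

lemma interpolation:
  fixes v :: "'l::field \<Rightarrow> 'l"
  assumes "finite A"
  shows "\<exists>f. (\<forall>x\<in>A. poly f x = v x) \<and> (\<forall>i\<ge>card A. poly.coeff f i = 0)"
  using assms
proof (induction A rule: finite_induct)
  case (insert a A)
  then obtain f where f: "\<forall>x\<in>A. poly f x = v x" "\<forall>i\<ge>card A. poly.coeff f i = 0" by blast
  define m where "m = (\<Prod>x\<in>A. [:- x, 1:])"
  have dm: "degree m = card A" unfolding m_def by (subst degree_prod_eq_sum_degree) auto
  have ma: "poly m a \<noteq> 0" using insert.hyps by (auto simp: m_def poly_prod prod_zero_iff)
  have mA: "poly m x = 0" if "x \<in> A" for x
    using that insert.hyps by (auto simp: m_def poly_prod prod_zero_iff)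
  show ?case
  proof (rule exI[of _ "f + smult ((v a - poly f a) / poly m a) m"], safe)
    fix i assume "card (insert a A) \<le> i"
    thus "poly.coeff (f + smult ((v a - poly f a) / poly m a) m) i = 0"
      using f(2) insert.hyps by (simp add: coeff_eq_0 dm)
  qed (use f ma mA in auto)
qed (auto intro: exI[of _ 0])

section \<open>Endomorphisms of a split bundle of rank two\<close>

definition vec2 :: "'a \<Rightarrow> 'a \<Rightarrow> 'a vec" where
  "vec2 x y = vec 2 (\<lambda>i. if i = 0 then x else y)"

definition mat2 :: "'a \<Rightarrow> 'a \<Rightarrow> 'a \<Rightarrow> 'a \<Rightarrow> 'a mat" where
  "mat2 a b c d = mat 2 2 (\<lambda>(i, j). if i = 0 then (if j = 0 then a else b) else (if j = 0 then c else d))"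

lemma less_2_cases_nat: "i < (2::nat) \<longleftrightarrow> i = 0 \<or> i = 1"
  by auto

lemma vec2_carrier [simp]: "vec2 x y \<in> carrier_vec 2"
  by (simp add: vec2_def)

lemma dim_vec2 [simp]: "dim_vec (vec2 x y) = 2"
  by (simp add: vec2_def)

lemma vec2_index [simp]: "vec2 x y $ 0 = x" "vec2 x y $ 1 = y" "vec2 x y $ Suc 0 = y"
  by (simp_all add: vec2_def)

lemma vec2_eq_iff [simp]: "vec2 x y = vec2 x' y' \<longleftrightarrow> x = x' \<and> y = y'"
  by (metis vec2_index(1,2))

lemma vec2_cases:
  assumes "v \<in> carrier_vec 2"
  obtains x y where "v = vec2 x y"
proof
  show "v = vec2 (v $ 0) (v $ 1)"
    by (rule eq_vecI) (use assms in \<open>auto simp: less_2_cases_nat\<close>)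
qed

lemma vec2_zero: "vec2 0 0 = 0\<^sub>v 2"
  by (rule eq_vecI) (auto simp: less_2_cases_nat)

lemma vec2_eq_zero_iff [simp]: "vec2 x y = 0\<^sub>v 2 \<longleftrightarrow> x = 0 \<and> y = 0"
  by (simp flip: vec2_zero)

lemma vec2_add [simp]: "vec2 x y + vec2 x' y' = vec2 (x + x') (y + y')"
  by (rule eq_vecI) (auto simp: less_2_cases_nat)

lemma vec2_smult [simp]: "c \<cdot>\<^sub>v vec2 x y = vec2 (c * x) (c * y)"
  by (rule eq_vecI) (auto simp: less_2_cases_nat)

lemma map_vec2 [simp]: "map_vec F (vec2 x y) = vec2 (F x) (F y)"
  by (rule eq_vecI) (auto simp: less_2_cases_nat)

lemma mat2_carrier [simp]: "mat2 a b c d \<in> carrier_mat 2 2"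
  by (simp add: mat2_def)

lemma dim_mat2 [simp]: "dim_row (mat2 a b c d) = 2" "dim_col (mat2 a b c d) = 2"
  by (simp_all add: mat2_def)

lemma mat2_index [simp]:
  "mat2 a b c d $$ (0, 0) = a" "mat2 a b c d $$ (0, 1) = b" "mat2 a b c d $$ (1, 0) = c" "mat2 a b c d $$ (1, 1) = d"
  "mat2 a b c d $$ (0, Suc 0) = b" "mat2 a b c d $$ (Suc 0, 0) = c" "mat2 a b c d $$ (Suc 0, Suc 0) = d"
  by (simp_all add: mat2_def)

lemma mat2_eq_iff [simp]:
  "mat2 a b c d = mat2 a' b' c' d' \<longleftrightarrow> a = a' \<and> b = b' \<and> c = c' \<and> d = d'"
  by (metis mat2_index(1-4))

lemma mat2_cases:
  assumes "A \<in> carrier_mat 2 2"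
  obtains a b c d where "A = mat2 a b c d"
proof
  show "A = mat2 (A $$ (0, 0)) (A $$ (0, 1)) (A $$ (1, 0)) (A $$ (1, 1))"
    by (rule eq_matI) (use assms in \<open>auto simp: less_2_cases_nat\<close>)
qed

lemma mat2_one: "1\<^sub>m 2 = mat2 1 0 0 (1 :: 'a::{zero,one})"
  by (rule eq_matI) (auto simp: less_2_cases_nat)

lemma mat2_zero: "0\<^sub>m 2 2 = mat2 0 0 0 (0 :: 'a::zero)"
  by (rule eq_matI) (auto simp: less_2_cases_nat)

lemma map_mat2 [simp]: "map_mat F (mat2 a b c d) = mat2 (F a) (F b) (F c) (F d)"
  by (rule eq_matI) (auto simp: less_2_cases_nat)

lemma mat2_mult [simp]:
  "mat2 a b c d * mat2 a' b' c' d' =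
     mat2 (a * a' + b * c') (a * b' + b * d') (c * a' + d * c') (c * b' + d * (d' :: 'a::comm_semiring_0))"
  by (rule eq_matI) (auto simp: scalar_prod_def numeral_2_eq_2 less_Suc_eq)

lemma mat2_mult_vec2 [simp]:
  "mat2 a b c d *\<^sub>v vec2 x y = vec2 (a * x + b * y) (c * x + d * (y :: 'a::comm_semiring_0))"
  by (rule eq_vecI) (auto simp: scalar_prod_def numeral_2_eq_2 less_Suc_eq)

section \<open>Laurent polynomials and morphisms between line bundles\<close>

lemma lookup_laurent_t: "Poly_Mapping.lookup (laurent_t p) k = (if k < 0 then 0 else poly.coeff p (nat k))"
proof -
  have "Poly_Mapping.lookup (laurent_t p) k = (\<Sum>i\<le>degree p. if int i = k then poly.coeff p i else 0)"
    unfolding laurent_t_def lookup_sum by (rule sum.cong) (auto simp: lookup_single when_def)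
  also have "\<dots> = (if k < 0 then 0 else poly.coeff p (nat k))"
  proof (cases "k < 0")
    case True thus ?thesis by (intro sum.neutral[THEN trans]) auto
  next
    case False
    hence "(\<Sum>i\<le>degree p. if int i = k then poly.coeff p i else 0) = (\<Sum>i\<le>degree p. if nat k = i then poly.coeff p i else 0)"
      by (intro sum.cong) auto
    thus ?thesis using False by (auto simp: coeff_eq_0)
  qed
  finally show ?thesis .
qed

lemma lookup_laurent_s: "Poly_Mapping.lookup (laurent_s p) k = (if k > 0 then 0 else poly.coeff p (nat (- k)))"
proof -
  have "Poly_Mapping.lookup (laurent_s p) k = Poly_Mapping.lookup (laurent_t p) (- k)"
    unfolding laurent_t_def laurent_s_def lookup_sum by (rule sum.cong) (auto simp: lookup_single when_def)
  thus ?thesis by (simp add: lookup_laurent_t)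
qed

lemma lookup_mult_single:
  "Poly_Mapping.lookup (f * Poly_Mapping.single (k::int) (c :: 'a::comm_semiring_0)) m = Poly_Mapping.lookup f (m - k) * c"
proof -
  have "Poly_Mapping.lookup (f * Poly_Mapping.single k c) m = (\<Sum>l. Poly_Mapping.lookup f l * (\<Sum>q. (c when k = q) when m = l + q))"
    by (simp add: lookup_mult lookup_single)
  also have "(\<lambda>l. \<Sum>q. (c when k = q) when m = l + q) = (\<lambda>l. c when l = m - k)"
  proof
    fix l
    have "(\<Sum>q. (c when k = q) when m = l + q) = (\<Sum>q. (c when m = l + q) when q = k)"
      by (rule Sum_any.cong) (auto simp: when_def)
    also have "\<dots> = (c when m = l + k)" by simp
    also have "\<dots> = (c when l = m - k)" by (rule when_cong) auto
    finally show "(\<Sum>q. (c when k = q) when m = l + q) = (c when l = m - k)" .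
  qed
  also have "(\<Sum>l. Poly_Mapping.lookup f l * (c when l = m - k)) = (\<Sum>l. Poly_Mapping.lookup f l * c when l = m - k)"
    by (simp add: mult_when)
  also have "\<dots> = Poly_Mapping.lookup f (m - k) * c" by simp
  finally show ?thesis .
qed

text \<open>This is \<open>s^n f(1/s)\<close>, a section of O(n) seen in the other chart. The
  reversal refers to the twist n and not to the degree of f, so a missing coefficient of degree n
  becomes a zero at infinity.\<close>

definition rev_poly :: "nat \<Rightarrow> 'a::comm_monoid_add poly \<Rightarrow> 'a poly" where
  "rev_poly n f = (\<Sum>i\<le>n. monom (poly.coeff f (n - i)) i)"

lemma coeff_rev_poly: "poly.coeff (rev_poly n f) i = (if i \<le> n then poly.coeff f (n - i) else 0)"
  unfolding rev_poly_def coeff_sum by (auto simp: sum.delta)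

lemma rev_poly_const [simp]: "rev_poly 0 [:c:] = [:c:]"
  by (rule poly_eqI) (auto simp: coeff_rev_poly coeff_pCons split: nat.split)

lemma rev_poly_0 [simp]: "rev_poly n 0 = 0"
  by (rule poly_eqI) (auto simp: coeff_rev_poly)

lemma rev_poly_add: "rev_poly n (f + g) = rev_poly n f + rev_poly n g"
  by (rule poly_eqI) (auto simp: coeff_rev_poly)

lemma rev_poly_smult: "rev_poly n (Polynomial.smult c f) = Polynomial.smult c (rev_poly n f)"
  by (rule poly_eqI) (auto simp: coeff_rev_poly)

text \<open>A morphism from O(c) to O(d) is a section of O(d - c). Comparing coefficients pairs
  degree k of A with degree d - c - k of B, and both must be nonnegative, which leaves the range
  from 0 to d - c, empty for c > d.\<close>

lemma transition_entry_iff: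
  "laurent_s B * Poly_Mapping.single (- c) 1 = Poly_Mapping.single (- d) 1 * laurent_t A \<longleftrightarrow>
     (if c \<le> d then degree A \<le> nat (d - c) \<and> B = rev_poly (nat (d - c)) A else A = 0 \<and> B = 0)"
  (is "?L = ?R")
proof -
  have neg: "- (k + c - d) = d - c - k" for k :: int by simp
  have "?L \<longleftrightarrow> (\<forall>m. Poly_Mapping.lookup (laurent_s B) (m + c) = Poly_Mapping.lookup (laurent_t A) (m + d))"
    by (subst mult.commute[of "Poly_Mapping.single _ _"]) (simp add: poly_mapping_eq_iff fun_eq_iff lookup_mult_single)
  also have "\<dots> \<longleftrightarrow> (\<forall>k. Poly_Mapping.lookup (laurent_s B) (k + c - d) = Poly_Mapping.lookup (laurent_t A) k)"
  proof safe
    fix k assume "\<forall>m. Poly_Mapping.lookup (laurent_s B) (m + c) = Poly_Mapping.lookup (laurent_t A) (m + d)"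
    from spec[OF this, of "k - d"] show "Poly_Mapping.lookup (laurent_s B) (k + c - d) = Poly_Mapping.lookup (laurent_t A) k"
      by (simp add: algebra_simps)
  next
    fix m assume "\<forall>k. Poly_Mapping.lookup (laurent_s B) (k + c - d) = Poly_Mapping.lookup (laurent_t A) k"
    from spec[OF this, of "m + d"] show "Poly_Mapping.lookup (laurent_s B) (m + c) = Poly_Mapping.lookup (laurent_t A) (m + d)"
      by (simp add: algebra_simps)
  qed
  finally have L: "?L \<longleftrightarrow> (\<forall>k. (if k + c - d > 0 then 0 else poly.coeff B (nat (d - c - k))) = (if k < 0 then 0 else poly.coeff A (nat k)))"
    unfolding lookup_laurent_t lookup_laurent_s neg .
  show ?thesis
  proof
    assume ?L
    have eq: "(if k + c - d > 0 then 0 else poly.coeff B (nat (d - c - k))) = (if k < 0 then 0 else poly.coeff A (nat k))" for k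
      by (rule spec[OF L[THEN iffD1, OF \<open>?L\<close>]])
    \<comment> \<open>Reading the identity at k = i and at k = d - c - i expresses each of A and B
      through the other.\<close>
    have A: "poly.coeff A i = (if int i + c - d > 0 then 0 else poly.coeff B (nat (d - c - int i)))" for i
      using eq[of "int i"] by simp
    have B: "poly.coeff B i = (if d - c - int i < 0 then 0 else poly.coeff A (nat (d - c - int i)))" for i
      using eq[of "d - c - int i"] by simp
    show ?R
    proof (cases "c \<le> d")
      case True
      have "degree A \<le> nat (d - c)" by (rule degree_le) (use True in \<open>auto simp: A\<close>)
      moreover have "B = rev_poly (nat (d - c)) A"
      proof (rule poly_eqI)
        fix i show "poly.coeff B i = poly.coeff (rev_poly (nat (d - c)) A) i"
        proof (cases "i \<le> nat (d - c)")
          case le: True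
          hence "nat (d - c - int i) = nat (d - c) - i" by (simp add: nat_diff_distrib')
          thus ?thesis using le True by (simp add: B[of i] coeff_rev_poly)
        next
          case False thus ?thesis using True by (simp add: B[of i] coeff_rev_poly)
        qed
      qed
      ultimately show ?thesis using True by simp
    next
      case False
      have "A = 0" by (rule poly_eqI) (use False in \<open>simp add: A\<close>)
      moreover have "B = 0" by (rule poly_eqI) (use False in \<open>simp add: B\<close>)
      ultimately show ?thesis using False by simp
    qed
  next
    assume R: ?R
    show ?L unfolding L
    proof
      fix k show "(if k + c - d > 0 then 0 else poly.coeff B (nat (d - c - k))) = (if k < 0 then 0 else poly.coeff A (nat k))"
      proof (cases "c \<le> d")
        case True
        hence dg: "degree A \<le> nat (d - c)" and B: "B = rev_poly (nat (d - c)) A" using R by auto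
        show ?thesis
        proof (cases "0 \<le> k \<and> k \<le> d - c")
          case k: True
          hence "nat (d - c) - nat (d - c - k) = nat k" by (simp add: nat_diff_distrib' nat_le_eq_zle)
          thus ?thesis using k by (auto simp: B coeff_rev_poly)
        next
          case False
          thus ?thesis using True dg by (auto simp: B coeff_rev_poly coeff_eq_0 not_le)
        qed
      qed (use R in auto)
    qed
  qed
qed

text \<open>For \<open>n = a - b\<close>, the entry \<open>f\<close> is a section of \<open>O(n)\<close>, whose polynomial is reversed in the
  chart at infinity, and \<open>h\<close> is a section of \<open>O(-n)\<close>, which vanishes unless \<open>n = 0\<close>.\<close>

definition endo :: "nat \<Rightarrow> 'k::field \<Rightarrow> 'k poly \<Rightarrow> 'k \<Rightarrow> 'k \<Rightarrow> 'k bundle_map" where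
  "endo n \<alpha> f h \<beta> = (mat2 [:\<alpha>:] f [:h:] [:\<beta>:], mat2 [:\<alpha>:] (rev_poly n f) [:h:] [:\<beta>:])"

definition endo_data :: "nat \<Rightarrow> 'k::field poly \<Rightarrow> 'k \<Rightarrow> bool" where
  "endo_data n f h \<longleftrightarrow> degree f \<le> n \<and> (n = 0 \<or> h = 0)"

lemma bundle_sum_twist:
  "bundle_sum (twist a) (twist b) = mat2 (Poly_Mapping.single (- a) 1) 0 0 (Poly_Mapping.single (- b) (1::'k::field))"
  unfolding bundle_sum_def twist_def
  by (rule eq_matI) (auto simp: less_2_cases_nat)

lemma bundle_rank_bundle_sum_twist [simp]: "bundle_rank (bundle_sum (twist a) (twist b)) = 2"
  by (simp add: bundle_rank_def bundle_sum_twist)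

lemma is_bundle_bundle_sum_twist [simp]: "is_bundle (bundle_sum (twist a) (twist b) :: 'k::field vbundle)"
  unfolding is_bundle_def invertible_mat_def inverts_mat_def
proof (intro conjI exI[of _ "bundle_sum (twist (- a)) (twist (- b))"])
  show "square_mat (bundle_sum (twist a) (twist b) :: 'k vbundle)" by (simp add: bundle_sum_twist)
qed (simp_all add: bundle_sum_twist mult_single mat2_one)

lemma is_bundle_twist [simp]: "is_bundle (twist a :: 'k::field vbundle)"
  unfolding is_bundle_def invertible_mat_def inverts_mat_def
proof (intro conjI exI[of _ "twist (- a)"])
  show "twist a * twist (- a) = (1\<^sub>m (dim_row (twist a)) :: 'k vbundle)" for a
    by (rule eq_matI) (auto simp: twist_def scalar_prod_def mult_single)
  from this[of "- a"] show "twist (- a) * twist a = (1\<^sub>m (dim_row (twist (- a))) :: 'k vbundle)" by simp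
qed (simp add: twist_def)

lemma bundle_rank_twist [simp]: "bundle_rank (twist a) = 1"
  by (simp add: bundle_rank_def twist_def)

text \<open>The transition matrix is diagonal, so the gluing condition separates into the four
  entries, each a morphism between two of the summands O(a), O(b) and thus an instance of
  \<open>transition_entry_iff\<close>.\<close>

lemma endo_in_bundle_hom_iff:
  fixes \<phi> :: "'k::field bundle_map"
  assumes "n = nat (a - b)" and "b \<le> a"
  shows "\<phi> \<in> bundle_hom (bundle_sum (twist a) (twist b)) (bundle_sum (twist a) (twist b)) \<longleftrightarrow>
    (\<exists>\<alpha> f h \<beta>. \<phi> = endo n \<alpha> f h \<beta> \<and> endo_data n f h)" (is "?L = ?R")
proof -
  have deg0: "degree p = 0 \<longleftrightarrow> (\<exists>c. p = [:c:])" for p :: "'k poly"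
    by (metis degree_eq_zeroE degree_pCons_0)
  have key: "(mat2 x0 f0 h0 y0, mat2 x1 f1 h1 y1) \<in> bundle_hom (bundle_sum (twist a) (twist b)) (bundle_sum (twist a) (twist b))
    \<longleftrightarrow> degree x0 = 0 \<and> x1 = rev_poly 0 x0 \<and> degree f0 \<le> n \<and> f1 = rev_poly n f0 \<and>
      degree y0 = 0 \<and> y1 = rev_poly 0 y0 \<and> (if n = 0 then degree h0 = 0 \<and> h1 = rev_poly 0 h0 else h0 = 0 \<and> h1 = 0)"
    for x0 f0 h0 y0 x1 f1 h1 y1 :: "'k poly"
    using assms unfolding bundle_hom_def
    by (auto simp: bundle_sum_twist transition_entry_iff bundle_rank_def)
  show ?thesis
  proof
    assume L: ?L
    then obtain A0 A1 where \<phi>: "\<phi> = (A0, A1)" and "A0 \<in> carrier_mat 2 2" "A1 \<in> carrier_mat 2 2"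
      by (auto simp: bundle_hom_def)
    then obtain x0 f0 h0 y0 x1 f1 h1 y1 where \<phi>: "\<phi> = (mat2 x0 f0 h0 y0, mat2 x1 f1 h1 y1)"
      by (metis mat2_cases)
    note k = L[unfolded \<phi> key]
    obtain \<alpha> \<beta> where x: "x0 = [:\<alpha>:]" "y0 = [:\<beta>:]" using k deg0 by blast
    obtain h where h: "h0 = [:h:]" "h1 = [:h:]" "n = 0 \<or> h = 0"
    proof (cases "n = 0")
      case True
      then obtain h where "h0 = [:h:]" using k deg0 by auto
      thus ?thesis using that[of h] True k by simp
    next
      case False
      thus ?thesis using that[of 0] k by simp
    qed
    show ?R
      by (rule exI[of _ \<alpha>], rule exI[of _ f0], rule exI[of _ h], rule exI[of _ \<beta>])
         (use k x h in \<open>auto simp: \<phi> endo_def endo_data_def\<close>)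
  next
    assume ?R
    thus ?L by (auto simp: endo_def key endo_data_def)
  qed
qed

lemma bundle_id_twist: "bundle_id (bundle_sum (twist a) (twist b)) = endo n 1 0 0 1"
  by (simp add: bundle_id_def endo_def mat2_one one_pCons)

lemma endo_eq_iff: "endo n \<alpha> f h \<beta> = endo n \<alpha>' f' h' \<beta>' \<longleftrightarrow> \<alpha> = \<alpha>' \<and> f = f' \<and> h = h' \<and> \<beta> = \<beta>'"
  by (auto simp: endo_def)

text \<open>The product of f and h' is the scalar \<open>coeff f 0 * h'\<close> in every case: for n
  = 0 the section f is constant, and for n > 0 the entry h' vanishes. For the same reason the
  determinant of an endomorphism is a scalar.\<close>

lemma endo_comp:
  assumes "endo_data n f h" "endo_data n f' h'"
  shows "bundle_comp (endo n \<alpha> f h \<beta>) (endo n \<alpha>' f' h' \<beta>') =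
    endo n (\<alpha> * \<alpha>' + poly.coeff f 0 * h') (Polynomial.smult \<alpha> f' + Polynomial.smult \<beta>' f)
      (h * \<alpha>' + \<beta> * h') (h * poly.coeff f' 0 + \<beta> * \<beta>')"
proof (cases "n = 0")
  case True
  then obtain c c' where "f = [:c:]" "f' = [:c':]"
    using assms by (auto simp: endo_data_def elim!: degree_eq_zeroE)
  thus ?thesis using True by (simp add: bundle_comp_def endo_def mult_ac)
next
  case False
  hence "h = 0" "h' = 0" using assms by (auto simp: endo_data_def)
  thus ?thesis by (simp add: bundle_comp_def endo_def mult_ac rev_poly_add rev_poly_smult)
qed

lemma endo_data_comp:
  assumes "endo_data n f h" "endo_data n f' h'"
  shows "endo_data n (Polynomial.smult \<alpha> f' + Polynomial.smult \<beta>' f) (h * \<alpha>' + \<beta> * h')"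
proof -
  have "degree (Polynomial.smult \<alpha> f' + Polynomial.smult \<beta>' f) \<le> n"
    using assms by (intro degree_add_le degree_smult_le[THEN order_trans]) (auto simp: endo_data_def)
  thus ?thesis using assms by (auto simp: endo_data_def)
qed

text \<open>The inverse is the adjugate matrix divided by the determinant.\<close>

lemma endo_inverse:
  assumes "endo_data n f h" and "D = \<alpha> * \<beta> - poly.coeff f 0 * h" and "D \<noteq> 0"
  shows "endo_data n (Polynomial.smult (- inverse D) f) (- (h / D))"
    and "bundle_comp (endo n \<alpha> f h \<beta>) (endo n (\<beta> / D) (Polynomial.smult (- inverse D) f) (- (h / D)) (\<alpha> / D)) = endo n 1 0 0 1"
    and "bundle_comp (endo n (\<beta> / D) (Polynomial.smult (- inverse D) f) (- (h / D)) (\<alpha> / D)) (endo n \<alpha> f h \<beta>) = endo n 1 0 0 1"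
proof -
  show d: "endo_data n (Polynomial.smult (- inverse D) f) (- (h / D))"
    using assms(1) unfolding endo_data_def using degree_smult_le[of "- inverse D" f] by auto
  have 1: "(\<alpha> * \<beta>) / D - (poly.coeff f 0 * h) / D = 1"
    using assms(2,3) by (simp flip: diff_divide_distrib)
  show "bundle_comp (endo n \<alpha> f h \<beta>) (endo n (\<beta> / D) (Polynomial.smult (- inverse D) f) (- (h / D)) (\<alpha> / D)) = endo n 1 0 0 1"
    using 1 unfolding endo_comp[OF assms(1) d] endo_eq_iff by (simp add: field_simps)
  show "bundle_comp (endo n (\<beta> / D) (Polynomial.smult (- inverse D) f) (- (h / D)) (\<alpha> / D)) (endo n \<alpha> f h \<beta>) = endo n 1 0 0 1"
    using 1 unfolding endo_comp[OF d assms(1)] endo_eq_iff by (simp add: field_simps)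
qed

lemma endo_in_bundle_aut_iff:
  fixes \<phi> :: "'k::field bundle_map"
  assumes n: "n = nat (a - b)" and ab: "b \<le> a"
  shows "\<phi> \<in> bundle_aut (bundle_sum (twist a) (twist b)) \<longleftrightarrow>
    (\<exists>\<alpha> f h \<beta>. \<phi> = endo n \<alpha> f h \<beta> \<and> endo_data n f h \<and> \<alpha> * \<beta> - poly.coeff f 0 * h \<noteq> 0)" (is "?L = ?R")
proof
  assume ?L
  then obtain \<psi> where "\<phi> \<in> bundle_hom (bundle_sum (twist a) (twist b)) (bundle_sum (twist a) (twist b))"
    "\<psi> \<in> bundle_hom (bundle_sum (twist a) (twist b)) (bundle_sum (twist a) (twist b))"
    and comp: "bundle_comp \<phi> \<psi> = bundle_id (bundle_sum (twist a) (twist b))"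
    by (auto simp: bundle_aut_def)
  then obtain \<alpha> f h \<beta> \<alpha>' f' h' \<beta>' where *: "\<phi> = endo n \<alpha> f h \<beta>" "endo_data n f h"
    "\<psi> = endo n \<alpha>' f' h' \<beta>'" "endo_data n f' h'"
    unfolding endo_in_bundle_hom_iff[OF n ab] by blast
  have eqs: "\<alpha> * \<alpha>' + poly.coeff f 0 * h' = 1" "Polynomial.smult \<alpha> f' + Polynomial.smult \<beta>' f = 0"
    "h * \<alpha>' + \<beta> * h' = 0" "h * poly.coeff f' 0 + \<beta> * \<beta>' = 1"
    using comp unfolding * endo_comp[OF *(2,4)] bundle_id_twist[where n = n] endo_eq_iff by auto
  have "poly.coeff (Polynomial.smult \<alpha> f' + Polynomial.smult \<beta>' f) 0 = 0" by (simp only: eqs(2) coeff_0)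
  hence 2: "\<alpha> * poly.coeff f' 0 + \<beta>' * poly.coeff f 0 = 0" by simp
  \<comment> \<open>Multiplicativity of the determinant; the four entries of the product are those
    of the identity.\<close>
  have "(\<alpha> * \<beta> - poly.coeff f 0 * h) * (\<alpha>' * \<beta>' - poly.coeff f' 0 * h') =
     (\<alpha> * \<alpha>' + poly.coeff f 0 * h') * (h * poly.coeff f' 0 + \<beta> * \<beta>') -
     (\<alpha> * poly.coeff f' 0 + \<beta>' * poly.coeff f 0) * (h * \<alpha>' + \<beta> * h')" by (simp add: algebra_simps)
  also have "\<dots> = 1" by (simp add: eqs 2)
  finally have "\<alpha> * \<beta> - poly.coeff f 0 * h \<noteq> 0" by auto
  thus ?R using * by blast
next
  assume ?R
  then obtain \<alpha> f h \<beta> where *: "\<phi> = endo n \<alpha> f h \<beta>" "endo_data n f h" "\<alpha> * \<beta> - poly.coeff f 0 * h \<noteq> 0" by blast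
  note inv = endo_inverse[OF *(2) refl *(3)]
  let ?\<psi> = "endo n (\<beta> / (\<alpha> * \<beta> - poly.coeff f 0 * h)) (Polynomial.smult (- inverse (\<alpha> * \<beta> - poly.coeff f 0 * h)) f)
    (- (h / (\<alpha> * \<beta> - poly.coeff f 0 * h))) (\<alpha> / (\<alpha> * \<beta> - poly.coeff f 0 * h))"
  have "?\<psi> \<in> bundle_hom (bundle_sum (twist a) (twist b)) (bundle_sum (twist a) (twist b))"
    "\<phi> \<in> bundle_hom (bundle_sum (twist a) (twist b)) (bundle_sum (twist a) (twist b))"
    unfolding endo_in_bundle_hom_iff[OF n ab] using inv(1) *(1,2) by blast+
  thus ?L unfolding bundle_aut_def bundle_id_twist[where n = n] using inv(2,3) *(1) by blast
qed

section \<open>Idempotents from decompositions\<close>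

lemma laurent_t_add: "laurent_t (p + r) = laurent_t p + laurent_t r"
  by (rule poly_mapping_eqI) (simp add: lookup_laurent_t lookup_add)

lemma laurent_s_add: "laurent_s (p + r) = laurent_s p + laurent_s r"
  by (rule poly_mapping_eqI) (simp add: lookup_laurent_s lookup_add)

lemma laurent_t_0 [simp]: "laurent_t 0 = 0"
  by (rule poly_mapping_eqI) (simp add: lookup_laurent_t)

lemma laurent_s_0 [simp]: "laurent_s 0 = 0"
  by (rule poly_mapping_eqI) (simp add: lookup_laurent_s)

lemma laurent_t_1 [simp]: "laurent_t 1 = 1"
  by (simp add: laurent_t_def)

lemma laurent_s_1 [simp]: "laurent_s 1 = 1"
  by (simp add: laurent_s_def)

lemma laurent_t_const [simp]: "laurent_t [:c:] = Poly_Mapping.single 0 c"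
  by (simp add: laurent_t_def)

lemma laurent_s_const [simp]: "laurent_s [:c:] = Poly_Mapping.single 0 c"
  by (simp add: laurent_s_def)

lemma laurent_t_smult: "laurent_t (Polynomial.smult c p) = laurent_t p * Poly_Mapping.single 0 c"
  by (rule poly_mapping_eqI) (simp add: lookup_laurent_t lookup_mult_single mult.commute)

lemma laurent_s_smult: "laurent_s (Polynomial.smult c p) = laurent_s p * Poly_Mapping.single 0 c"
  by (rule poly_mapping_eqI) (simp add: lookup_laurent_s lookup_mult_single mult.commute)

lemma laurent_t_shift: "laurent_t (pCons 0 p) = laurent_t p * Poly_Mapping.single 1 1"
  by (rule poly_mapping_eqI)
     (auto simp: lookup_laurent_t lookup_mult_single coeff_pCons nat_diff_distrib' split: nat.split)

lemma laurent_s_shift: "laurent_s (pCons 0 p) = laurent_s p * Poly_Mapping.single (- 1) 1"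
  by (rule poly_mapping_eqI)
     (auto simp: lookup_laurent_s lookup_mult_single coeff_pCons nat_diff_distrib' split: nat.split)

lemma laurent_t_mult: "laurent_t (p * r) = laurent_t p * laurent_t r"
proof (induction p)
  case (pCons c p)
  have "pCons c p = Polynomial.smult c 1 + pCons 0 p" by (simp add: one_pCons)
  hence "laurent_t (pCons c p) = laurent_t (Polynomial.smult c 1) + laurent_t (pCons 0 p)"
    by (simp only: laurent_t_add)
  thus ?case using pCons.IH
    by (simp add: laurent_t_add laurent_t_smult laurent_t_shift distrib_right distrib_left mult_ac)
qed simp

lemma laurent_s_mult: "laurent_s (p * r) = laurent_s p * laurent_s r"
proof (induction p)
  case (pCons c p)
  have "pCons c p = Polynomial.smult c 1 + pCons 0 p" by (simp add: one_pCons)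
  hence "laurent_s (pCons c p) = laurent_s (Polynomial.smult c 1) + laurent_s (pCons 0 p)"
    by (simp only: laurent_s_add)
  thus ?case using pCons.IH
    by (simp add: laurent_s_add laurent_s_smult laurent_s_shift distrib_right distrib_left mult_ac)
qed simp

interpretation laurent_t: semiring_hom "laurent_t :: 'k::field poly \<Rightarrow> 'k laurent"
  by unfold_locales (simp_all add: laurent_t_add laurent_t_mult)

interpretation laurent_s: semiring_hom "laurent_s :: 'k::field poly \<Rightarrow> 'k laurent"
  by unfold_locales (simp_all add: laurent_s_add laurent_s_mult)

lemma is_bundle_carrier: "is_bundle g \<Longrightarrow> g \<in> carrier_mat (bundle_rank g) (bundle_rank g)"
  unfolding is_bundle_def invertible_mat_def bundle_rank_def by (auto simp: square_mat.simps)

lemma bundle_hom_carrier: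
  assumes "\<phi> \<in> bundle_hom g h"
  shows "fst \<phi> \<in> carrier_mat (bundle_rank h) (bundle_rank g)" "snd \<phi> \<in> carrier_mat (bundle_rank h) (bundle_rank g)"
    "chart_matrix \<phi> b \<in> carrier_mat (bundle_rank h) (bundle_rank g)"
  using assms by (auto simp: bundle_hom_def, cases b) auto

lemma bundle_comp_in_hom:
  assumes "\<psi> \<in> bundle_hom h k" "\<phi> \<in> bundle_hom g h" "is_bundle g" "is_bundle h" "is_bundle k"
  shows "bundle_comp \<psi> \<phi> \<in> bundle_hom g k"
proof -
  obtain A0 A1 B0 B1 where eq: "\<psi> = (B0, B1)" "\<phi> = (A0, A1)" by (cases \<psi>, cases \<phi>)
  note c = bundle_hom_carrier[OF assms(1)] bundle_hom_carrier[OF assms(2)] assms(3-5)[THEN is_bundle_carrier]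
  have A: "map_mat laurent_s A1 * g = h * map_mat laurent_t A0" and B: "map_mat laurent_s B1 * h = k * map_mat laurent_t B0"
    using assms(1,2) by (auto simp: bundle_hom_def eq)
  have cs: "A0 \<in> carrier_mat (bundle_rank h) (bundle_rank g)" "A1 \<in> carrier_mat (bundle_rank h) (bundle_rank g)"
    "B0 \<in> carrier_mat (bundle_rank k) (bundle_rank h)" "B1 \<in> carrier_mat (bundle_rank k) (bundle_rank h)"
    using c by (auto simp: eq)
  have "map_mat laurent_s (B1 * A1) * g = map_mat laurent_s B1 * map_mat laurent_s A1 * g"
    using laurent_s.mat_hom_mult[OF cs(4) cs(2)] by simp
  also have "\<dots> = map_mat laurent_s B1 * (map_mat laurent_s A1 * g)"
    by (rule assoc_mult_mat) (use c cs in auto)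
  also have "\<dots> = map_mat laurent_s B1 * h * map_mat laurent_t A0"
    unfolding A by (rule assoc_mult_mat[symmetric]) (use c cs in auto)
  also have "\<dots> = k * (map_mat laurent_t B0 * map_mat laurent_t A0)"
    unfolding B by (rule assoc_mult_mat) (use c cs in auto)
  also have "map_mat laurent_t B0 * map_mat laurent_t A0 = map_mat laurent_t (B0 * A0)"
    using laurent_t.mat_hom_mult[OF cs(3) cs(1)] by simp
  finally show ?thesis using cs by (auto simp: bundle_hom_def bundle_comp_def eq)
qed

section \<open>Induced maps on fibres and composition of parabolic morphisms\<close>

lemma reduce_carrier [simp]: "v \<in> carrier_vec n \<Longrightarrow> reduce b v \<in> carrier_vec n"
  by (simp add: reduce_def)

lemma reduce_reduce [simp]: "reduce b (reduce b v) = reduce b v"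
  by (rule eq_vecI) (simp_all add: reduce_def)

lemma reduce_mult_vec:
  assumes "A \<in> carrier_mat m n" "v \<in> carrier_vec n"
  shows "reduce b (A *\<^sub>v reduce b v) = reduce b (A *\<^sub>v v)"
proof (rule eq_vecI)
  fix i assume "i < dim_vec (reduce b (A *\<^sub>v v))"
  hence i: "i < m" using assms by (simp add: reduce_def)
  let ?p = "local_prime b"
  have "(\<Sum>j = 0..<n. row A i $ j * (v $ j mod ?p)) mod ?p = (\<Sum>j = 0..<n. (row A i $ j * (v $ j mod ?p)) mod ?p) mod ?p"
    by (simp only: mod_sum_eq)
  also have "\<dots> = (\<Sum>j = 0..<n. (row A i $ j * v $ j) mod ?p) mod ?p"
    by (simp only: mod_mult_right_eq)
  also have "\<dots> = (\<Sum>j = 0..<n. row A i $ j * v $ j) mod ?p" by (simp only: mod_sum_eq)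
  finally show "reduce b (A *\<^sub>v reduce b v) $ i = reduce b (A *\<^sub>v v) $ i"
    using assms i by (simp add: reduce_def scalar_prod_def)
qed (use assms in \<open>simp add: reduce_def\<close>)

lemma fibre_carrier: "v \<in> fibre n b \<Longrightarrow> v \<in> carrier_vec n"
  by (simp add: fibre_def)

lemma fibre_map_comp:
  assumes "\<psi> \<in> bundle_hom h k" "\<phi> \<in> bundle_hom g h" "v \<in> carrier_vec (bundle_rank g)"
  shows "fibre_map (bundle_comp \<psi> \<phi>) b v = fibre_map \<psi> b (fibre_map \<phi> b v)"
proof -
  have "chart_matrix (bundle_comp \<psi> \<phi>) b = chart_matrix \<psi> b * chart_matrix \<phi> b"
    by (cases b) (simp_all add: bundle_comp_def)
  hence "fibre_map (bundle_comp \<psi> \<phi>) b v = reduce b (chart_matrix \<psi> b *\<^sub>v (chart_matrix \<phi> b *\<^sub>v v))"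
    using bundle_hom_carrier(3)[OF assms(1), of b] bundle_hom_carrier(3)[OF assms(2), of b] assms(3)
    by (simp add: fibre_map_def assoc_mult_mat_vec)
  also have "\<dots> = reduce b (chart_matrix \<psi> b *\<^sub>v (reduce b (chart_matrix \<phi> b *\<^sub>v v)))"
    using bundle_hom_carrier(3)[OF assms(1), of b] bundle_hom_carrier(3)[OF assms(2), of b] assms(3)
    by (intro reduce_mult_vec[symmetric]) auto
  finally show ?thesis by (simp add: fibre_map_def)
qed

lemma fibre_map_id:
  assumes "v \<in> fibre (bundle_rank g) b"
  shows "fibre_map (bundle_id g) b v = v"
proof -
  have "chart_matrix (bundle_id g) b = 1\<^sub>m (bundle_rank g)" by (cases b) (auto simp: bundle_id_def)
  thus ?thesis using assms by (simp add: fibre_map_def fibre_def)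
qed

lemma is_flag_subset: "is_flag n b F \<Longrightarrow> F j \<subseteq> fibre n b"
  by (auto simp: is_flag_def fibre_subspace_def)

lemma par_hom_comp:
  assumes "\<psi> \<in> par_hom D N P" "\<phi> \<in> par_hom D M N"
    and "is_bundle (fst M)" "is_bundle (fst N)" "is_bundle (fst P)"
    and "\<And>b j. b \<in> D \<Longrightarrow> snd M b j \<subseteq> fibre (bundle_rank (fst M)) b"
  shows "bundle_comp \<psi> \<phi> \<in> par_hom D M P"
  unfolding par_hom_def
proof (intro CollectI conjI ballI allI)
  show "bundle_comp \<psi> \<phi> \<in> bundle_hom (fst M) (fst P)"
    using assms by (intro bundle_comp_in_hom[of _ "fst N"]) (auto simp: par_hom_def)
  fix b j assume b: "b \<in> D"
  show "fibre_map (bundle_comp \<psi> \<phi>) b ` snd M b j \<subseteq> snd P b j"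
  proof
    fix u assume "u \<in> fibre_map (bundle_comp \<psi> \<phi>) b ` snd M b j"
    then obtain v where v: "v \<in> snd M b j" "u = fibre_map (bundle_comp \<psi> \<phi>) b v" by blast
    have vc: "v \<in> carrier_vec (bundle_rank (fst M))" using v(1) assms(6)[OF b] fibre_carrier by blast
    have "u = fibre_map \<psi> b (fibre_map \<phi> b v)"
      unfolding v(2) using assms(1,2) vc by (intro fibre_map_comp) (auto simp: par_hom_def)
    moreover have "fibre_map \<phi> b v \<in> snd N b j" using assms(2) b v(1) by (auto simp: par_hom_def)
    ultimately show "u \<in> snd P b j" using assms(1) b by (auto simp: par_hom_def)
  qed
qed

text \<open>The projection of a direct sum onto its first summand. The same constant matrix serves
  both charts, because it commutes with block-diagonal transition matrices.\<close>

definition sum_proj :: "nat \<Rightarrow> nat \<Rightarrow> 'a::{zero,one} mat" where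
  "sum_proj m n = four_block_mat (1\<^sub>m m) (0\<^sub>m m n) (0\<^sub>m n m) (0\<^sub>m n n)"

lemma sum_proj_carrier [simp]: "sum_proj m n \<in> carrier_mat (m + n) (m + n)"
  by (simp add: sum_proj_def)

lemma sum_proj_idem: "sum_proj m n * sum_proj m n = (sum_proj m n :: 'a::semiring_1 mat)"
  unfolding sum_proj_def by (subst mult_four_block_mat[where ?nr1.0 = m and ?n1.0 = m and ?n2.0 = n and ?nr2.0 = n and ?nc1.0 = m and ?nc2.0 = n]) auto

lemma map_mat_sum_proj: "F 0 = 0 \<Longrightarrow> F 1 = 1 \<Longrightarrow> map_mat F (sum_proj m n) = sum_proj m n"
  by (rule eq_matI) (auto simp: sum_proj_def)

lemma sum_proj_neq_one: "n > 0 \<Longrightarrow> sum_proj m n \<noteq> (1\<^sub>m (m + n) :: 'a::zero_neq_one mat)"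
proof
  assume "n > 0" and eq: "sum_proj m n = (1\<^sub>m (m + n) :: 'a mat)"
  hence "sum_proj m n $$ (m, m) = (1 :: 'a)" by simp
  thus False using \<open>n > 0\<close> by (simp add: sum_proj_def)
qed

lemma sum_proj_neq_zero: "m > 0 \<Longrightarrow> sum_proj m n \<noteq> (0\<^sub>m (m + n) (m + n) :: 'a::zero_neq_one mat)"
proof
  assume "m > 0" and eq: "sum_proj m n = (0\<^sub>m (m + n) (m + n) :: 'a mat)"
  hence "sum_proj m n $$ (0, 0) = (0 :: 'a)" by simp
  thus False using \<open>m > 0\<close> by (simp add: sum_proj_def)
qed

lemma sum_proj_mult_vec:
  fixes v w :: "'a::comm_ring_1 vec"
  assumes "v \<in> carrier_vec m" "w \<in> carrier_vec n"
  shows "sum_proj m n *\<^sub>v (v @\<^sub>v w) = v @\<^sub>v 0\<^sub>v n"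
  unfolding sum_proj_def using assms
  by (subst four_block_mat_mult_vec[where ?nr1.0 = m and ?nc1.0 = m and ?nc2.0 = n and ?nr2.0 = n]) auto

lemma bundle_sum_carrier:
  assumes "is_bundle g" "is_bundle h"
  shows "bundle_sum g h \<in> carrier_mat (bundle_rank g + bundle_rank h) (bundle_rank g + bundle_rank h)"
    and "bundle_rank (bundle_sum g h) = bundle_rank g + bundle_rank h"
proof -
  have "dim_row g = bundle_rank g" "dim_col g = bundle_rank g" "dim_row h = bundle_rank h" "dim_col h = bundle_rank h"
    using is_bundle_carrier[OF assms(1)] is_bundle_carrier[OF assms(2)] by (simp_all only: carrier_matD)
  note d = this
  show "bundle_sum g h \<in> carrier_mat (bundle_rank g + bundle_rank h) (bundle_rank g + bundle_rank h)"
    by (rule carrier_matI) (simp_all only: bundle_sum_def index_mat_four_block(2,3) d)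
  show "bundle_rank (bundle_sum g h) = bundle_rank g + bundle_rank h"
    unfolding bundle_rank_def bundle_sum_def by simp
qed

lemma sum_proj_in_hom:
  assumes "is_bundle g" "is_bundle h" and m: "m = bundle_rank g" and n: "n = bundle_rank h"
  shows "(sum_proj m n, sum_proj m n) \<in> bundle_hom (bundle_sum g h) (bundle_sum g h)"
proof -
  have c: "g \<in> carrier_mat m m" "h \<in> carrier_mat n n"
    unfolding m n using assms(1,2) by (auto intro: is_bundle_carrier)
  have S: "bundle_sum g h = four_block_mat g (0\<^sub>m m n) (0\<^sub>m n m) h"
    unfolding bundle_sum_def using c by (simp only: carrier_matD)
  have "sum_proj m n * bundle_sum g h = bundle_sum g h * sum_proj m n"
    unfolding S sum_proj_def using c
    by (subst (1 2) mult_four_block_mat[where ?nr1.0 = m and ?n1.0 = m and ?n2.0 = n and ?nr2.0 = n and ?nc1.0 = m and ?nc2.0 = n]) auto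
  thus ?thesis using bundle_sum_carrier[OF assms(1,2)]
    by (simp add: bundle_hom_def map_mat_sum_proj m n)
qed

text \<open>The projection of N + P onto N, transported through the isomorphism, is an idempotent of
  M. It respects the flags because those of a sum are sums of flags, and positivity of both ranks
  keeps it away from 0 and the identity.\<close>

lemma decomposition_idempotent:
  fixes D :: "'k::field point set" and M N P :: "'k parabolic"
  assumes M: "is_bundle (fst M)" and subset: "\<And>b j. b \<in> D \<Longrightarrow> snd M b j \<subseteq> fibre (bundle_rank (fst M)) b"
    and N: "is_parabolic D N" "bundle_rank (fst N) > 0" and P: "is_parabolic D P" "bundle_rank (fst P) > 0"
    and iso: "par_iso D M (par_sum N P)" and S: "is_bundle (bundle_sum (fst N) (fst P))"
  shows "\<exists>e. e \<in> par_hom D M M \<and> bundle_comp e e = e \<and> e \<noteq> bundle_id (fst M) \<and>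
    fst e \<noteq> 0\<^sub>m (bundle_rank (fst M)) (bundle_rank (fst M))"
proof -
  let ?S = "par_sum N P"
  define m n r where "m = bundle_rank (fst N)" and "n = bundle_rank (fst P)" and "r = bundle_rank (fst M)"
  obtain \<phi> \<psi> where \<phi>: "\<phi> \<in> par_hom D M ?S" and \<psi>: "\<psi> \<in> par_hom D ?S M"
    and \<psi>\<phi>: "bundle_comp \<psi> \<phi> = bundle_id (fst M)" and \<phi>\<psi>: "bundle_comp \<phi> \<psi> = bundle_id (fst ?S)"
    using iso by (auto simp: par_iso_def)
  define pr :: "'k bundle_map" where "pr = (sum_proj m n, sum_proj m n)"
  have bN: "is_bundle (fst N)" "is_bundle (fst P)" using N P by (auto simp: is_parabolic_def)
  have fS: "fst ?S = bundle_sum (fst N) (fst P)" by (simp add: par_sum_def)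
  have rS: "bundle_rank (fst ?S) = m + n" by (simp add: fS bundle_sum_carrier[OF bN] m_def n_def)
  have pr: "pr \<in> par_hom D ?S ?S"
    unfolding par_hom_def
  proof (intro CollectI conjI ballI allI)
    show "pr \<in> bundle_hom (fst ?S) (fst ?S)"
      unfolding pr_def fS by (rule sum_proj_in_hom[OF bN m_def n_def])
    fix b j assume b: "b \<in> D"
    have F: "is_flag m b (snd N b)" "is_flag n b (snd P b)"
      using N P b by (auto simp: is_parabolic_def m_def n_def)
    show "fibre_map pr b ` snd ?S b j \<subseteq> snd ?S b j"
    proof
      fix u assume "u \<in> fibre_map pr b ` snd ?S b j"
      then obtain v w where vw: "v \<in> snd N b j" "w \<in> snd P b j" "u = fibre_map pr b (v @\<^sub>v w)"
        by (auto simp: par_sum_def)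
      have v: "v \<in> fibre m b" and w: "w \<in> fibre n b" using vw F is_flag_subset by blast+
      have ch: "chart_matrix pr b = sum_proj m n" by (cases b) (auto simp: pr_def)
      have "u = reduce b (v @\<^sub>v 0\<^sub>v n)"
        unfolding vw(3) fibre_map_def ch using v w fibre_carrier by (subst sum_proj_mult_vec) auto
      also have "\<dots> = reduce b v @\<^sub>v 0\<^sub>v n"
        by (rule eq_vecI) (auto simp: reduce_def)
      also have "reduce b v = v" using v by (simp add: fibre_def)
      finally have "u = v @\<^sub>v 0\<^sub>v n" .
      moreover have "0\<^sub>v n \<in> snd P b j" using F by (auto simp: is_flag_def fibre_subspace_def)
      ultimately show "u \<in> snd ?S b j" using vw(1) by (auto simp: par_sum_def)
    qed
  qed
  have subS: "snd ?S b j \<subseteq> fibre (bundle_rank (fst ?S)) b" if b: "b \<in> D" for b j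
  proof
    fix u assume "u \<in> snd ?S b j"
    then obtain v w where vw: "v \<in> snd N b j" "w \<in> snd P b j" "u = v @\<^sub>v w"
      by (auto simp: par_sum_def)
    have "is_flag m b (snd N b)" "is_flag n b (snd P b)"
      using N P b by (auto simp: is_parabolic_def m_def n_def)
    hence v: "v \<in> fibre m b" and w: "w \<in> fibre n b" using vw is_flag_subset by blast+
    have "reduce b (v @\<^sub>v w) = reduce b v @\<^sub>v reduce b w"
      by (rule eq_vecI) (auto simp: reduce_def)
    thus "u \<in> fibre (bundle_rank (fst ?S)) b" using v w unfolding vw(3) rS by (auto simp: fibre_def)
  qed
  define e where "e = bundle_comp \<psi> (bundle_comp pr \<phi>)"
  have bS: "is_bundle (fst ?S)" using S by (simp add: fS)
  have e: "e \<in> par_hom D M M"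
    unfolding e_def using \<phi> \<psi> pr M bS subset by (intro par_hom_comp[of _ _ ?S]) auto
  \<comment> \<open>Stated for one chart and applied to both. With A B = 1 and Q the projection, B Q
    A is idempotent and A (B Q A) B = Q; the second identity later shows that e is neither 0 nor the
    identity, as Q is neither.\<close>
  have mats: "A * B = 1\<^sub>m (m + n) \<Longrightarrow> A \<in> carrier_mat (m + n) r \<Longrightarrow> B \<in> carrier_mat r (m + n) \<Longrightarrow> 
     (B * (sum_proj m n * A)) * (B * (sum_proj m n * A)) = B * (sum_proj m n * A) \<and>
     A * (B * (sum_proj m n * A)) * B = sum_proj m n" for A B :: "'k poly mat"
  proof -
    assume AB: "A * B = 1\<^sub>m (m + n)" and A: "A \<in> carrier_mat (m + n) r" and B: "B \<in> carrier_mat r (m + n)"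
    define Q where "Q = (sum_proj m n :: 'k poly mat)"
    have Qc: "Q \<in> carrier_mat (m + n) (m + n)" and QQ: "Q * Q = Q" by (simp_all add: Q_def sum_proj_idem)
    have QA: "Q * A \<in> carrier_mat (m + n) r" using Qc A by (rule mult_carrier_mat)
    have BQA: "B * (Q * A) \<in> carrier_mat r r" using B QA by (rule mult_carrier_mat)
    have ABQA: "A * (B * (Q * A)) = Q * A"
      by (simp only: assoc_mult_mat[OF A B QA, symmetric] AB left_mult_one_mat[OF QA])
    have "(B * (Q * A)) * (B * (Q * A)) = B * (Q * (A * (B * (Q * A))))"
      by (simp only: assoc_mult_mat[OF B QA BQA] assoc_mult_mat[OF Qc A BQA])
    also have "\<dots> = B * (Q * Q * A)" by (simp only: ABQA assoc_mult_mat[OF Qc Qc A])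
    finally have 1: "(B * (Q * A)) * (B * (Q * A)) = B * (Q * A)" by (simp only: QQ)
    have "A * (B * (Q * A)) * B = Q"
      by (simp only: ABQA assoc_mult_mat[OF Qc A B] AB right_mult_one_mat[OF Qc])
    thus "(B * (sum_proj m n * A)) * (B * (sum_proj m n * A)) = B * (sum_proj m n * A) \<and>
     A * (B * (sum_proj m n * A)) * B = sum_proj m n" using 1 unfolding Q_def by blast
  qed
  have \<phi>c: "fst \<phi> \<in> carrier_mat (m + n) r" "snd \<phi> \<in> carrier_mat (m + n) r"
    and \<psi>c: "fst \<psi> \<in> carrier_mat r (m + n)" "snd \<psi> \<in> carrier_mat r (m + n)"
    using \<phi> \<psi> bundle_hom_carrier[of \<phi> "fst M" "fst ?S"] bundle_hom_carrier[of \<psi> "fst ?S" "fst M"]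
    by (auto simp: par_hom_def rS r_def)
  have one: "fst \<phi> * fst \<psi> = 1\<^sub>m (m + n)" "snd \<phi> * snd \<psi> = 1\<^sub>m (m + n)"
    using \<phi>\<psi> by (auto simp: bundle_comp_def bundle_id_def rS)
  note m1 = mats[OF one(1) \<phi>c(1) \<psi>c(1)] and m2 = mats[OF one(2) \<phi>c(2) \<psi>c(2)]
  have fe: "fst e = fst \<psi> * (sum_proj m n * fst \<phi>)" "snd e = snd \<psi> * (sum_proj m n * snd \<phi>)"
    by (simp_all add: e_def bundle_comp_def pr_def)
  have idem: "bundle_comp e e = e"
    using m1 m2 unfolding bundle_comp_def prod_eq_iff fst_conv snd_conv fe by blast
  have P_eq: "fst \<phi> * fst e * fst \<psi> = sum_proj m n" using m1 unfolding fe by blast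
  have "e \<noteq> bundle_id (fst M)"
  proof
    assume "e = bundle_id (fst M)"
    hence "fst e = 1\<^sub>m r" by (simp add: bundle_id_def r_def)
    hence "fst \<phi> * fst \<psi> = sum_proj m n" using P_eq by (simp only: right_mult_one_mat[OF \<phi>c(1)])
    thus False using one(1) sum_proj_neq_one[of n m, where ?'a = "'k poly"] P(2) unfolding n_def by metis
  qed
  moreover have "fst e \<noteq> 0\<^sub>m r r"
  proof
    assume "fst e = 0\<^sub>m r r"
    hence "0\<^sub>m (m + n) (m + n) = (sum_proj m n :: 'k poly mat)"
      using P_eq by (simp only: right_mult_zero_mat[OF \<phi>c(1)] left_mult_zero_mat[OF \<psi>c(1)])
    thus False using sum_proj_neq_zero[of m n, where ?'a = "'k poly"] N(2) unfolding m_def by metis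
  qed
  ultimately show ?thesis using e idem unfolding r_def by blast
qed

section \<open>Decomposable line configurations\<close>

lemma is_bundle_bundle_sum:
  assumes "is_bundle g" "is_bundle h"
  shows "is_bundle (bundle_sum g h)"
proof -
  define m n where "m = bundle_rank g" and "n = bundle_rank h"
  have c: "g \<in> carrier_mat m m" "h \<in> carrier_mat n n"
    using assms is_bundle_carrier by (auto simp: m_def n_def)
  obtain g' where g': "g * g' = 1\<^sub>m m" "g' * g = 1\<^sub>m (dim_row g')"
    using assms(1) c unfolding is_bundle_def invertible_mat_def inverts_mat_def by auto
  obtain h' where h': "h * h' = 1\<^sub>m n" "h' * h = 1\<^sub>m (dim_row h')"
    using assms(2) c unfolding is_bundle_def invertible_mat_def inverts_mat_def by auto
  have dg: "dim_col g' = m" "dim_row g' = m"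
    using arg_cong[OF g'(1), of dim_col] arg_cong[OF g'(2), of dim_col] c by auto
  have dh: "dim_col h' = n" "dim_row h' = n"
    using arg_cong[OF h'(1), of dim_col] arg_cong[OF h'(2), of dim_col] c by auto
  have c': "g' \<in> carrier_mat m m" "h' \<in> carrier_mat n n" using dg dh by auto
  have S: "bundle_sum g h = four_block_mat g (0\<^sub>m m n) (0\<^sub>m n m) h"
    and S': "bundle_sum g' h' = four_block_mat g' (0\<^sub>m m n) (0\<^sub>m n m) h'"
    unfolding bundle_sum_def using c c' by (simp_all only: carrier_matD)
  have "bundle_sum g h * bundle_sum g' h' = 1\<^sub>m (m + n)"
    unfolding S S' using c c'
    by (subst mult_four_block_mat[where ?nr1.0 = m and ?n1.0 = m and ?n2.0 = n and ?nr2.0 = n and ?nc1.0 = m and ?nc2.0 = n])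
       (auto simp: g' h' four_block_one_mat)
  moreover have "bundle_sum g' h' * bundle_sum g h = 1\<^sub>m (m + n)"
    unfolding S S' using c c'
    by (subst mult_four_block_mat[where ?nr1.0 = m and ?n1.0 = m and ?n2.0 = n and ?nr2.0 = n and ?nc1.0 = m and ?nc2.0 = n])
       (auto simp: g' h' dg dh four_block_one_mat)
  moreover have "dim_row (bundle_sum g h) = m + n" "dim_col (bundle_sum g h) = m + n"
    "dim_row (bundle_sum g' h') = m + n" unfolding S S' using c c' by auto
  ultimately show ?thesis unfolding is_bundle_def invertible_mat_def inverts_mat_def by auto
qed

text \<open>For a local prime X - \<theta> this is \<theta>. At infinity the prime is the coordinate
  s itself, and the value is 0.\<close>

definition pt :: "'l::field point \<Rightarrow> 'l" where
  "pt c = - poly.coeff (local_prime c) 0"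

definition rational_point :: "'l::field point \<Rightarrow> bool" where
  "rational_point c \<longleftrightarrow> local_prime c = [:- pt c, 1:]"

text \<open>The value of a section of \<open>O(n)\<close>; at infinity this is its coefficient of degree \<open>n\<close>.\<close>

definition fev :: "nat \<Rightarrow> 'l::field poly \<Rightarrow> 'l point \<Rightarrow> 'l" where
  "fev n f c = poly (case c of Affine _ \<Rightarrow> f | Infinity \<Rightarrow> rev_poly n f) (pt c)"

text \<open>The point \<open>[x : y]\<close> of the projective line, where \<open>None\<close> is \<open>[1 : 0]\<close>.\<close>

definition proj :: "'l::field \<Rightarrow> 'l \<Rightarrow> 'l option" where
  "proj x y = (if y = 0 then None else Some (x / y))"

text \<open>At a rational point the residue field is the ground field, so reduced fibre vectors are
  pairs of constant polynomials; this is the line spanned by (x, y).\<close>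

definition kline :: "'l::field \<Rightarrow> 'l \<Rightarrow> 'l poly vec set" where
  "kline x y = range (\<lambda>s. vec2 [:s * x:] [:s * y:])"

lemma proj_eq_iff:
  assumes "x \<noteq> 0 \<or> y \<noteq> 0" "x' \<noteq> 0 \<or> y' \<noteq> 0"
  shows "proj x y = proj x' y' \<longleftrightarrow> x * y' = x' * y"
  using assms by (auto simp: proj_def frac_eq_eq)

lemma kline_mem_iff:
  assumes "x \<noteq> 0 \<or> y \<noteq> 0"
  shows "vec2 [:u:] [:v:] \<in> kline x y \<longleftrightarrow> u * y = x * v"
proof
  assume "vec2 [:u:] [:v:] \<in> kline x y"
  thus "u * y = x * v" by (auto simp: kline_def)
next
  assume eq: "u * y = x * v"
  show "vec2 [:u:] [:v:] \<in> kline x y"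
  proof (cases "x = 0")
    case True
    thus ?thesis using assms eq by (auto simp: kline_def intro!: image_eqI[of _ _ "v / y"])
  next
    case False
    thus ?thesis using eq by (auto simp: kline_def field_simps intro!: image_eqI[of _ _ "u / x"])
  qed
qed

lemma kline_cong:
  assumes "x \<noteq> 0 \<or> y \<noteq> 0" "x' \<noteq> 0 \<or> y' \<noteq> 0" "proj x y = proj x' y'"
  shows "kline x y = kline x' y'"
proof -
  have sub: "kline x y \<subseteq> kline x' y'" if "x \<noteq> 0 \<or> y \<noteq> 0" "x' \<noteq> 0 \<or> y' \<noteq> 0" "x * y' = x' * y"
    for x y x' y' :: 'a
  proof
    fix w assume "w \<in> kline x y"
    then obtain s where w: "w = vec2 [:s * x:] [:s * y:]" by (auto simp: kline_def)
    have "s * (x * y') = s * (x' * y)" using that(3) by simp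
    thus "w \<in> kline x' y'" unfolding w using that(2) by (subst kline_mem_iff) (auto simp: mult_ac)
  qed
  have eq: "x * y' = x' * y" using assms by (simp add: proj_eq_iff)
  show ?thesis using sub[OF assms(1,2) eq] sub[OF assms(2,1)] eq by (auto simp: mult_ac)
qed

lemma mod_linear: "f mod [:- \<theta>, 1:] = [:poly f \<theta>:]" for f :: "'l::field poly"
proof -
  have "f mod [:- \<theta>, 1:] = ([:- \<theta>, 1:] * synthetic_div f \<theta> + [:poly f \<theta>:]) mod [:- \<theta>, 1:]"
    by (simp only: synthetic_div_correct')
  also have "\<dots> = [:poly f \<theta>:] mod [:- \<theta>, 1:]" by (rule mod_mult_self4)
  also have "\<dots> = [:poly f \<theta>:]" by (rule mod_poly_less) simp
  finally show ?thesis .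
qed

lemma fibre_zero [simp]: "0\<^sub>v n \<in> fibre n c"
  by (simp add: fibre_def reduce_def) (rule eq_vecI; simp)

lemma fibre_subspace_zero: "fibre_subspace n c {0\<^sub>v n}"
proof -
  have "reduce c (f \<cdot>\<^sub>v 0\<^sub>v n) = 0\<^sub>v n" for f
    by (rule eq_vecI) (auto simp: reduce_def)
  thus ?thesis by (auto simp: fibre_subspace_def)
qed

lemma fibre_subspace_fibre: "fibre_subspace n c (fibre n c)"
proof -
  have "v + w \<in> fibre n c" if "v \<in> fibre n c" "w \<in> fibre n c" for v w
  proof -
    have vw: "v \<in> carrier_vec n" "w \<in> carrier_vec n" "reduce c v = v" "reduce c w = w"
      using that by (auto simp: fibre_def)
    have "reduce c (v + w) = reduce c v + reduce c w"
      using vw(1,2) by (intro eq_vecI) (auto simp: reduce_def poly_mod_add_left)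
    thus ?thesis using vw by (simp add: fibre_def)
  qed
  moreover have "reduce c (f \<cdot>\<^sub>v v) \<in> fibre n c" if "v \<in> fibre n c" for f v
    using fibre_carrier[OF that] by (simp add: fibre_def)
  ultimately show ?thesis by (auto simp: fibre_subspace_def)
qed

lemma reduce_vec2: "reduce c (vec2 f g) = vec2 (f mod local_prime c) (g mod local_prime c)"
  by (simp add: reduce_def)

lemma reduce_rational:
  assumes "rational_point c"
  shows "reduce c (vec2 f g) = vec2 [:poly f (pt c):] [:poly g (pt c):]"
  by (simp only: reduce_vec2 assms[unfolded rational_point_def] mod_linear)

lemma fibre_rational:
  assumes "rational_point c"
  shows "fibre 2 c = {vec2 [:x:] [:y:] | x y. True}"
proof safe
  fix v assume "v \<in> fibre 2 c"
  hence v: "v \<in> carrier_vec 2" "reduce c v = v" by (auto simp: fibre_def)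
  obtain f g where fg: "v = vec2 f g" using vec2_cases[OF v(1)] .
  show "\<exists>x y. v = vec2 [:x:] [:y:] \<and> True"
    using v(2) unfolding fg reduce_rational[OF assms] by metis
next
  fix x y show "vec2 [:x:] [:y:] \<in> fibre 2 c"
    by (simp add: fibre_def reduce_rational[OF assms])
qed

lemma fibre_subspace_kline:
  assumes "rational_point c"
  shows "fibre_subspace 2 c (kline x y)"
  unfolding fibre_subspace_def
proof (intro conjI ballI allI)
  show "kline x y \<subseteq> fibre 2 c" by (auto simp: kline_def fibre_rational[OF assms])
  show "0\<^sub>v 2 \<in> kline x y" unfolding kline_def vec2_zero[symmetric] by (rule range_eqI[of _ _ 0]) simp
next
  fix v w assume "v \<in> kline x y" "w \<in> kline x y"
  then obtain s t where "v = vec2 [:s * x:] [:s * y:]" "w = vec2 [:t * x:] [:t * y:]" by (auto simp: kline_def)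
  hence "v + w = vec2 [:(s + t) * x:] [:(s + t) * y:]" by (simp add: distrib_right)
  thus "v + w \<in> kline x y" unfolding kline_def by (rule range_eqI)
next
  fix f v assume "v \<in> kline x y"
  then obtain s where "v = vec2 [:s * x:] [:s * y:]" by (auto simp: kline_def)
  hence "reduce c (f \<cdot>\<^sub>v v) = vec2 [:(poly f (pt c) * s) * x:] [:(poly f (pt c) * s) * y:]"
    by (simp add: reduce_rational[OF assms] mult_ac)
  thus "reduce c (f \<cdot>\<^sub>v v) \<in> kline x y" unfolding kline_def by (rule range_eqI)
qed

lemma fibre_map_endo:
  assumes "rational_point c"
  shows "fibre_map (endo n \<alpha> f h \<beta>) c (vec2 [:x:] [:y:]) = vec2 [:\<alpha> * x + fev n f c * y:] [:h * x + \<beta> * y:]"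
proof -
  have "chart_matrix (endo n \<alpha> f h \<beta>) c = mat2 [:\<alpha>:] (case c of Affine _ \<Rightarrow> f | Infinity \<Rightarrow> rev_poly n f) [:h:] [:\<beta>:]"
    by (cases c) (simp_all add: endo_def)
  thus ?thesis by (simp add: fibre_map_def reduce_rational[OF assms] fev_def mult.commute)
qed

text \<open>The shape that full flags take after extension of scalars to the closure: every point is
  rational and every line has homogeneous coordinates. Decomposability is studied for this shape
  over any field.\<close>

definition line_type :: "'l::field point set \<Rightarrow> 'l flags \<Rightarrow> ('l point \<Rightarrow> 'l) \<Rightarrow> ('l point \<Rightarrow> 'l) \<Rightarrow> bool" where
  "line_type D F x y \<longleftrightarrow> (\<forall>c\<in>D. rational_point c \<and> (x c \<noteq> 0 \<or> y c \<noteq> 0) \<and>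
     F c = (\<lambda>j. if j = 0 then fibre 2 c else if j = 1 then kline (x c) (y c) else {0\<^sub>v 2}))"

text \<open>The data are the columns of an automorphism: (\<alpha>, h) spans the image of the
  summand O(a), and (f, \<beta>) that of O(b). Every line has to be a fibre of one of these two line
  subbundles.\<close>

definition split_lines :: "nat \<Rightarrow> 'l::field point set \<Rightarrow> ('l point \<Rightarrow> 'l option) \<Rightarrow> bool" where
  "split_lines n D z \<longleftrightarrow> (\<exists>\<alpha> f h \<beta>. endo_data n f h \<and> \<alpha> * \<beta> - poly.coeff f 0 * h \<noteq> 0 \<and>
     (\<forall>c\<in>D. z c = proj \<alpha> h \<or> z c = proj (fev n f c) \<beta>))"

lemma line_type_is_flag:
  assumes "line_type D F x y" "c \<in> D"
  shows "is_flag 2 c (F c)"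
proof -
  have c: "rational_point c" "x c \<noteq> 0 \<or> y c \<noteq> 0"
    and F: "F c = (\<lambda>j. if j = 0 then fibre 2 c else if j = 1 then kline (x c) (y c) else {0\<^sub>v 2})"
    using assms by (auto simp: line_type_def)
  have K: "fibre_subspace 2 c (kline (x c) (y c))" by (rule fibre_subspace_kline[OF c(1)])
  show ?thesis unfolding is_flag_def
  proof (intro conjI allI)
    fix j show "fibre_subspace 2 c (F c j)" "F c (Suc j) \<subseteq> F c j"
      using K by (auto simp: F fibre_subspace_fibre fibre_subspace_zero) (auto simp: fibre_subspace_def)
  next
    show "finite {j. F c j \<noteq> {0\<^sub>v 2}}" by (rule finite_subset[of _ "{0, 1}"]) (auto simp: F)
  qed (simp add: F)
qed

lemma fev_const [simp]: "fev 0 [:c:] p = c"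
  by (simp add: fev_def split: point.split)

lemma fev_0 [simp]: "fev n 0 c = 0"
  by (simp add: fev_def split: point.split)

lemma fev_add: "fev n (f + g) c = fev n f c + fev n g c"
  by (simp add: fev_def rev_poly_add split: point.split)

lemma fev_smult: "fev n (Polynomial.smult s f) c = s * fev n f c"
  by (simp add: fev_def rev_poly_smult split: point.split)

text \<open>The only lines preserved by an idempotent of rank one are its image and its kernel.\<close>

lemma split_lines_of_idempotent:
  assumes D: "line_type D F x y" and e: "endo_data n f h"
    and idem: "bundle_comp (endo n \<alpha> f h \<beta>) (endo n \<alpha> f h \<beta>) = endo n \<alpha> f h \<beta>"
    and ne: "endo n \<alpha> f h \<beta> \<noteq> endo n 1 0 0 1" "endo n \<alpha> f h \<beta> \<noteq> endo n 0 0 0 0"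
    and inv: "\<And>c. c \<in> D \<Longrightarrow> fibre_map (endo n \<alpha> f h \<beta>) c ` F c 1 \<subseteq> F c 1"
  shows "split_lines n D (\<lambda>c. proj (x c) (y c))"
proof -
  have xy: "x c \<noteq> 0 \<or> y c \<noteq> 0" if "c \<in> D" for c using D that by (auto simp: line_type_def)
  have pres: "(\<alpha> * x c + fev n f c * y c) * y c = x c * (h * x c + \<beta> * y c)" if c: "c \<in> D" for c
  proof -
    have r: "rational_point c" "F c 1 = kline (x c) (y c)" using D c by (auto simp: line_type_def)
    have "vec2 [:x c:] [:y c:] \<in> kline (x c) (y c)" using xy[OF c] by (simp add: kline_mem_iff)
    hence "fibre_map (endo n \<alpha> f h \<beta>) c (vec2 [:x c:] [:y c:]) \<in> kline (x c) (y c)"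
      using inv[OF c] unfolding r(2) by blast
    thus ?thesis using xy[OF c] by (simp add: fibre_map_endo[OF r(1)] kline_mem_iff)
  qed
  have I: "\<alpha> * \<alpha> + poly.coeff f 0 * h = \<alpha>" "Polynomial.smult \<alpha> f + Polynomial.smult \<beta> f = f"
    "h * \<alpha> + \<beta> * h = h" "h * poly.coeff f 0 + \<beta> * \<beta> = \<beta>"
    using idem unfolding endo_comp[OF e e] endo_eq_iff by auto
  show ?thesis
  proof (cases "h = 0")
    case h: True
    have "\<alpha> * (\<alpha> - 1) = 0" "\<beta> * (\<beta> - 1) = 0" using I h by (auto simp: algebra_simps)
    hence ab: "\<alpha> = 0 \<or> \<alpha> = 1" "\<beta> = 0 \<or> \<beta> = 1" by auto
    consider "\<alpha> = 1" "\<beta> = 0" | "\<alpha> = 0" "\<beta> = 1" | "\<alpha> = 1" "\<beta> = 1" "f = 0" | "\<alpha> = 0" "\<beta> = 0" "f = 0"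
    proof -
      have "\<alpha> = 1 \<and> \<beta> = 1 \<longrightarrow> f = 0" "\<alpha> = 0 \<and> \<beta> = 0 \<longrightarrow> f = 0"
        using I(2) by (metis add_cancel_left_left smult_1_left, metis add_0 smult_0_left)
      thus ?thesis using ab that by blast
    qed
    thus ?thesis
    proof cases
      case 1
      show ?thesis unfolding split_lines_def
      proof (intro exI conjI ballI)
        \<comment> \<open>Here the idempotent has image [1 : 0] and kernel [-f : 1], hence the
          sign.\<close>
        show "endo_data n (Polynomial.smult (-1) f) 0" using e by (simp add: endo_data_def)
        fix c assume c: "c \<in> D"
        have "(x c + fev n f c * y c) * y c = 0" using pres[OF c] 1 h by simp
        hence "y c = 0 \<or> x c = - fev n f c * y c" by (auto simp: add_eq_0_iff2)
        thus "proj (x c) (y c) = proj 1 0 \<or> proj (x c) (y c) = proj (fev n (Polynomial.smult (-1) f) c) 1"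
          using xy[OF c] by (auto simp: proj_eq_iff fev_smult proj_def simp del: smult_minus_left smult_1_left)
      qed simp
    next
      case 2
      show ?thesis unfolding split_lines_def
      proof (intro exI conjI ballI)
        \<comment> \<open>Now the image is [f : 1] and the kernel is [1 : 0].\<close>
        show "endo_data n f 0" using e by (simp add: endo_data_def)
        fix c assume c: "c \<in> D"
        have "(fev n f c * y c - x c) * y c = 0" using pres[OF c] 2 h by (simp add: algebra_simps)
        hence "y c = 0 \<or> x c = fev n f c * y c" by auto
        thus "proj (x c) (y c) = proj 1 0 \<or> proj (x c) (y c) = proj (fev n f c) 1"
          using xy[OF c] by (auto simp: proj_eq_iff proj_def)
      qed simp
    qed (use ne h in auto)
  next
    case h: False
    hence n0: "n = 0" using e by (simp add: endo_data_def)
    then obtain \<gamma> where f: "f = [:\<gamma>:]" using e by (auto simp: endo_data_def elim!: degree_eq_zeroE)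
    \<comment> \<open>An idempotent with h \<noteq> 0 has trace 1 and determinant 0. Its image is
      [\<alpha> : h] and its kernel is [-\<beta> : h]; these become the two columns, with
      determinant h (\<alpha> + \<beta>) = h.\<close>
    have "h * (\<alpha> + \<beta> - 1) = (h * \<alpha> + \<beta> * h) - h" by (simp add: algebra_simps)
    hence "h * (\<alpha> + \<beta> - 1) = 0" by (simp only: I(3) diff_self)
    hence "\<alpha> + \<beta> - 1 = 0" using h by (metis mult_eq_0_iff)
    hence b: "\<beta> = 1 - \<alpha>" by (simp add: eq_diff_eq add.commute)
    have g: "\<gamma> * h = \<alpha> * \<beta>" using I(1) unfolding b f by (simp add: algebra_simps)
    show ?thesis unfolding split_lines_def
    proof (intro exI conjI ballI)
      show "endo_data n [:- \<beta>:] h" using n0 by (simp add: endo_data_def)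
      show "\<alpha> * h - poly.coeff [:- \<beta>:] 0 * h \<noteq> 0" using h by (simp add: b algebra_simps)
      fix c assume c: "c \<in> D"
      have "h * ((\<alpha> * x c + \<gamma> * y c) * y c) = h * (x c * (h * x c + \<beta> * y c))"
        using pres[OF c] by (simp add: n0 f)
      \<comment> \<open>The invariance equation multiplied by h factors, by the vanishing
        determinant, into the equations of image and kernel.\<close>
      moreover have "(h * x c - \<alpha> * y c) * (h * x c + \<beta> * y c) =
         h * (x c * (h * x c + \<beta> * y c)) - h * ((\<alpha> * x c + \<gamma> * y c) * y c) + (\<gamma> * h - \<alpha> * \<beta>) * y c * y c"
        by (simp add: algebra_simps)
      ultimately have "(h * x c - \<alpha> * y c) * (h * x c + \<beta> * y c) = 0"
        by (simp only: g diff_self mult_zero_left add_0)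
      hence "h * x c = \<alpha> * y c \<or> h * x c = - \<beta> * y c" by (auto simp: add_eq_0_iff2)
      thus "proj (x c) (y c) = proj \<alpha> h \<or> proj (x c) (y c) = proj (fev n [:- \<beta>:] c) h"
        using xy[OF c] h by (auto simp: proj_eq_iff n0 mult.commute)
    qed
  qed
qed

definition vec1 :: "'a \<Rightarrow> 'a vec" where
  "vec1 x = vec 1 (\<lambda>_. x)"

lemma vec1_append [simp]: "vec1 x @\<^sub>v vec1 y = vec2 x y"
  by (rule eq_vecI) (auto simp: vec1_def vec2_def)

lemma vec1_zero: "0\<^sub>v 1 = vec1 (0 :: 'a::zero)"
  by (rule eq_vecI) (auto simp: vec1_def)

lemma fibre1_rational:
  assumes "rational_point c"
  shows "fibre 1 c = {vec1 [:x:] | x. True}"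
proof -
  have r: "reduce c (vec1 f) = vec1 [:poly f (pt c):]" for f
    unfolding reduce_def assms[unfolded rational_point_def]
    by (rule eq_vecI) (auto simp: vec1_def mod_linear)
  show ?thesis
  proof safe
    fix v assume "v \<in> fibre 1 c"
    hence v: "v \<in> carrier_vec 1" "reduce c v = v" by (auto simp: fibre_def)
    have "v = vec1 (v $ 0)" by (rule eq_vecI) (use v in \<open>auto simp: vec1_def\<close>)
    thus "\<exists>x. v = vec1 [:x:] \<and> True" using v(2) r by metis
  next
    fix x show "vec1 [:x:] \<in> fibre 1 c"
      by (simp add: fibre_def r) (simp add: vec1_def)
  qed
qed

text \<open>Flags for the summands: a line of the sum lies in one summand, whose flag stays full up
  to index 1, while the flag of the other drops at once. The flag A makes this choice.\<close>

lemma is_flag_rank1: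
  "is_flag 1 c (\<lambda>j. if j = 0 \<or> j = 1 \<and> A then fibre 1 c else {0\<^sub>v 1})"
  unfolding is_flag_def
proof (intro conjI allI)
  show "finite {j::nat. (if j = 0 \<or> j = 1 \<and> A then fibre 1 c else {0\<^sub>v 1}) \<noteq> {0\<^sub>v 1}}"
    by (rule finite_subset[of _ "{0, 1}"]) auto
qed (auto simp: fibre_subspace_fibre fibre_subspace_zero)

text \<open>The automorphism with the two given columns carries the standard splitting O(a) + O(b)
  to the wanted one. At each point the line is assigned to O(a) if it is the fibre of the first
  column and to O(b) otherwise.\<close>

lemma par_decomposes_of_split:
  assumes n: "n = nat (a - b)" "b \<le> a" and D: "line_type D F x y"
    and split: "split_lines n D (\<lambda>c. proj (x c) (y c))"
  shows "\<exists>N P. is_parabolic D N \<and> is_parabolic D P \<and> bundle_rank (fst N) > 0 \<and> bundle_rank (fst P) > 0 \<and>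
     par_iso D (bundle_sum (twist a) (twist b), F) (par_sum N P)"
proof -
  let ?g = "bundle_sum (twist a) (twist b)"
  obtain \<alpha> f h \<beta> where e: "endo_data n f h" and det: "\<alpha> * \<beta> - poly.coeff f 0 * h \<noteq> 0"
    and z: "\<And>c. c \<in> D \<Longrightarrow> proj (x c) (y c) = proj \<alpha> h \<or> proj (x c) (y c) = proj (fev n f c) \<beta>"
    using split by (auto simp: split_lines_def)
  define A where "A c \<longleftrightarrow> proj (x c) (y c) = proj \<alpha> h" for c
  define N where "N = (twist a :: 'a vbundle, \<lambda>c j. if j = 0 \<or> j = (1::nat) \<and> A c then fibre 1 c else {0\<^sub>v 1})"
  define P where "P = (twist b :: 'a vbundle, \<lambda>c j. if j = 0 \<or> j = (1::nat) \<and> \<not> A c then fibre 1 c else {0\<^sub>v 1})"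
  let ?S = "par_sum N P"
  have fS: "fst ?S = ?g" by (simp add: par_sum_def N_def P_def)
  have xy: "x c \<noteq> 0 \<or> y c \<noteq> 0" and rat: "rational_point c"
    and F: "F c = (\<lambda>j. if j = 0 then fibre 2 c else if j = 1 then kline (x c) (y c) else {0\<^sub>v 2})"
    if "c \<in> D" for c using D that by (auto simp: line_type_def)
  have S: "snd ?S c = (\<lambda>j. if j = 0 then fibre 2 c else if j = 1 then (if A c then kline 1 0 else kline 0 1) else {0\<^sub>v 2})"
    if "c \<in> D" for c
  proof
    fix j
    have "snd ?S c j = {v @\<^sub>v w | v w. v \<in> snd N c j \<and> w \<in> snd P c j}" by (simp add: par_sum_def)
    thus "snd ?S c j = (if j = 0 then fibre 2 c else if j = 1 then (if A c then kline 1 0 else kline 0 1) else {0\<^sub>v 2})"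
      unfolding N_def P_def snd_conv fibre1_rational[OF rat[OF that]] fibre_rational[OF rat[OF that]] vec1_zero vec2_zero[symmetric] kline_def
      by (auto simp: image_def) (metis pCons_0_0 vec1_append)+
  qed
  define \<phi> where "\<phi> = endo n \<alpha> f h \<beta>"
  have "\<phi> \<in> bundle_aut ?g"
    unfolding endo_in_bundle_aut_iff[OF n] \<phi>_def using e det by blast
  then obtain \<psi> where hom: "\<phi> \<in> bundle_hom ?g ?g" "\<psi> \<in> bundle_hom ?g ?g"
    and inv: "bundle_comp \<psi> \<phi> = bundle_id ?g" "bundle_comp \<phi> \<psi> = bundle_id ?g"
    by (auto simp: bundle_aut_def)
  have \<psi>\<phi>: "fibre_map \<psi> c (fibre_map \<phi> c v) = v" and \<phi>\<psi>: "fibre_map \<phi> c (fibre_map \<psi> c v) = v"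
    if "v \<in> fibre 2 c" for c v
    using fibre_map_comp[OF hom(2,1), of v c] fibre_map_comp[OF hom(1,2), of v c] that
      fibre_map_id[of v ?g c] fibre_carrier[OF that] by (simp_all add: inv)
  have fib: "fibre_map \<chi> c v \<in> fibre 2 c" if "\<chi> \<in> bundle_hom ?g ?g" "v \<in> fibre 2 c" for \<chi> c v
    using bundle_hom_carrier(3)[OF that(1), of c] fibre_carrier[OF that(2)] by (auto simp: fibre_map_def fibre_def)
  have Ssub: "snd ?S c j \<subseteq> fibre 2 c" if "c \<in> D" for c j
    unfolding S[OF that] fibre_rational[OF rat[OF that]] kline_def vec2_zero[symmetric] by auto
  have img: "fibre_map \<phi> c ` snd ?S c j = F c j" if c: "c \<in> D" for c j
  proof -
    have fm: "fibre_map \<phi> c (vec2 [:u:] [:v:]) = vec2 [:\<alpha> * u + fev n f c * v:] [:h * u + \<beta> * v:]" for u v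
      unfolding \<phi>_def by (rule fibre_map_endo[OF rat[OF c]])
    \<comment> \<open>The determinant takes the same value at every point: either f is constant or h
      = 0. Therefore both columns are nonzero in each fibre.\<close>
    have det': "\<alpha> * \<beta> - fev n f c * h \<noteq> 0"
    proof (cases "n = 0")
      case True
      then obtain \<gamma> where "f = [:\<gamma>:]" using e by (auto simp: endo_data_def elim!: degree_eq_zeroE)
      thus ?thesis using det True by simp
    next
      case False thus ?thesis using det e by (simp add: endo_data_def)
    qed
    consider "j = 0" | "j = 1" "A c" | "j = 1" "\<not> A c" | "j > 1" by linarith
    thus ?thesis
    proof cases
      case 1
      have "fibre_map \<phi> c ` fibre 2 c = fibre 2 c"
        using fib[OF hom(1)] fib[OF hom(2)] \<phi>\<psi> by (auto simp: image_iff) metis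
      thus ?thesis using 1 by (simp add: S[OF c] F[OF c])
    next
      case 2
      have "fibre_map \<phi> c ` kline 1 0 = kline \<alpha> h"
        unfolding kline_def image_image fm by (simp add: mult.commute)
      also have "\<dots> = kline (x c) (y c)" using xy[OF c] 2 det' by (intro kline_cong) (auto simp: A_def)
      finally show ?thesis using 2 by (simp add: S[OF c] F[OF c])
    next
      case 3
      have "fibre_map \<phi> c ` kline 0 1 = kline (fev n f c) \<beta>"
        unfolding kline_def image_image fm by (simp add: mult.commute)
      also have "\<dots> = kline (x c) (y c)" using xy[OF c] 3 det' z[OF c] by (intro kline_cong) (auto simp: A_def)
      finally show ?thesis using 3 by (simp add: S[OF c] F[OF c])
    next
      case 4
      thus ?thesis using fm[of 0 0] by (simp add: S[OF c] F[OF c] flip: vec2_zero)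
    qed
  qed
  have "\<psi> \<in> par_hom D (?g, F) ?S"
    unfolding par_hom_def fS fst_conv snd_conv
  proof (intro CollectI conjI ballI allI hom)
    fix c j assume c: "c \<in> D"
    show "fibre_map \<psi> c ` F c j \<subseteq> snd ?S c j"
      unfolding img[OF c, of j, symmetric] using Ssub[OF c, of j] \<psi>\<phi> by auto
  qed
  moreover have "\<phi> \<in> par_hom D ?S (?g, F)"
    unfolding par_hom_def fS fst_conv snd_conv using hom img by auto
  ultimately have "par_iso D (?g, F) ?S"
    unfolding par_iso_def fS fst_conv using inv by blast
  moreover have "is_parabolic D N" "is_parabolic D P"
    unfolding is_parabolic_def N_def P_def fst_conv snd_conv bundle_rank_twist using is_flag_rank1 by auto
  moreover have "bundle_rank (fst N) > 0" "bundle_rank (fst P) > 0" by (simp_all add: N_def P_def)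
  ultimately show ?thesis by blast
qed

theorem par_indecomposable_iff:
  fixes D :: "'l::field point set"
  assumes n: "n = nat (a - b)" "b \<le> a" and D: "line_type D F x y"
  shows "par_indecomposable D (bundle_sum (twist a) (twist b), F) \<longleftrightarrow> \<not> split_lines n D (\<lambda>c. proj (x c) (y c))"
proof -
  let ?g = "bundle_sum (twist a) (twist b) :: 'l vbundle" and ?M = "(bundle_sum (twist a) (twist b) :: 'l vbundle, F)"
  have flag: "is_flag 2 c (F c)" if "c \<in> D" for c by (rule line_type_is_flag[OF D that])
  have par: "is_parabolic D ?M" using flag by (simp add: is_parabolic_def)
  have split: "split_lines n D (\<lambda>c. proj (x c) (y c))"
    if NP: "is_parabolic D N" "is_parabolic D P" "bundle_rank (fst N) > 0" "bundle_rank (fst P) > 0"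
      and iso: "par_iso D ?M (par_sum N P)" for N P
  proof -
    have bs: "is_bundle (bundle_sum (fst N) (fst P))"
      using NP by (intro is_bundle_bundle_sum) (auto simp: is_parabolic_def)
    have M: "is_bundle (fst ?M)" by simp
    have sub: "snd ?M c j \<subseteq> fibre (bundle_rank (fst ?M)) c" if "c \<in> D" for c j
      using is_flag_subset[OF flag[OF that]] by simp
    have "\<exists>e. e \<in> par_hom D ?M ?M \<and> bundle_comp e e = e \<and> e \<noteq> bundle_id (fst ?M) \<and>
        fst e \<noteq> 0\<^sub>m (bundle_rank (fst ?M)) (bundle_rank (fst ?M))"
      by (rule decomposition_idempotent[OF M _ NP(1,3,2,4) iso bs]) (rule sub)
    then obtain e where e: "e \<in> par_hom D ?M ?M" "bundle_comp e e = e" "e \<noteq> bundle_id (fst ?M)"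
      "fst e \<noteq> 0\<^sub>m (bundle_rank (fst ?M)) (bundle_rank (fst ?M))"
      by (elim exE conjE)
    have "e \<in> bundle_hom ?g ?g" using e(1) by (simp add: par_hom_def)
    then obtain \<alpha> f h \<beta> where *: "e = endo n \<alpha> f h \<beta>" "endo_data n f h"
      unfolding endo_in_bundle_hom_iff[OF n] by blast
    show ?thesis
    proof (rule split_lines_of_idempotent[OF D *(2)])
      show "bundle_comp (endo n \<alpha> f h \<beta>) (endo n \<alpha> f h \<beta>) = endo n \<alpha> f h \<beta>" using e(2) * by simp
      show "endo n \<alpha> f h \<beta> \<noteq> endo n 1 0 0 1" using e(3) * by (simp add: bundle_id_twist[where n = n])
      show "endo n \<alpha> f h \<beta> \<noteq> endo n 0 0 0 0"
      proof
        assume "endo n \<alpha> f h \<beta> = endo n 0 0 0 0"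
        thus False using e(4) * by (simp add: endo_def mat2_zero)
      qed
      show "fibre_map (endo n \<alpha> f h \<beta>) c ` F c 1 \<subseteq> F c 1" if "c \<in> D" for c
        using e(1) that * by (auto simp: par_hom_def)
    qed
  qed
  have "bundle_rank (fst ?M) > 0" by simp
  thus ?thesis using par par_decomposes_of_split[OF n D] split unfolding par_indecomposable_def by blast
qed

section \<open>Lines as points of the projective line\<close>

lemma irreducible_X: "irreducible [:0, 1 :: 'k::field:]"
proof (rule Factorial_Ring.irreducibleI)
  show "\<not> is_unit [:0, 1 :: 'k:]" by (simp add: is_unit_pCons_iff)
  fix a b :: "'k poly" assume ab: "[:0, 1:] = a * b"
  hence "a \<noteq> 0" "b \<noteq> 0" by auto
  hence "degree a + degree b = 1" using arg_cong[OF ab, of degree] by (simp add: degree_mult_eq)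
  hence "degree a = 0 \<or> degree b = 0" by linarith
  thus "is_unit a \<or> is_unit b" using \<open>a \<noteq> 0\<close> \<open>b \<noteq> 0\<close> by (auto simp: is_unit_iff_degree)
qed simp

text \<open>The geometric points over b, in the coordinate of the chart of b. Over infinity the only
  root is 0, which is also the root of the affine point t = 0, so a root identifies a point only
  together with b.\<close>

definition conj_root :: "'k::{field,finite} point \<Rightarrow> 'k alg_closure \<Rightarrow> bool" where
  "conj_root b \<theta> \<longleftrightarrow> closed_point b \<and> poly (map_poly to_ac (local_prime b)) \<theta> = 0"

lemma conj_root_geometric_root:
  assumes "conj_root b \<theta>"
  shows "geometric_root (local_prime b) \<theta>"
proof
  show "irreducible (local_prime b)"
    using assms by (cases b) (auto simp: conj_root_def irreducible_X)
qed (use assms in \<open>simp add: conj_root_def\<close>)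

lemma ex_conj_root:
  assumes "closed_point b"
  shows "\<exists>\<theta>. conj_root b \<theta>"
proof -
  have irr: "irreducible (local_prime b)" using assms by (cases b) (auto simp: irreducible_X)
  have "degree (local_prime b) > 0"
  proof (rule ccontr)
    assume "\<not> degree (local_prime b) > 0"
    moreover have "local_prime b \<noteq> 0" using irr by auto
    ultimately have "is_unit (local_prime b)" by (simp add: is_unit_iff_degree)
    thus False using irr by (simp add: irreducible_def)
  qed
  thus ?thesis using alg_closed_imp_poly_has_root[of "map_poly to_ac (local_prime b)"] assms
    by (auto simp: conj_root_def)
qed

definition some_root :: "'k::{field,finite} point \<Rightarrow> 'k alg_closure" where
  "some_root b = (SOME \<theta>. conj_root b \<theta>)"

lemma conj_root_some_root: "closed_point b \<Longrightarrow> conj_root b (some_root b)"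
  unfolding some_root_def by (rule someI_ex) (rule ex_conj_root)

lemma conj_root_iff_orbit:
  assumes "conj_root b \<theta>"
  shows "conj_root b \<theta>' \<longleftrightarrow> (\<exists>j. \<theta>' = (frob ^^ j) \<theta>)"
  using geometric_root.conj_roots_eq_orbit[OF conj_root_geometric_root[OF assms]] assms
  by (auto simp: conj_root_def set_eq_iff)

lemma conj_root_frob: "conj_root b \<theta> \<Longrightarrow> conj_root b (frob \<theta>)"
  using conj_root_iff_orbit[of b \<theta> "frob \<theta>"] by (auto intro: exI[of _ 1])

lemma card_conj_root: "closed_point b \<Longrightarrow> card {\<theta>. conj_root b \<theta>} = point_degree b"
  using geometric_root.card_conj_roots[OF conj_root_geometric_root[OF conj_root_some_root[of b]]]
  by (simp add: conj_root_def point_degree_def)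

lemma finite_conj_root: "closed_point b \<Longrightarrow> finite {\<theta>. conj_root b \<theta>}"
  using geometric_root.finite_conj_roots[OF conj_root_geometric_root[OF conj_root_some_root[of b]]]
  by (simp add: conj_root_def)

lemma frob_funpow_point_degree: "conj_root b \<theta> \<Longrightarrow> (frob ^^ point_degree b) \<theta> = \<theta>"
  using geometric_root.frob_funpow_degree[OF conj_root_geometric_root] by (simp add: point_degree_def)

lemma conj_root_Infinity: "conj_root Infinity \<theta> \<longleftrightarrow> \<theta> = 0"
  by (simp add: conj_root_def)

lemma conj_root_unique:
  assumes "conj_root (Affine p) \<theta>" "conj_root (Affine p') \<theta>"
  shows "p = p'"
proof -
  have "p dvd p'" "p' dvd p"
    using geometric_root.root_iff_dvd[OF conj_root_geometric_root[OF assms(1)], of p']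
      geometric_root.root_iff_dvd[OF conj_root_geometric_root[OF assms(2)], of p] assms
    by (auto simp: conj_root_def)
  moreover have "lead_coeff p = 1" "lead_coeff p' = 1" using assms by (auto simp: conj_root_def)
  ultimately show ?thesis using poly_dvd_antisym[of p p'] by simp
qed

fun point_at :: "'k::field point \<Rightarrow> 'l::field \<Rightarrow> 'l point" where
  "point_at (Affine p) \<theta> = Affine [:- \<theta>, 1:]"
| "point_at Infinity \<theta> = Infinity"

lemma pt_point_at: "conj_root b \<theta> \<Longrightarrow> pt (point_at b \<theta>) = \<theta>"
  by (cases b) (auto simp: pt_def conj_root_Infinity)

lemma rational_point_at: "rational_point (point_at b \<theta>)"
  by (cases b) (auto simp: rational_point_def pt_def)

text \<open>An irreducible polynomial over an algebraically closed field is linear, so a closed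
  point above b amounts to a root of the prime of b.\<close>

lemma divisor_ext_eq:
  assumes "reduced_divisor D"
  shows "divisor_ext to_ac D = {point_at b \<theta> | b \<theta>. b \<in> D \<and> conj_root b \<theta>}"
proof (intro Set.set_eqI iffI)
  fix c assume "c \<in> divisor_ext to_ac D"
  then obtain b where c: "closed_point c" "b \<in> D" "lies_over to_ac c b" by (auto simp: divisor_ext_def)
  have b: "closed_point b" using assms c(2) by (auto simp: reduced_divisor_def)
  show "c \<in> {point_at b \<theta> | b \<theta>. b \<in> D \<and> conj_root b \<theta>}"
  proof (cases b)
    case Infinity
    hence "c = point_at b 0" using c(3) by (cases c) auto
    moreover have "conj_root b 0" by (simp add: Infinity conj_root_Infinity)
    ultimately show ?thesis using c(2) by blast
  next
    case (Affine p)
    then obtain r where r: "c = Affine r" "r dvd map_poly to_ac p" using c(3) by (cases c) auto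
    have irr: "irreducible r" "lead_coeff r = 1" using c(1) r(1) by auto
    have r0: "r \<noteq> 0" using irr by auto
    have "degree r \<noteq> 0" using irr r0 by (auto simp: irreducible_def is_unit_iff_degree)
    moreover have "\<not> degree r > 1" using alg_closed_imp_reducible[of r] irr by blast
    ultimately have "degree r = 1" by linarith
    moreover obtain \<theta>' r1 where "r = pCons \<theta>' r1" by (cases r)
    ultimately have "degree r1 = 0" "r = pCons \<theta>' r1" by (auto split: if_splits)
    then obtain s where s: "r = [:\<theta>', s:]" by (metis degree_eq_zeroE)
    have "s \<noteq> 0" using \<open>degree r = 1\<close> by (auto simp: s)
    hence r': "r = [:- (- \<theta>'), 1:]" using irr(2) by (simp add: s)
    have "poly (map_poly to_ac p) (- \<theta>') = 0"
      using r(2) unfolding r' by (simp only: poly_eq_0_iff_dvd)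
    hence "conj_root b (- \<theta>')" using b by (simp add: conj_root_def Affine)
    moreover have "c = point_at b (- \<theta>')" using r(1) r' Affine by simp
    ultimately show ?thesis using c(2) by blast
  qed
next
  fix c assume "c \<in> {point_at b \<theta> | b \<theta>. b \<in> D \<and> conj_root b \<theta>}"
  then obtain b \<theta> where c: "c = point_at b \<theta>" "b \<in> D" "conj_root b \<theta>" by blast
  show "c \<in> divisor_ext to_ac D"
  proof (cases b)
    case Infinity
    thus ?thesis using c by (auto simp: divisor_ext_def intro!: bexI[of _ Infinity])
  next
    case (Affine p)
    have "[:- \<theta>, 1:] dvd map_poly to_ac p" using c(3) by (simp add: Affine conj_root_def poly_eq_0_iff_dvd)
    moreover have "irreducible [:- \<theta>, 1:]"
    proof (rule Factorial_Ring.irreducibleI)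
      show "\<not> is_unit [:- \<theta>, 1:]" by (simp add: is_unit_pCons_iff)
      fix f g assume fg: "[:- \<theta>, 1:] = f * g"
      hence nz: "f \<noteq> 0" "g \<noteq> 0" by auto
      hence "degree f + degree g = 1" using arg_cong[OF fg, of degree] by (simp add: degree_mult_eq)
      hence "degree f = 0 \<or> degree g = 0" by linarith
      thus "is_unit f \<or> is_unit g" using nz by (auto simp: is_unit_iff_degree)
    qed simp
    ultimately show ?thesis using c Affine by (auto simp: divisor_ext_def intro!: bexI[of _ b])
  qed
qed

text \<open>Two distinct monic irreducible polynomials have no common root. Hence the union in
  \<open>flags_ext\<close> reduces to one term.\<close>

lemma lies_over_point_at:
  assumes "conj_root b \<theta>" "closed_point b'"
  shows "lies_over to_ac (point_at b \<theta>) b' \<longleftrightarrow> b' = b"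
proof
  assume L: "lies_over to_ac (point_at b \<theta>) b'"
  show "b' = b"
  proof (cases b)
    case Infinity thus ?thesis using L by (cases b') auto
  next
    case (Affine p)
    then obtain p' where p': "b' = Affine p'" using L by (cases b') auto
    have "conj_root (Affine p') \<theta>" using L assms by (simp add: Affine p' conj_root_def poly_eq_0_iff_dvd)
    thus ?thesis using conj_root_unique[of p \<theta> p'] assms by (simp add: Affine p')
  qed
next
  assume "b' = b"
  thus "lies_over to_ac (point_at b \<theta>) b'" using assms by (cases b) (auto simp: conj_root_def poly_eq_0_iff_dvd)
qed

section \<open>Coordinates of a line at a geometric point\<close>

definition xv :: "'k::{field,finite} poly vec \<Rightarrow> 'k alg_closure \<Rightarrow> 'k alg_closure" where
  "xv v \<theta> = poly (map_poly to_ac (v $ 0)) \<theta>"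

definition yv :: "'k::{field,finite} poly vec \<Rightarrow> 'k alg_closure \<Rightarrow> 'k alg_closure" where
  "yv v \<theta> = poly (map_poly to_ac (v $ 1)) \<theta>"

lemma xv_vec2 [simp]: "xv (vec2 f g) \<theta> = poly (map_poly to_ac f) \<theta>"
  and yv_vec2 [simp]: "yv (vec2 f g) \<theta> = poly (map_poly to_ac g) \<theta>"
  by (simp_all add: xv_def yv_def)

lemma values_reduce:
  assumes "conj_root b \<theta>" "v \<in> carrier_vec 2"
  shows "xv (reduce b v) \<theta> = xv v \<theta>" "yv (reduce b v) \<theta> = yv v \<theta>"
  using geometric_root.poly_mod[OF conj_root_geometric_root[OF assms(1)]] assms(2)
  by (auto elim!: vec2_cases simp: reduce_vec2 simp del: ac.map_poly_mod)

lemma fibre_eqI: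
  assumes "conj_root b \<theta>" "v \<in> fibre 2 b" "w \<in> fibre 2 b" "xv v \<theta> = xv w \<theta>" "yv v \<theta> = yv w \<theta>"
  shows "v = w"
proof -
  interpret geometric_root "local_prime b" \<theta> by (rule conj_root_geometric_root[OF assms(1)])
  obtain f g where v: "v = vec2 f g" using assms(2) by (auto simp: fibre_def elim: vec2_cases)
  obtain f' g' where w: "w = vec2 f' g'" using assms(3) by (auto simp: fibre_def elim: vec2_cases)
  have red: "f mod local_prime b = f" "g mod local_prime b = g" "f' mod local_prime b = f'" "g' mod local_prime b = g'"
    using assms(2,3) by (auto simp: v w fibre_def reduce_vec2)
  have inj: "inj_on (\<lambda>x. poly (map_poly to_ac x) \<theta>) {x. x mod local_prime b = x}"
    using bij_betw_residue by (simp add: bij_betw_def)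
  have "f = f'" using inj_onD[OF inj, of f f'] red assms(4) by (simp add: v w)
  moreover have "g = g'" using inj_onD[OF inj, of g g'] red assms(5) by (simp add: v w)
  ultimately show ?thesis by (simp add: v w)
qed

lemma values_nonzero:
  assumes "conj_root b \<theta>" "v \<in> fibre 2 b" "v \<noteq> 0\<^sub>v 2"
  shows "xv v \<theta> \<noteq> 0 \<or> yv v \<theta> \<noteq> 0"
  using fibre_eqI[OF assms(1,2) fibre_zero] assms(3) by (auto simp flip: vec2_zero)

lemma values_frob: "xv v (frob \<theta>) = frob (xv v \<theta>)" "yv v (frob \<theta>) = frob (yv v \<theta>)"
  by (simp_all add: xv_def yv_def)

text \<open>A single root suffices to test proportionality. If two fibre vectors are proportional at
  \<theta>, the factor is a quotient of values fixed by the d-th power of Frobenius, hence itself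
  the value of a residue class by \<open>bij_betw_residue\<close>, and the vectors are proportional
  over the residue field.\<close>

lemma fibre_linesD:
  fixes b :: "'k::{field,finite} point"
  assumes "L \<in> fibre_lines 2 b" "conj_root b \<theta>" "v \<in> L" "v \<noteq> 0\<^sub>v 2"
  shows "L = {w \<in> fibre 2 b. xv w \<theta> * yv v \<theta> = xv v \<theta> * yv w \<theta>}"
proof -
  interpret geometric_root "local_prime b" \<theta> by (rule conj_root_geometric_root[OF assms(2)])
  obtain u where u: "u \<in> fibre 2 b" "u \<noteq> 0\<^sub>v 2" "L = range (\<lambda>f. reduce b (f \<cdot>\<^sub>v u))"
    using assms(1) by (auto simp: fibre_lines_def)
  have uc: "u \<in> carrier_vec 2" by (rule fibre_carrier[OF u(1)])
  have scale: "xv (reduce b (f \<cdot>\<^sub>v u)) \<theta> = poly (map_poly to_ac f) \<theta> * xv u \<theta>"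
    "yv (reduce b (f \<cdot>\<^sub>v u)) \<theta> = poly (map_poly to_ac f) \<theta> * yv u \<theta>" for f
  proof -
    have c: "f \<cdot>\<^sub>v u \<in> carrier_vec 2" using uc by simp
    show "xv (reduce b (f \<cdot>\<^sub>v u)) \<theta> = poly (map_poly to_ac f) \<theta> * xv u \<theta>"
      "yv (reduce b (f \<cdot>\<^sub>v u)) \<theta> = poly (map_poly to_ac f) \<theta> * yv u \<theta>"
      unfolding values_reduce[OF assms(2) c] using uc by (auto elim!: vec2_cases simp: ac_poly.hom_mult)
  qed
  have Lu: "L = {w \<in> fibre 2 b. xv w \<theta> * yv u \<theta> = xv u \<theta> * yv w \<theta>}"
  proof (intro Set.set_eqI iffI)
    fix w assume "w \<in> L"
    then obtain f where w: "w = reduce b (f \<cdot>\<^sub>v u)" by (auto simp: u(3))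
    have "w \<in> fibre 2 b" using uc by (simp add: w fibre_def)
    thus "w \<in> {w \<in> fibre 2 b. xv w \<theta> * yv u \<theta> = xv u \<theta> * yv w \<theta>}"
      by (simp add: w scale mult_ac)
  next
    fix w assume "w \<in> {w \<in> fibre 2 b. xv w \<theta> * yv u \<theta> = xv u \<theta> * yv w \<theta>}"
    hence w: "w \<in> fibre 2 b" "xv w \<theta> * yv u \<theta> = xv u \<theta> * yv w \<theta>" by auto
    define s where "s = (if yv u \<theta> = 0 then xv w \<theta> / xv u \<theta> else yv w \<theta> / yv u \<theta>)"
    have s: "xv w \<theta> = s * xv u \<theta>" "yv w \<theta> = s * yv u \<theta>"
      using values_nonzero[OF assms(2) u(1,2)] w(2) by (auto simp: s_def field_simps)
    have fix_val: "(frob ^^ degree (local_prime b)) (poly (map_poly to_ac g) \<theta>) = poly (map_poly to_ac g) \<theta>" for g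
      by (simp add: frob_funpow_poly_to_ac frob_funpow_degree)
    have fd: "(frob ^^ j) (x / y) = (frob ^^ j) x / (frob ^^ j) y" for j and x y :: "'k alg_closure"
      by (induction j) (auto simp: frob_divide)
    have "(frob ^^ degree (local_prime b)) s = s"
      unfolding s_def by (simp add: fd xv_def yv_def fix_val del: frob_funpow_poly_to_ac)
    then obtain f where f: "poly (map_poly to_ac f) \<theta> = s"
      using bij_betw_residue unfolding bij_betw_def by (metis (mono_tags, lifting) imageE mem_Collect_eq)
    have "w = reduce b (f \<cdot>\<^sub>v u)"
    proof (rule fibre_eqI[OF assms(2) w(1)])
      show "reduce b (f \<cdot>\<^sub>v u) \<in> fibre 2 b" using uc by (simp add: fibre_def)
    qed (simp_all add: scale f s)
    thus "w \<in> L" by (simp add: u(3))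
  qed
  have v: "v \<in> fibre 2 b" "xv v \<theta> * yv u \<theta> = xv u \<theta> * yv v \<theta>" using assms(3) Lu by auto
  have nz: "xv v \<theta> \<noteq> 0 \<or> yv v \<theta> \<noteq> 0" "xv u \<theta> \<noteq> 0 \<or> yv u \<theta> \<noteq> 0"
    using values_nonzero[OF assms(2)] v(1) assms(4) u by auto
  have "xv w \<theta> * yv u \<theta> = xv u \<theta> * yv w \<theta> \<longleftrightarrow> xv w \<theta> * yv v \<theta> = xv v \<theta> * yv w \<theta>" for w
    using nz v(2) by (cases "xv w \<theta> = 0 \<and> yv w \<theta> = 0")
      (auto simp: proj_eq_iff[symmetric])
  thus ?thesis using Lu by simp
qed

definition rep_vec :: "'k::{field,finite} poly vec set \<Rightarrow> 'k poly vec" where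
  "rep_vec L = (SOME v. v \<in> L \<and> v \<noteq> 0\<^sub>v 2)"

text \<open>The point of the projective line over the closure that L determines at \<theta>; by
  \<open>gval_eq\<close> the chosen vector does not matter.\<close>

definition gval :: "'k::{field,finite} poly vec set \<Rightarrow> 'k alg_closure \<Rightarrow> 'k alg_closure option" where
  "gval L \<theta> = proj (xv (rep_vec L) \<theta>) (yv (rep_vec L) \<theta>)"

lemma rep_vec:
  assumes "L \<in> fibre_lines 2 b"
  shows "rep_vec L \<in> L" "rep_vec L \<noteq> 0\<^sub>v 2" "rep_vec L \<in> fibre 2 b"
proof -
  obtain u where u: "u \<in> fibre 2 b" "u \<noteq> 0\<^sub>v 2" "L = range (\<lambda>f. reduce b (f \<cdot>\<^sub>v u))"
    using assms by (auto simp: fibre_lines_def)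
  have sub: "L \<subseteq> fibre 2 b" using fibre_carrier[OF u(1)] by (auto simp: u(3) fibre_def)
  have "u \<in> L" unfolding u(3) using u(1) by (intro range_eqI[of _ _ 1]) (simp add: fibre_def)
  hence "\<exists>v. v \<in> L \<and> v \<noteq> 0\<^sub>v 2" using u(2) by blast
  hence "rep_vec L \<in> L \<and> rep_vec L \<noteq> 0\<^sub>v 2" unfolding rep_vec_def by (rule someI_ex)
  thus "rep_vec L \<in> L" "rep_vec L \<noteq> 0\<^sub>v 2" "rep_vec L \<in> fibre 2 b" using sub by auto
qed

lemma gval_eq:
  assumes "L \<in> fibre_lines 2 b" "conj_root b \<theta>" "v \<in> L" "v \<noteq> 0\<^sub>v 2"
  shows "gval L \<theta> = proj (xv v \<theta>) (yv v \<theta>)"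
proof -
  have *: "L = {w \<in> fibre 2 b. xv w \<theta> * yv v \<theta> = xv v \<theta> * yv w \<theta>}" by (rule fibre_linesD[OF assms])
  have "v \<in> fibre 2 b" "rep_vec L \<in> L" using * assms(3) rep_vec[OF assms(1)] by auto
  thus ?thesis unfolding gval_def
    using * values_nonzero[OF assms(2)] rep_vec[OF assms(1)] assms(4) by (subst proj_eq_iff) auto
qed

lemma gval_frob: "gval L (frob \<theta>) = map_option frob (gval L \<theta>)"
  by (auto simp: gval_def proj_def values_frob frob_divide)

text \<open>The lines are the points of the projective line over the residue field, which evaluation
  identifies with the fixed field of the d-th power of Frobenius. Injectivity comes from
  \<open>fibre_linesD\<close>; for surjectivity \<open>None\<close> lifts to (1, 0) and a finite
  value to (f, 1).\<close>

lemma bij_betw_gval: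
  fixes b :: "'k::{field,finite} point"
  assumes "conj_root b \<theta>"
  shows "bij_betw (\<lambda>L. gval L \<theta>) (fibre_lines 2 b) {z. (map_option frob ^^ point_degree b) z = z}"
proof -
  interpret geometric_root "local_prime b" \<theta> by (rule conj_root_geometric_root[OF assms(1)])
  have fp: "(map_option frob ^^ j) z = map_option (frob ^^ j) z" for j and z :: "'k alg_closure option"
    by (induction j) (auto simp: option.map_comp option.map_id option.map_ident o_def)
  show ?thesis unfolding bij_betw_def
  proof (intro conjI inj_onI)
    fix L L' assume L: "L \<in> fibre_lines 2 b" "L' \<in> fibre_lines 2 b" and eq: "gval L \<theta> = gval L' \<theta>"
    let ?v = "rep_vec L" and ?w = "rep_vec L'"
    note v = rep_vec[OF L(1)] and w = rep_vec[OF L(2)]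
    have nz: "xv ?v \<theta> \<noteq> 0 \<or> yv ?v \<theta> \<noteq> 0" "xv ?w \<theta> \<noteq> 0 \<or> yv ?w \<theta> \<noteq> 0"
      using values_nonzero[OF assms] v w by auto
    have "xv ?w \<theta> * yv ?v \<theta> = xv ?v \<theta> * yv ?w \<theta>" using eq nz unfolding gval_def by (simp add: proj_eq_iff)
    hence "?w \<in> L" using fibre_linesD[OF L(1) assms v(1,2)] w(3) by auto
    thus "L = L'" using fibre_linesD[OF L(1) assms _ w(2)] fibre_linesD[OF L(2) assms w(1,2)] by simp
  next
    show "(\<lambda>L. gval L \<theta>) ` fibre_lines 2 b = {z. (map_option frob ^^ point_degree b) z = z}"
    proof (intro Set.set_eqI iffI)
      fix z assume "z \<in> (\<lambda>L. gval L \<theta>) ` fibre_lines 2 b"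
      then obtain L where z: "z = gval L \<theta>" by blast
      have "gval L ((frob ^^ j) \<theta>) = (map_option frob ^^ j) (gval L \<theta>)" for j
        by (induction j) (simp_all add: gval_frob)
      from this[of "point_degree b"] show "z \<in> {z. (map_option frob ^^ point_degree b) z = z}"
        using frob_funpow_point_degree[OF assms] by (simp add: z)
    next
      fix z :: "'k alg_closure option" assume "z \<in> {z. (map_option frob ^^ point_degree b) z = z}"
      hence z: "map_option (frob ^^ point_degree b) z = z" by (simp add: fp)
      have line: "gval (range (\<lambda>f. reduce b (f \<cdot>\<^sub>v v))) \<theta> = proj (xv v \<theta>) (yv v \<theta>) \<and>
        range (\<lambda>f. reduce b (f \<cdot>\<^sub>v v)) \<in> fibre_lines 2 b" if "v \<in> fibre 2 b" "v \<noteq> 0\<^sub>v 2" for v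
      proof -
        have L: "range (\<lambda>f. reduce b (f \<cdot>\<^sub>v v)) \<in> fibre_lines 2 b" using that by (auto simp: fibre_lines_def)
        have "v \<in> range (\<lambda>f. reduce b (f \<cdot>\<^sub>v v))"
          using that by (intro range_eqI[of _ _ 1]) (simp add: fibre_def)
        thus ?thesis using gval_eq[OF L assms _ that(2)] L by blast
      qed
      have one: "1 mod local_prime b = 1" using reduced_iff[of 1] degree_pos by simp
      have "\<exists>v\<in>fibre 2 b. v \<noteq> 0\<^sub>v 2 \<and> z = proj (xv v \<theta>) (yv v \<theta>)"
      proof (cases z)
        case None
        show ?thesis
        proof (rule bexI[of _ "vec2 1 0"])
          show "vec2 1 0 \<in> fibre 2 b" unfolding fibre_def mem_Collect_eq reduce_vec2 mod_0 one by (rule conjI[OF vec2_carrier refl])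
        qed (simp add: None proj_def)
      next
        case (Some y)
        hence "y \<in> {y. (frob ^^ degree (local_prime b)) y = y}" using z by (simp add: point_degree_def)
        hence "y \<in> (\<lambda>x. poly (map_poly to_ac x) \<theta>) ` {x. x mod local_prime b = x}"
          unfolding bij_betw_imp_surj_on[OF bij_betw_residue] .
        then obtain f where f: "f mod local_prime b = f" "y = poly (map_poly to_ac f) \<theta>" by blast
        show ?thesis
        proof (rule bexI[of _ "vec2 f 1"])
          show "vec2 f 1 \<in> fibre 2 b" unfolding fibre_def mem_Collect_eq reduce_vec2 f(1) one by (rule conjI[OF vec2_carrier refl])
        qed (simp add: Some proj_def f(2))
      qed
      then obtain v where "v \<in> fibre 2 b" "v \<noteq> 0\<^sub>v 2" "z = proj (xv v \<theta>) (yv v \<theta>)" by blast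
      with line[of v] show "z \<in> (\<lambda>L. gval L \<theta>) ` fibre_lines 2 b" by (intro image_eqI) auto
    qed
  qed
qed

section \<open>Geometric indecomposability\<close>

definition split_config :: "nat \<Rightarrow> 'k::{field,finite} point set \<Rightarrow> ('k point \<Rightarrow> 'k alg_closure \<Rightarrow> 'k alg_closure option) \<Rightarrow> bool" where
  "split_config n D z \<longleftrightarrow> (\<exists>\<alpha> f h \<beta>. endo_data n f h \<and> \<alpha> * \<beta> - poly.coeff f 0 * h \<noteq> 0 \<and>
     (\<forall>b\<in>D. \<forall>\<theta>. conj_root b \<theta> \<longrightarrow> z b \<theta> = proj \<alpha> h \<or> z b \<theta> = proj (fev n f (point_at b \<theta>)) \<beta>))"

lemma bundle_ext_twist:
  "bundle_ext to_ac (bundle_sum (twist a) (twist b)) = bundle_sum (twist a) (twist b)"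
proof -
  have "Poly_Mapping.map to_ac 0 = 0" by (rule poly_mapping_eqI) (simp add: Poly_Mapping.map.rep_eq)
  thus ?thesis by (simp add: bundle_ext_def bundle_sum_twist)
qed

lemma fibre_span_eqI:
  assumes "fibre_subspace n c L" "S \<subseteq> L" "\<And>L'. fibre_subspace n c L' \<Longrightarrow> S \<subseteq> L' \<Longrightarrow> L \<subseteq> L'"
  shows "fibre_span n c S = L"
  unfolding fibre_span_def using assms by blast

lemma reduce_map_poly:
  assumes "conj_root b \<theta>" "v \<in> carrier_vec 2"
  shows "reduce (point_at b \<theta>) (map_vec (map_poly to_ac) v) = vec2 [:xv v \<theta>:] [:yv v \<theta>:]"
proof -
  obtain f g where v: "v = vec2 f g" using vec2_cases[OF assms(2)] .
  show ?thesis
    by (simp only: v map_vec2 reduce_rational[OF rational_point_at] pt_point_at[OF assms(1)] xv_vec2 yv_vec2)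
qed

lemma line_structuresD:
  "L \<in> line_structures D (bundle_sum (twist a) (twist b)) \<Longrightarrow> b' \<in> D \<Longrightarrow> L b' \<in> fibre_lines 2 b'"
  by (auto simp: line_structures_def)

lemma fibre_lines_subset: "L \<in> fibre_lines 2 b \<Longrightarrow> L \<subseteq> fibre 2 b"
  by (auto simp: fibre_lines_def fibre_def)

text \<open>For j = 1 the span remains a line, because all vectors of L b' have proportional values
  at \<theta>; for j = 0 the images of the two unit vectors already generate the fibre.\<close>

lemma flags_ext_line_flags:
  fixes D :: "'k::{field,finite} point set"
  assumes D: "reduced_divisor D" and L: "L \<in> line_structures D (bundle_sum (twist a) (twist b))"
    and b: "b' \<in> D" "conj_root b' \<theta>"
  shows "flags_ext to_ac 2 D (line_flags (bundle_sum (twist a) (twist b)) L) (point_at b' \<theta>) =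
    (\<lambda>j. if j = 0 then fibre 2 (point_at b' \<theta>) else
         if j = 1 then kline (xv (rep_vec (L b')) \<theta>) (yv (rep_vec (L b')) \<theta>) else {0\<^sub>v 2})"
proof
  fix j :: nat
  let ?c = "point_at b' \<theta>" and ?F = "line_flags (bundle_sum (twist a) (twist b)) L"
  have Lb: "L b' \<in> fibre_lines 2 b'" by (rule line_structuresD[OF L b(1)])
  have single: "{b \<in> D. lies_over to_ac ?c b} = {b'}"
    using D b lies_over_point_at[OF b(2)] by (auto simp: reduced_divisor_def)
  have F: "?F b' j = (if j = 0 then fibre 2 b' else if j = 1 then L b' else {0\<^sub>v 2})"
    by (simp add: line_flags_def)
  have Fsub: "?F b' j \<subseteq> carrier_vec 2"
    unfolding F using fibre_lines_subset[OF Lb] by (auto dest: fibre_carrier)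
  let ?I = "(\<lambda>v. vec2 [:xv v \<theta>:] [:yv v \<theta>:]) ` ?F b' j"
  have "(\<lambda>v. reduce ?c (map_vec (map_poly to_ac) v)) ` ?F b' j = ?I"
    by (rule image_cong[OF refl]) (use Fsub reduce_map_poly[OF b(2)] in blast)
  hence span: "flags_ext to_ac 2 D ?F ?c j = fibre_span 2 ?c ?I"
    unfolding flags_ext_def single by simp
  have rat: "rational_point ?c" by (rule rational_point_at)
  have scale: "vec2 [:s * x:] [:s * y:] \<in> L'" if "fibre_subspace 2 ?c L'" "vec2 [:x:] [:y:] \<in> L'" for s x y L'
  proof -
    have "reduce ?c ([:s:] \<cdot>\<^sub>v vec2 [:x:] [:y:]) \<in> L'" using that unfolding fibre_subspace_def by blast
    thus ?thesis by (simp add: reduce_rational[OF rat] mult.commute)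
  qed
  consider "j = 0" | "j = 1" | "j > 1" by linarith
  thus "flags_ext to_ac 2 D ?F ?c j = (if j = 0 then fibre 2 ?c else
         if j = 1 then kline (xv (rep_vec (L b')) \<theta>) (yv (rep_vec (L b')) \<theta>) else {0\<^sub>v 2})"
  proof cases
    case 1
    have "fibre_span 2 ?c ?I = fibre 2 ?c"
    proof (rule fibre_span_eqI[OF fibre_subspace_fibre])
      show "?I \<subseteq> fibre 2 ?c" by (auto simp: fibre_rational[OF rat])
      fix L' assume L': "fibre_subspace 2 ?c L'" "?I \<subseteq> L'"
      interpret geometric_root "local_prime b'" \<theta> by (rule conj_root_geometric_root[OF b(2)])
      have one: "1 mod local_prime b' = 1" using reduced_iff[of 1] degree_pos by simp
      have "?F b' j = fibre 2 b'" unfolding F using 1 by simp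
      hence "vec2 1 0 \<in> ?F b' j" "vec2 0 1 \<in> ?F b' j"
        by (simp_all only: fibre_def mem_Collect_eq reduce_vec2 mod_0 one vec2_carrier simp_thms)
      hence "vec2 [:1:] [:0:] \<in> ?I" "vec2 [:0:] [:1:] \<in> ?I"
        by (force intro: image_eqI[of _ _ "vec2 1 0"], force intro: image_eqI[of _ _ "vec2 0 1"])
      hence e: "vec2 [:1:] [:0:] \<in> L'" "vec2 [:0:] [:1:] \<in> L'" using L'(2) by blast+
      have "vec2 [:x:] [:y:] \<in> L'" for x y
      proof -
        have "vec2 [:x * 1:] [:x * 0:] + vec2 [:y * 0:] [:y * 1:] \<in> L'"
          using scale[OF L'(1) e(1)] scale[OF L'(1) e(2)] L'(1) unfolding fibre_subspace_def by blast
        thus ?thesis by simp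
      qed
      thus "fibre 2 ?c \<subseteq> L'" by (auto simp: fibre_rational[OF rat])
    qed
    thus ?thesis using span 1 by simp
  next
    case 2
    let ?v = "rep_vec (L b')"
    note v = rep_vec[OF Lb]
    have Fj: "?F b' j = L b'" unfolding F using 2 by simp
    have nz: "xv ?v \<theta> \<noteq> 0 \<or> yv ?v \<theta> \<noteq> 0" by (rule values_nonzero[OF b(2) v(3,2)])
    have "fibre_span 2 ?c ?I = kline (xv ?v \<theta>) (yv ?v \<theta>)"
    proof (rule fibre_span_eqI[OF fibre_subspace_kline[OF rat]])
      show "?I \<subseteq> kline (xv ?v \<theta>) (yv ?v \<theta>)"
      proof safe
        fix u assume "u \<in> ?F b' j"
        hence "u \<in> L b'" by (simp only: Fj)
        hence "xv u \<theta> * yv ?v \<theta> = xv ?v \<theta> * yv u \<theta>" using fibre_linesD[OF Lb b(2) v(1,2)] by auto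
        thus "vec2 [:xv u \<theta>:] [:yv u \<theta>:] \<in> kline (xv ?v \<theta>) (yv ?v \<theta>)" using nz by (simp add: kline_mem_iff)
      qed
      fix L' assume L': "fibre_subspace 2 ?c L'" "?I \<subseteq> L'"
      have "?v \<in> ?F b' j" using v(1) by (simp only: Fj)
      hence "vec2 [:xv ?v \<theta>:] [:yv ?v \<theta>:] \<in> L'" using L'(2) by blast
      thus "kline (xv ?v \<theta>) (yv ?v \<theta>) \<subseteq> L'" using scale[OF L'(1)] by (auto simp: kline_def)
    qed
    thus ?thesis using span 2 by simp
  next
    case 3
    have "?F b' j = {0\<^sub>v 2}" unfolding F using 3 by simp
    hence "?I = {0\<^sub>v 2}" by (simp flip: vec2_zero)
    moreover have "fibre_span 2 ?c {0\<^sub>v 2} = {0\<^sub>v 2}"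
      by (rule fibre_span_eqI[OF fibre_subspace_zero]) auto
    ultimately show ?thesis using span 3 by simp
  qed
qed

theorem geom_indecomposable_iff:
  fixes D :: "'k::{field,finite} point set"
  assumes n: "n = nat (a - b)" "b \<le> a" and D: "reduced_divisor D"
    and L: "L \<in> line_structures D (bundle_sum (twist a) (twist b))"
  shows "geom_indecomposable D (bundle_sum (twist a) (twist b), line_flags (bundle_sum (twist a) (twist b)) L)
    \<longleftrightarrow> \<not> split_config n D (\<lambda>b. gval (L b))"
proof -
  let ?E = "divisor_ext to_ac D" and ?g = "bundle_sum (twist a) (twist b) :: 'k vbundle"
  \<comment> \<open>Coordinates in \<open>line_type\<close> are functions of the point of the
    extended divisor, so the point b underneath has to be recovered from it; \<open>pt\<close>
    recovers the root.\<close>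
  define below where "below c = (SOME b. b \<in> D \<and> (\<exists>\<theta>. conj_root b \<theta> \<and> c = point_at b \<theta>))" for c :: "'k alg_closure point"
  have cl: "closed_point b" if "b \<in> D" for b using D that by (simp add: reduced_divisor_def)
  have uniq: "b' = b"
    if "b \<in> D" "conj_root b \<theta>" "b' \<in> D" "conj_root b' \<theta>'" "point_at b \<theta> = point_at b' \<theta>'" for b \<theta> b' \<theta>'
  proof -
    have "lies_over to_ac (point_at b \<theta>) b'"
      unfolding that(5) by (rule lies_over_point_at[OF that(4) cl[OF that(3)], THEN iffD2, OF refl])
    thus ?thesis by (rule lies_over_point_at[OF that(2) cl[OF that(3)], THEN iffD1])
  qed
  have below: "below (point_at b \<theta>) = b" if "b \<in> D" "conj_root b \<theta>" for b \<theta>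
    unfolding below_def using that uniq[OF that] by (intro some_equality) blast+
  define x y where "x c = xv (rep_vec (L (below c))) (pt c)" and "y c = yv (rep_vec (L (below c))) (pt c)" for c
  have xy: "x (point_at b \<theta>) = xv (rep_vec (L b)) \<theta>" "y (point_at b \<theta>) = yv (rep_vec (L b)) \<theta>"
    if "b \<in> D" "conj_root b \<theta>" for b \<theta>
    using that by (simp_all add: x_def y_def below pt_point_at)
  have lt: "line_type ?E (flags_ext to_ac 2 D (line_flags ?g L)) x y"
    unfolding line_type_def divisor_ext_eq[OF D]
  proof safe
    fix b \<theta> assume b: "b \<in> D" "conj_root b \<theta>"
    show "rational_point (point_at b \<theta>)" by (rule rational_point_at)
    show "flags_ext to_ac 2 D (line_flags ?g L) (point_at b \<theta>) = (\<lambda>j. if j = 0 then fibre 2 (point_at b \<theta>)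
      else if j = 1 then kline (x (point_at b \<theta>)) (y (point_at b \<theta>)) else {0\<^sub>v 2})"
      unfolding xy[OF b] by (rule flags_ext_line_flags[OF D L b])
    assume "y (point_at b \<theta>) = 0" "x (point_at b \<theta>) = 0"
    thus False using values_nonzero[OF b(2)] rep_vec[OF line_structuresD[OF L b(1)]] by (auto simp: xy[OF b])
  qed
  have "par_ext to_ac D (?g, line_flags ?g L) = (bundle_sum (twist a) (twist b), flags_ext to_ac 2 D (line_flags ?g L))"
    by (simp add: par_ext_def bundle_ext_twist)
  hence "geom_indecomposable D (?g, line_flags ?g L) \<longleftrightarrow> \<not> split_lines n ?E (\<lambda>c. proj (x c) (y c))"
    unfolding geom_indecomposable_def by (simp only: par_indecomposable_iff[OF n lt])
  also have "split_lines n ?E (\<lambda>c. proj (x c) (y c)) \<longleftrightarrow> split_config n D (\<lambda>b. gval (L b))"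
  proof -
    have "(\<forall>c\<in>?E. proj (x c) (y c) = u \<or> proj (x c) (y c) = w c) \<longleftrightarrow>
      (\<forall>b\<in>D. \<forall>\<theta>. conj_root b \<theta> \<longrightarrow> gval (L b) \<theta> = u \<or> gval (L b) \<theta> = w (point_at b \<theta>))" for u w
    proof -
      have "gval (L b) \<theta> = proj (x (point_at b \<theta>)) (y (point_at b \<theta>))" if "b \<in> D" "conj_root b \<theta>" for b \<theta>
        by (simp add: gval_def xy[OF that])
      note G = this
      have E: "(\<forall>c\<in>?E. Q c) \<longleftrightarrow> (\<forall>b\<in>D. \<forall>\<theta>. conj_root b \<theta> \<longrightarrow> Q (point_at b \<theta>))" for Q
        unfolding divisor_ext_eq[OF D] by blast
      show ?thesis unfolding E by (auto simp: G)
    qed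
    thus ?thesis unfolding split_lines_def split_config_def by simp
  qed
  finally show ?thesis .
qed

section \<open>Automorphisms acting on line configurations\<close>

lemma fev_point_at:
  assumes "conj_root b \<theta>"
  shows "fev n f (point_at b \<theta>) = (if b = Infinity then poly.coeff f n else poly f \<theta>)"
proof (cases b)
  case (Affine p)
  thus ?thesis using pt_point_at[OF assms] by (simp add: fev_def)
next
  case Infinity
  thus ?thesis by (simp add: fev_def pt_def poly_0_coeff_0 coeff_rev_poly)
qed

text \<open>The geometric points at which the line differs from the fibre [1 : 0] of O(a). They are
  recorded as pairs because infinity and t = 0 share the root 0.\<close>

definition finite_values :: "'k::{field,finite} point set \<Rightarrow> ('k point \<Rightarrow> 'k alg_closure \<Rightarrow> 'k alg_closure option) \<Rightarrow> ('k point \<times> 'k alg_closure) set" where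
  "finite_values D z = {(b, \<theta>). b \<in> D \<and> conj_root b \<theta> \<and> z b \<theta> \<noteq> None}"

lemma finite_values_subset:
  "finite_values D z \<subseteq> Sigma D (\<lambda>b. {\<theta>. conj_root b \<theta>})"
  by (auto simp: finite_values_def)

lemma finite_finite_values:
  assumes "reduced_divisor D"
  shows "finite (finite_values D z)"
  by (rule finite_subset[OF finite_values_subset])
     (use assms in \<open>auto simp: reduced_divisor_def finite_conj_root\<close>)

lemma inj_on_snd_conj_root: "inj_on snd {(b, \<theta>). b \<noteq> Infinity \<and> conj_root b \<theta>}"
proof (rule inj_onI, clarsimp)
  fix b \<theta> b' assume *: "b \<noteq> Infinity" "conj_root b \<theta>" "b' \<noteq> Infinity" "conj_root b' \<theta>"
  obtain p p' where "b = Affine p" "b' = Affine p'" using *(1,3) by (meson point.exhaust)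
  thus "b = b'" using conj_root_unique[of p \<theta> p'] *(2,4) by simp
qed

text \<open>Roots separate the affine points, so these may be replaced by the set T of their roots;
  the point at infinity is counted apart.\<close>

lemma finite_values_split:
  fixes D :: "'k::{field,finite} point set" and z
  assumes D: "reduced_divisor D"
  defines "T \<equiv> snd ` {(b, \<theta>) \<in> finite_values D z. b \<noteq> Infinity}"
  shows "finite T" and "card (finite_values D z) = card T + (if (Infinity, 0) \<in> finite_values D z then 1 else 0)"
proof -
  let ?A = "{(b, \<theta>) \<in> finite_values D z. b \<noteq> Infinity}"
  have finA: "finite ?A" by (rule finite_subset[OF _ finite_finite_values[OF D, of z]]) auto
  thus "finite T" unfolding T_def by simp
  have "inj_on snd ?A" by (rule inj_on_subset[OF inj_on_snd_conj_root]) (auto simp: finite_values_def)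
  hence cT: "card T = card ?A" unfolding T_def by (rule card_image)
  have eq: "finite_values D z = ?A \<union> (if (Infinity, 0) \<in> finite_values D z then {(Infinity, 0)} else {})"
    by (auto simp: finite_values_def conj_root_Infinity)
  have "card (finite_values D z) = card ?A + card (if (Infinity, 0) \<in> finite_values D z then {(Infinity :: 'k point, 0 :: 'k alg_closure)} else {})"
    by (subst eq, rule card_Un_disjoint) (use finA in auto)
  thus "card (finite_values D z) = card T + (if (Infinity, 0) \<in> finite_values D z then 1 else 0)" by (simp add: cT)
qed

text \<open>Sections of O(n) take prescribed values at up to n + 1 points of the projective line.
  The value s at infinity is the coefficient of degree n, so \<open>monom s n\<close> is split off
  and the affine values are corrected by it before interpolating.\<close>

lemma exists_interpolating_section:
  assumes D: "reduced_divisor D" and card: "card (finite_values D z) \<le> n + 1"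
  shows "\<exists>f. degree f \<le> n \<and> (\<forall>(b, \<theta>)\<in>finite_values D z. z b \<theta> = Some (fev n f (point_at b \<theta>)))"
proof -
  define T where "T = snd ` {(b, \<theta>) \<in> finite_values D z. b \<noteq> Infinity}"
  note T = finite_values_split[OF D, of z, folded T_def]
  define pr where "pr \<theta> = (SOME b. (b, \<theta>) \<in> finite_values D z \<and> b \<noteq> Infinity)" for \<theta>
  have pr: "pr \<theta> = b" if "(b, \<theta>) \<in> finite_values D z" "b \<noteq> Infinity" for b \<theta>
  proof -
    have "(pr \<theta>, \<theta>) \<in> finite_values D z \<and> pr \<theta> \<noteq> Infinity"
      unfolding pr_def by (rule someI[of _ b]) (use that in simp)
    thus ?thesis using inj_onD[OF inj_on_snd_conj_root, of "(pr \<theta>, \<theta>)" "(b, \<theta>)"] that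
      by (auto simp: finite_values_def)
  qed
  define v where "v \<theta> = the (z (pr \<theta>) \<theta>)" for \<theta>
  define s where "s = (if (Infinity, 0) \<in> finite_values D z then the (z Infinity 0) else 0)"
  obtain f where f: "\<forall>\<theta>\<in>T. poly f \<theta> = v \<theta> - s * \<theta> ^ n" "\<forall>i\<ge>card T. poly.coeff f i = 0"
    using interpolation[OF T(1), of "\<lambda>\<theta>. v \<theta> - s * \<theta> ^ n"] by blast
  show ?thesis
  proof (intro exI conjI ballI, safe)
    show "degree (f + monom s n) \<le> n"
    proof (rule degree_le, safe)
      fix i assume "n < i"
      thus "poly.coeff (f + monom s n) i = 0" using f(2) T(2) card by (auto split: if_splits)
    qed
    fix b \<theta> assume b: "(b, \<theta>) \<in> finite_values D z"
    hence cr: "conj_root b \<theta>" and nn: "z b \<theta> \<noteq> None" by (auto simp: finite_values_def)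
    show "z b \<theta> = Some (fev n (f + monom s n) (point_at b \<theta>))"
    proof (cases "b = Infinity")
      case True
      hence "\<theta> = 0" using cr by (simp add: conj_root_Infinity)
      hence inf: "(Infinity, 0) \<in> finite_values D z" using b True by simp
      \<comment> \<open>Infinity uses up one of the n + 1 conditions, so \<open>card T\<close> is at
        most n and the affine interpolant has no term of degree n.\<close>
      hence "poly.coeff f n = 0" using f(2) T(2) card by auto
      thus ?thesis unfolding fev_point_at[OF cr] using nn inf True \<open>\<theta> = 0\<close> by (auto simp: s_def)
    next
      case False
      have "\<theta> \<in> T" unfolding T_def using b False by force
      hence "poly (f + monom s n) \<theta> = v \<theta>" using f(1) by (simp add: poly_monom)
      thus ?thesis unfolding fev_point_at[OF cr] using False nn pr[OF b False] by (auto simp: v_def)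
    qed
  qed
qed

text \<open>A nonzero section of O(n) has at most n zeros. A zero at infinity lowers the degree of f
  below n, which compensates for the affine root that is then missing.\<close>

lemma section_eq_zero:
  assumes D: "reduced_divisor D" and card: "card (finite_values D z) \<ge> n + 1" and deg: "degree f \<le> n"
    and zero: "\<And>b \<theta>. (b, \<theta>) \<in> finite_values D z \<Longrightarrow> fev n f (point_at b \<theta>) = 0"
  shows "f = 0"
proof -
  define T where "T = snd ` {(b, \<theta>) \<in> finite_values D z. b \<noteq> Infinity}"
  note T = finite_values_split[OF D, of z, folded T_def]
  have root: "poly f \<theta> = 0" if "\<theta> \<in> T" for \<theta>
  proof -
    obtain b where b: "(b, \<theta>) \<in> finite_values D z" "b \<noteq> Infinity" using \<open>\<theta> \<in> T\<close> by (auto simp: T_def)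
    hence "conj_root b \<theta>" by (simp add: finite_values_def)
    from fev_point_at[OF this, of n f] zero[OF b(1)] b(2) show ?thesis by simp
  qed
  show ?thesis
  proof (cases "(Infinity, 0) \<in> finite_values D z")
    case False
    show ?thesis by (rule poly_eqI_degree[of T]) (use root T(2) card deg False in auto)
  next
    case True
    hence c: "poly.coeff f n = 0" using zero[OF True] fev_point_at[of Infinity 0 n f] by (simp add: conj_root_Infinity)
    show ?thesis
    proof (rule ccontr)
      assume "f \<noteq> 0"
      hence "degree f \<noteq> n" using c by auto
      hence "degree f < card T" using deg T(2) card True by simp
      hence "f = 0" by (intro poly_eqI_degree[of T]) (use root in auto)
      thus False using \<open>f \<noteq> 0\<close> by simp
    qed
  qed
qed

lemma proj_1_0 [simp]: "proj 1 0 = None"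
  by (simp add: proj_def)

lemma proj_by_1 [simp]: "proj x 1 = Some x"
  by (simp add: proj_def)

lemma split_config_of_section:
  assumes "degree f \<le> n"
    and "\<And>b \<theta>. b \<in> D \<Longrightarrow> conj_root b \<theta> \<Longrightarrow> z b \<theta> = None \<or> z b \<theta> = Some (fev n f (point_at b \<theta>))"
  shows "split_config n D z"
  unfolding split_config_def
proof (intro exI conjI ballI allI impI)
  show "endo_data n f 0" using assms(1) by (simp add: endo_data_def)
  fix b \<theta> assume "b \<in> D" "conj_root b \<theta>"
  from assms(2)[OF this] show "z b \<theta> = proj 1 0 \<or> z b \<theta> = proj (fev n f (point_at b \<theta>)) 1" by simp
qed simp

text \<open>A complement of O(a) can be interpolated through all the finite values, and the
  remaining lines are fibres of O(a) itself. This bound is the origin of the threshold n + 2 in the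
  formula for a > b.\<close>

lemma split_config_of_card_le:
  assumes "reduced_divisor D" "card (finite_values D z) \<le> n + 1"
  shows "split_config n D z"
proof -
  obtain f where f: "degree f \<le> n" "\<forall>(b, \<theta>)\<in>finite_values D z. z b \<theta> = Some (fev n f (point_at b \<theta>))"
    using exists_interpolating_section[OF assms] by blast
  show ?thesis
  proof (rule split_config_of_section[OF f(1)])
    fix b \<theta> assume "b \<in> D" "conj_root b \<theta>"
    thus "z b \<theta> = None \<or> z b \<theta> = Some (fev n f (point_at b \<theta>))"
      using bspec[OF f(2), of "(b, \<theta>)"] by (cases "z b \<theta>") (simp_all add: finite_values_def)
  qed
qed

text \<open>The value of f times h' is at every point the scalar appearing in
  \<open>endo_comp\<close>. Fibrewise determinants therefore coincide with the global one.\<close>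

lemma fev_mult_offdiag:
  assumes "endo_data n f h" "endo_data n f' h'"
  shows "fev n f c * h' = poly.coeff f 0 * h'"
proof (cases "n = 0")
  case True
  then obtain \<gamma> where "f = [:\<gamma>:]" using assms by (auto simp: endo_data_def elim!: degree_eq_zeroE)
  thus ?thesis using True by simp
qed (use assms in \<open>simp add: endo_data_def\<close>)

lemma reduce_smult: "reduce b (f \<cdot>\<^sub>v reduce b w) = reduce b (f \<cdot>\<^sub>v w)"
  by (rule eq_vecI) (auto simp: reduce_def mod_mult_right_eq)

section \<open>The automorphism group acting on line structures\<close>

locale rank2_bundle =
  fixes a b :: int and n :: nat and g :: "'k::{field,finite} vbundle" and D :: "'k point set"
  assumes n: "n = nat (a - b)" and ab: "b \<le> a" and g: "g = bundle_sum (twist a) (twist b)"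
    and D: "reduced_divisor D"
begin

lemma finite_D: "finite D"
  using D by (simp add: reduced_divisor_def)

lemma closed_D: "b' \<in> D \<Longrightarrow> closed_point b'"
  using D by (simp add: reduced_divisor_def)

lemma rank_g [simp]: "bundle_rank g = 2"
  by (simp add: g)

lemma aut_iff: "\<phi> \<in> bundle_aut g \<longleftrightarrow>
    (\<exists>\<alpha> f h \<beta>. \<phi> = endo n \<alpha> f h \<beta> \<and> endo_data n f h \<and> \<alpha> * \<beta> - poly.coeff f 0 * h \<noteq> 0)"
  unfolding g by (rule endo_in_bundle_aut_iff[OF n ab])

lemma aut_hom: "\<phi> \<in> bundle_aut g \<Longrightarrow> \<phi> \<in> bundle_hom g g"
  by (simp add: bundle_aut_def)

lemma aut_inverse:
  assumes "\<phi> \<in> bundle_aut g"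
  obtains \<psi> where "\<psi> \<in> bundle_aut g" "bundle_comp \<psi> \<phi> = bundle_id g" "bundle_comp \<phi> \<psi> = bundle_id g"
  using assms unfolding bundle_aut_def by blast

lemma aut_comp:
  assumes "\<phi> \<in> bundle_aut g" "\<psi> \<in> bundle_aut g"
  shows "bundle_comp \<phi> \<psi> \<in> bundle_aut g"
proof -
  obtain \<alpha> f h \<beta> where p: "\<phi> = endo n \<alpha> f h \<beta>" "endo_data n f h" "\<alpha> * \<beta> - poly.coeff f 0 * h \<noteq> 0"
    using assms(1) unfolding aut_iff by blast
  obtain \<alpha>' f' h' \<beta>' where p': "\<psi> = endo n \<alpha>' f' h' \<beta>'" "endo_data n f' h'" "\<alpha>' * \<beta>' - poly.coeff f' 0 * h' \<noteq> 0"
    using assms(2) unfolding aut_iff by blast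
  have "(\<alpha> * \<alpha>' + poly.coeff f 0 * h') * (h * poly.coeff f' 0 + \<beta> * \<beta>') -
      poly.coeff (Polynomial.smult \<alpha> f' + Polynomial.smult \<beta>' f) 0 * (h * \<alpha>' + \<beta> * h') =
      (\<alpha> * \<beta> - poly.coeff f 0 * h) * (\<alpha>' * \<beta>' - poly.coeff f' 0 * h')"
    by (simp add: algebra_simps)
  also have "\<dots> \<noteq> 0" using p(3) p'(3) by simp
  finally show ?thesis
    unfolding aut_iff p(1) p'(1) endo_comp[OF p(2) p'(2)] using endo_data_comp[OF p(2) p'(2)] by blast
qed

lemma fibre_map_fibre: "\<phi> \<in> bundle_hom g g \<Longrightarrow> v \<in> fibre 2 b' \<Longrightarrow> fibre_map \<phi> b' v \<in> fibre 2 b'"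
  using bundle_hom_carrier(3)[of \<phi> g g b'] fibre_carrier[of v 2 b'] by (auto simp: fibre_map_def fibre_def)

lemma fibre_map_inverse:
  assumes "\<phi> \<in> bundle_hom g g" "\<psi> \<in> bundle_hom g g" "bundle_comp \<psi> \<phi> = bundle_id g" "v \<in> fibre 2 b'"
  shows "fibre_map \<psi> b' (fibre_map \<phi> b' v) = v"
  using fibre_map_comp[OF assms(2,1), of v b'] fibre_map_id[of v g b'] assms(3,4) fibre_carrier[OF assms(4)] by simp

lemma fibre_map_line:
  assumes "\<phi> \<in> bundle_aut g" "L \<in> fibre_lines 2 b'"
  shows "fibre_map \<phi> b' ` L \<in> fibre_lines 2 b'"
proof -
  obtain v where v: "v \<in> fibre 2 b'" "v \<noteq> 0\<^sub>v 2" "L = range (\<lambda>f. reduce b' (f \<cdot>\<^sub>v v))"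
    using assms(2) by (auto simp: fibre_lines_def)
  have vc: "v \<in> carrier_vec 2" using fibre_carrier[OF v(1)] .
  obtain \<psi> where \<psi>: "\<psi> \<in> bundle_aut g" "bundle_comp \<psi> \<phi> = bundle_id g" using aut_inverse[OF assms(1)] .
  let ?w = "fibre_map \<phi> b' v"
  have A: "chart_matrix \<phi> b' \<in> carrier_mat 2 2" using bundle_hom_carrier(3)[OF aut_hom[OF assms(1)]] by simp
  have "?w \<noteq> 0\<^sub>v 2"
  proof
    assume w0: "?w = 0\<^sub>v 2"
    have B: "chart_matrix \<psi> b' \<in> carrier_mat 2 2" using bundle_hom_carrier(3)[OF aut_hom[OF \<psi>(1)]] by simp
    have "v = fibre_map \<psi> b' (0\<^sub>v 2)"
      using fibre_map_inverse[OF aut_hom[OF assms(1)] aut_hom[OF \<psi>(1)] \<psi>(2) v(1)] w0 by simp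
    also have "chart_matrix \<psi> b' *\<^sub>v 0\<^sub>v 2 = 0\<^sub>v 2" using B by (intro eq_vecI) auto
    hence "fibre_map \<psi> b' (0\<^sub>v 2) = 0\<^sub>v 2" using fibre_zero[of 2 b'] by (simp add: fibre_map_def fibre_def)
    finally show False using v(2) by simp
  qed
  moreover have "fibre_map \<phi> b' ` L = range (\<lambda>f. reduce b' (f \<cdot>\<^sub>v ?w))"
    unfolding v(3) image_image
  proof (rule image_cong[OF refl])
    fix f
    have "fibre_map \<phi> b' (reduce b' (f \<cdot>\<^sub>v v)) = reduce b' (chart_matrix \<phi> b' *\<^sub>v (f \<cdot>\<^sub>v v))"
      unfolding fibre_map_def by (rule reduce_mult_vec[OF A]) (use vc in simp)
    also have "chart_matrix \<phi> b' *\<^sub>v (f \<cdot>\<^sub>v v) = f \<cdot>\<^sub>v (chart_matrix \<phi> b' *\<^sub>v v)"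
      by (rule mat2_cases[OF A], rule vec2_cases[OF vc]) (simp add: algebra_simps)
    finally show "fibre_map \<phi> b' (reduce b' (f \<cdot>\<^sub>v v)) = reduce b' (f \<cdot>\<^sub>v ?w)"
      by (simp add: fibre_map_def reduce_smult)
  qed
  moreover have "?w \<in> fibre 2 b'" using fibre_map_fibre[OF aut_hom[OF assms(1)] v(1)] .
  ultimately show ?thesis unfolding fibre_lines_def by blast
qed

abbreviation "structures \<equiv> line_structures D g"

lemma structuresD: "L \<in> structures \<Longrightarrow> b' \<in> D \<Longrightarrow> L b' \<in> fibre_lines 2 b'"
  by (auto simp: line_structures_def)

lemma line_act_structures: "\<phi> \<in> bundle_aut g \<Longrightarrow> L \<in> structures \<Longrightarrow> line_act D \<phi> L \<in> structures"
  unfolding line_structures_def rank_g line_act_def by (rule restrict_PiE_iff[THEN iffD2]) (auto intro!: fibre_map_line)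

lemma line_act_comp:
  assumes "\<phi> \<in> bundle_hom g g" "\<psi> \<in> bundle_hom g g" "L \<in> structures"
  shows "line_act D (bundle_comp \<psi> \<phi>) L = line_act D \<psi> (line_act D \<phi> L)"
  unfolding line_act_def
proof (rule restrict_ext)
  fix b' assume b': "b' \<in> D"
  have "L b' \<subseteq> carrier_vec 2" using fibre_lines_subset[OF structuresD[OF assms(3) b']] fibre_carrier by auto
  hence "fibre_map (bundle_comp \<psi> \<phi>) b' ` L b' = (\<lambda>v. fibre_map \<psi> b' (fibre_map \<phi> b' v)) ` L b'"
    by (intro image_cong refl fibre_map_comp[OF assms(2,1)]) auto
  thus "fibre_map (bundle_comp \<psi> \<phi>) b' ` L b' = fibre_map \<psi> b' ` (\<lambda>b\<in>D. fibre_map \<phi> b ` L b) b'"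
    using b' by (simp add: image_image)
qed

lemma line_act_id:
  assumes "L \<in> structures"
  shows "line_act D (bundle_id g) L = L"
proof -
  have "fibre_map (bundle_id g) b' ` L b' = L b'" if b': "b' \<in> D" for b'
  proof -
    have "fibre_map (bundle_id g) b' v = v" if "v \<in> L b'" for v
      using fibre_lines_subset[OF structuresD[OF assms b']] that by (intro fibre_map_id) auto
    thus ?thesis by simp
  qed
  thus ?thesis using assms by (auto simp: line_act_def line_structures_def PiE_def extensional_def fun_eq_iff)
qed

lemma values_fibre_map:
  assumes "conj_root b' \<theta>" "v \<in> carrier_vec 2"
  shows "xv (fibre_map (endo n \<alpha> f h \<beta>) b' v) \<theta> = to_ac \<alpha> * xv v \<theta> + fev n (map_poly to_ac f) (point_at b' \<theta>) * yv v \<theta>"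
    and "yv (fibre_map (endo n \<alpha> f h \<beta>) b' v) \<theta> = to_ac h * xv v \<theta> + to_ac \<beta> * yv v \<theta>"
proof -
  obtain v1 v2 where v: "v = vec2 v1 v2" using vec2_cases[OF assms(2)] .
  have rp: "map_poly to_ac (rev_poly n f) = rev_poly n (map_poly to_ac f)"
    by (rule poly_eqI) (simp add: coeff_rev_poly)
  let ?r = "case point_at b' \<theta> of Affine _ \<Rightarrow> f | Infinity \<Rightarrow> rev_poly n f"
  have ch: "chart_matrix (endo n \<alpha> f h \<beta>) b' = mat2 [:\<alpha>:] ?r [:h:] [:\<beta>:]"
    by (cases b') (simp_all add: endo_def)
  have ev: "poly (map_poly to_ac ?r) \<theta> = fev n (map_poly to_ac f) (point_at b' \<theta>)"
    using pt_point_at[OF assms(1)] by (cases b') (simp_all add: fev_def rp)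
  show "xv (fibre_map (endo n \<alpha> f h \<beta>) b' v) \<theta> = to_ac \<alpha> * xv v \<theta> + fev n (map_poly to_ac f) (point_at b' \<theta>) * yv v \<theta>"
    "yv (fibre_map (endo n \<alpha> f h \<beta>) b' v) \<theta> = to_ac h * xv v \<theta> + to_ac \<beta> * yv v \<theta>"
    unfolding fibre_map_def ch v mat2_mult_vec2 values_reduce[OF assms(1) vec2_carrier] xv_vec2 yv_vec2
      ac_poly.hom_add ac_poly.hom_mult poly_add poly_mult ev by (simp_all add: ac.map_poly_pCons_hom)
qed

definition geom_indec :: "('k point \<Rightarrow> 'k poly vec set) set" where
  "geom_indec = {L \<in> structures. geom_indecomposable D (g, line_flags g L)}"

lemma geom_indec_iff: "L \<in> geom_indec \<longleftrightarrow> L \<in> structures \<and> \<not> split_config n D (\<lambda>b. gval (L b))"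
  unfolding geom_indec_def using geom_indecomposable_iff[OF n ab D] by (auto simp: g)

text \<open>In coordinates an automorphism acts by a fractional linear transformation that depends
  on the geometric point only through the value of f.\<close>

lemma gval_line_act:
  assumes "endo n \<alpha> f h \<beta> \<in> bundle_aut g" "L \<in> structures" "b' \<in> D" "conj_root b' \<theta>"
  shows "gval (line_act D (endo n \<alpha> f h \<beta>) L b') \<theta> =
    proj (to_ac \<alpha> * xv (rep_vec (L b')) \<theta> + fev n (map_poly to_ac f) (point_at b' \<theta>) * yv (rep_vec (L b')) \<theta>)
      (to_ac h * xv (rep_vec (L b')) \<theta> + to_ac \<beta> * yv (rep_vec (L b')) \<theta>)"
proof -
  let ?\<phi> = "endo n \<alpha> f h \<beta>" and ?v = "rep_vec (L b')"
  note Lb = structuresD[OF assms(2,3)]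
  note v = rep_vec[OF Lb]
  obtain \<psi> where \<psi>: "\<psi> \<in> bundle_aut g" "bundle_comp \<psi> ?\<phi> = bundle_id g" using aut_inverse[OF assms(1)] .
  have "fibre_map ?\<phi> b' ?v \<noteq> 0\<^sub>v 2"
  proof
    assume w0: "fibre_map ?\<phi> b' ?v = 0\<^sub>v 2"
    have B: "chart_matrix \<psi> b' \<in> carrier_mat 2 2" using bundle_hom_carrier(3)[OF aut_hom[OF \<psi>(1)]] by simp
    have "?v = fibre_map \<psi> b' (0\<^sub>v 2)"
      using fibre_map_inverse[OF aut_hom[OF assms(1)] aut_hom[OF \<psi>(1)] \<psi>(2) v(3)] w0 by simp
    also have "chart_matrix \<psi> b' *\<^sub>v 0\<^sub>v 2 = 0\<^sub>v 2" using B by (intro eq_vecI) auto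
    hence "fibre_map \<psi> b' (0\<^sub>v 2) = 0\<^sub>v 2" using fibre_zero[of 2 b'] by (simp add: fibre_map_def fibre_def)
    finally show False using v(2) by simp
  qed
  hence "gval (fibre_map ?\<phi> b' ` L b') \<theta> = proj (xv (fibre_map ?\<phi> b' ?v) \<theta>) (yv (fibre_map ?\<phi> b' ?v) \<theta>)"
    using v(1) by (intro gval_eq[OF fibre_map_line[OF assms(1) Lb] assms(4)]) auto
  thus ?thesis using values_fibre_map[OF assms(4) fibre_carrier[OF v(3)]] assms(3) by (simp add: line_act_def)
qed

lemma proj_transform:
  assumes "\<alpha> * \<beta> - F * h \<noteq> (0 :: 'l::field)" "x \<noteq> 0 \<or> y \<noteq> 0" "x' \<noteq> 0 \<or> y' \<noteq> 0" "proj x y = proj x' y'"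
  shows "proj (\<alpha> * x + F * y) (h * x + \<beta> * y) = proj (\<alpha> * x' + F * y') (h * x' + \<beta> * y')"
proof -
  have nz: "\<alpha> * x + F * y \<noteq> 0 \<or> h * x + \<beta> * y \<noteq> 0" if "x \<noteq> 0 \<or> y \<noteq> 0" for x y
  proof (rule ccontr)
    assume "\<not> ?thesis"
    hence z: "\<alpha> * x + F * y = 0" "h * x + \<beta> * y = 0" by auto
    have "(\<alpha> * \<beta> - F * h) * x = \<beta> * (\<alpha> * x + F * y) - F * (h * x + \<beta> * y)"
      "(\<alpha> * \<beta> - F * h) * y = \<alpha> * (h * x + \<beta> * y) - h * (\<alpha> * x + F * y)" by (simp_all add: algebra_simps)
    hence "(\<alpha> * \<beta> - F * h) * x = 0" "(\<alpha> * \<beta> - F * h) * y = 0" by (simp_all only: z mult_zero_right diff_self)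
    thus False using assms(1) that by simp
  qed
  have "x * y' = x' * y" using assms(2-4) by (simp add: proj_eq_iff)
  hence "(\<alpha> * \<beta> - F * h) * (x * y' - x' * y) = 0" by simp
  hence "(\<alpha> * x + F * y) * (h * x' + \<beta> * y') = (\<alpha> * x' + F * y') * (h * x + \<beta> * y)" by (simp add: algebra_simps)
  thus ?thesis using nz[OF assms(2)] nz[OF assms(3)] by (simp add: proj_eq_iff)
qed

lemma endo_data_to_ac: "endo_data n f h \<Longrightarrow> endo_data n (map_poly to_ac f) (to_ac h)"
  by (auto simp: endo_data_def)

text \<open>The new splitting consists of the columns of the product of \<phi>, extended to the
  closure, with the automorphism of the old splitting. Applied to the inverse of \<phi>, this shows
  that the nonsplit configurations are stable.\<close>

lemma split_config_line_act:
  assumes \<phi>: "\<phi> \<in> bundle_aut g" and L: "L \<in> structures" and split: "split_config n D (\<lambda>b. gval (L b))"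
  shows "split_config n D (\<lambda>b. gval (line_act D \<phi> L b))"
proof -
  obtain \<alpha> f h \<beta> where p: "\<phi> = endo n \<alpha> f h \<beta>" "endo_data n f h" "\<alpha> * \<beta> - poly.coeff f 0 * h \<noteq> 0"
    using \<phi> unfolding aut_iff by blast
  let ?\<alpha> = "to_ac \<alpha>" and ?f = "map_poly to_ac f" and ?h = "to_ac h" and ?\<beta> = "to_ac \<beta>"
  have e: "endo_data n ?f ?h" by (rule endo_data_to_ac[OF p(2)])
  have det: "?\<alpha> * ?\<beta> - poly.coeff ?f 0 * ?h \<noteq> 0"
  proof -
    have "?\<alpha> * ?\<beta> - poly.coeff ?f 0 * ?h = to_ac (\<alpha> * \<beta> - poly.coeff f 0 * h)" by simp
    thus ?thesis using p(3) by (simp only: to_ac_eq_0_iff not_False_eq_True)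
  qed
  obtain \<alpha>' f' h' \<beta>' where e': "endo_data n f' h'" and det': "\<alpha>' * \<beta>' - poly.coeff f' 0 * h' \<noteq> 0"
    and z: "\<And>b \<theta>. b \<in> D \<Longrightarrow> conj_root b \<theta> \<Longrightarrow> gval (L b) \<theta> = proj \<alpha>' h' \<or> gval (L b) \<theta> = proj (fev n f' (point_at b \<theta>)) \<beta>'"
    using split unfolding split_config_def by blast
  show ?thesis unfolding split_config_def
  proof (intro exI conjI ballI allI impI)
    show "endo_data n (Polynomial.smult ?\<alpha> f' + Polynomial.smult \<beta>' ?f) (?h * \<alpha>' + ?\<beta> * h')"
      by (rule endo_data_comp[OF e e'])
    have "(?\<alpha> * \<alpha>' + poly.coeff ?f 0 * h') * (?h * poly.coeff f' 0 + ?\<beta> * \<beta>') -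
        poly.coeff (Polynomial.smult ?\<alpha> f' + Polynomial.smult \<beta>' ?f) 0 * (?h * \<alpha>' + ?\<beta> * h') =
        (?\<alpha> * ?\<beta> - poly.coeff ?f 0 * ?h) * (\<alpha>' * \<beta>' - poly.coeff f' 0 * h')" by (simp add: algebra_simps)
    also have "\<dots> \<noteq> 0" using det det' by simp
    finally show "(?\<alpha> * \<alpha>' + poly.coeff ?f 0 * h') * (?h * poly.coeff f' 0 + ?\<beta> * \<beta>') -
        poly.coeff (Polynomial.smult ?\<alpha> f' + Polynomial.smult \<beta>' ?f) 0 * (?h * \<alpha>' + ?\<beta> * h') \<noteq> 0" .
    fix b' \<theta> assume b': "b' \<in> D" "conj_root b' \<theta>"
    let ?x = "xv (rep_vec (L b')) \<theta>" and ?y = "yv (rep_vec (L b')) \<theta>"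
    let ?F = "fev n ?f (point_at b' \<theta>)" and ?F' = "fev n f' (point_at b' \<theta>)"
    note r = rep_vec[OF structuresD[OF L b'(1)]]
    have xy: "?x \<noteq> 0 \<or> ?y \<noteq> 0" by (rule values_nonzero[OF b'(2) r(3,2)])
    have d: "?\<alpha> * ?\<beta> - ?F * ?h \<noteq> 0" using det unfolding fev_mult_offdiag[OF e e] .
    have d': "\<alpha>' * \<beta>' - ?F' * h' \<noteq> 0" using det' unfolding fev_mult_offdiag[OF e' e'] .
    have "\<alpha>' \<noteq> 0 \<or> h' \<noteq> 0" "?F' \<noteq> 0 \<or> \<beta>' \<noteq> 0" using d' by auto
    hence "proj (?\<alpha> * ?x + ?F * ?y) (?h * ?x + ?\<beta> * ?y) = proj (?\<alpha> * \<alpha>' + ?F * h') (?h * \<alpha>' + ?\<beta> * h') \<or>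
      proj (?\<alpha> * ?x + ?F * ?y) (?h * ?x + ?\<beta> * ?y) = proj (?\<alpha> * ?F' + ?F * \<beta>') (?h * ?F' + ?\<beta> * \<beta>')"
      using z[OF b'] proj_transform[OF d xy] unfolding gval_def by blast
    moreover have "?F * h' = poly.coeff ?f 0 * h'" by (rule fev_mult_offdiag[OF e e'])
    moreover have "?h * ?F' = ?h * poly.coeff f' 0" using fev_mult_offdiag[OF e' e] by (simp add: mult.commute)
    moreover have "fev n (Polynomial.smult ?\<alpha> f' + Polynomial.smult \<beta>' ?f) (point_at b' \<theta>) = ?\<alpha> * ?F' + ?F * \<beta>'"
      by (simp add: fev_add fev_smult mult.commute)
    ultimately show "gval (line_act D \<phi> L b') \<theta> = proj (?\<alpha> * \<alpha>' + poly.coeff ?f 0 * h') (?h * \<alpha>' + ?\<beta> * h') \<or>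
      gval (line_act D \<phi> L b') \<theta> = proj (fev n (Polynomial.smult ?\<alpha> f' + Polynomial.smult \<beta>' ?f) (point_at b' \<theta>)) (?h * poly.coeff f' 0 + ?\<beta> * \<beta>')"
      unfolding p(1) gval_line_act[OF \<phi>[unfolded p(1)] L b'] by simp
  qed
qed

lemma line_act_geom_indec:
  assumes "\<phi> \<in> bundle_aut g" "L \<in> geom_indec"
  shows "line_act D \<phi> L \<in> geom_indec"
proof -
  have L: "L \<in> structures" using assms(2) by (simp add: geom_indec_iff)
  obtain \<psi> where \<psi>: "\<psi> \<in> bundle_aut g" "bundle_comp \<psi> \<phi> = bundle_id g" using aut_inverse[OF assms(1)] .
  have "line_act D \<psi> (line_act D \<phi> L) = L"
    using line_act_comp[OF aut_hom[OF assms(1)] aut_hom[OF \<psi>(1)] L] line_act_id[OF L] \<psi>(2) by simp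
  thus ?thesis using split_config_line_act[OF \<psi>(1) line_act_structures[OF assms(1) L]] line_act_structures[OF assms(1) L] assms(2)
    by (auto simp: geom_indec_iff)
qed

end

section \<open>Stabilizers and orbits\<close>

lemma bundle_comp_assoc:
  assumes "\<chi> \<in> bundle_hom g g" "\<psi> \<in> bundle_hom g g" "\<phi> \<in> bundle_hom g g"
  shows "bundle_comp (bundle_comp \<chi> \<psi>) \<phi> = bundle_comp \<chi> (bundle_comp \<psi> \<phi>)"
  using bundle_hom_carrier(1,2)[OF assms(1)] bundle_hom_carrier(1,2)[OF assms(2)] bundle_hom_carrier(1,2)[OF assms(3)]
  by (simp add: bundle_comp_def)

lemma bundle_comp_id_left: "\<phi> \<in> bundle_hom g g \<Longrightarrow> bundle_comp (bundle_id g) \<phi> = \<phi>"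
  using bundle_hom_carrier(1,2)[of \<phi> g g] by (simp add: bundle_comp_def bundle_id_def)

lemma card_option_fixed:
  fixes b :: "'k::{field,finite} point"
  assumes "conj_root b \<theta>"
  shows "card {z :: 'k alg_closure option. (map_option frob ^^ point_degree b) z = z} = card (UNIV :: 'k set) ^ point_degree b + 1"
    and "finite {z :: 'k alg_closure option. (map_option frob ^^ point_degree b) z = z}"
proof -
  interpret geometric_root "local_prime b" \<theta> by (rule conj_root_geometric_root[OF assms(1)])
  have fp: "(map_option frob ^^ j) z = map_option (frob ^^ j) z" for j and z :: "'k alg_closure option"
    by (induction j) (auto simp: option.map_comp option.map_id option.map_ident o_def)
  let ?T = "{y :: 'k alg_closure. (frob ^^ point_degree b) y = y}"
  have cT: "card ?T = card (UNIV :: 'k set) ^ point_degree b"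
    using card_frob_fixed by (simp add: point_degree_def)
  hence fin: "finite ?T" using card_UNIV_gt_1[where ?'k = 'k] card_gt_0_iff[of ?T] by simp
  have eq: "{z :: 'k alg_closure option. (map_option frob ^^ point_degree b) z = z} = insert None (Some ` ?T)"
  proof (rule Set.set_eqI)
    fix z :: "'k alg_closure option"
    show "z \<in> {z. (map_option frob ^^ point_degree b) z = z} \<longleftrightarrow> z \<in> insert None (Some ` ?T)"
      by (cases z) (auto simp: fp)
  qed
  show "finite {z :: 'k alg_closure option. (map_option frob ^^ point_degree b) z = z}" unfolding eq using fin by simp
  show "card {z :: 'k alg_closure option. (map_option frob ^^ point_degree b) z = z} = card (UNIV :: 'k set) ^ point_degree b + 1"
    unfolding eq using fin cT by (subst card_insert_disjoint) (auto simp: card_image)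
qed

context rank2_bundle
begin

text \<open>A nonscalar automorphism fixing all lines would split the configuration. If it has two
  eigenlines, they are the columns of a splitting; if it is a scalar times a nontrivial translation
  by f, every finite value sits at a zero of f, so there are at most n of them and interpolation
  applies.\<close>

lemma stabilizer_scalar:
  assumes \<phi>: "endo n \<alpha> f h \<beta> \<in> bundle_aut g" and L: "L \<in> geom_indec"
    and fixed: "line_act D (endo n \<alpha> f h \<beta>) L = L"
  shows "f = 0 \<and> h = 0 \<and> \<alpha> = \<beta>"
proof (rule ccontr)
  assume contr: "\<not> (f = 0 \<and> h = 0 \<and> \<alpha> = \<beta>)"
  have e: "endo_data n f h" using \<phi> unfolding aut_iff endo_eq_iff by blast
  have Ls: "L \<in> structures" and ns: "\<not> split_config n D (\<lambda>b. gval (L b))" using L by (auto simp: geom_indec_iff)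
  define x y where "x b \<theta> = xv (rep_vec (L b)) \<theta>" and "y b \<theta> = yv (rep_vec (L b)) \<theta>" for b \<theta>
  have gv: "gval (L b) \<theta> = proj (x b \<theta>) (y b \<theta>)" for b \<theta> by (simp add: gval_def x_def y_def)
  have nz: "x b \<theta> \<noteq> 0 \<or> y b \<theta> \<noteq> 0" if "b \<in> D" "conj_root b \<theta>" for b \<theta>
    unfolding x_def y_def using values_nonzero[OF that(2)] rep_vec[OF structuresD[OF Ls that(1)]] by blast
  have pres: "(to_ac \<alpha> * x b \<theta> + fev n (map_poly to_ac f) (point_at b \<theta>) * y b \<theta>) * y b \<theta> =
      x b \<theta> * (to_ac h * x b \<theta> + to_ac \<beta> * y b \<theta>)" if b: "b \<in> D" "conj_root b \<theta>" for b \<theta>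
  proof -
    note r = rep_vec[OF structuresD[OF Ls b(1)]]
    have "fibre_map (endo n \<alpha> f h \<beta>) b ` L b = L b"
      using fun_cong[OF fixed, of b] b(1) by (simp add: line_act_def)
    hence "fibre_map (endo n \<alpha> f h \<beta>) b (rep_vec (L b)) \<in> L b" using r(1) by blast
    hence "xv (fibre_map (endo n \<alpha> f h \<beta>) b (rep_vec (L b))) \<theta> * y b \<theta> = x b \<theta> * yv (fibre_map (endo n \<alpha> f h \<beta>) b (rep_vec (L b))) \<theta>"
      unfolding x_def y_def using fibre_linesD[OF structuresD[OF Ls b(1)] b(2) r(1,2)] by blast
    thus ?thesis unfolding values_fibre_map[OF b(2) fibre_carrier[OF r(3)]] by (simp add: x_def y_def)
  qed
  have "split_config n D (\<lambda>b. gval (L b))"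
  proof (cases "h = 0")
    case h: False
    hence n0: "n = 0" using e by (simp add: endo_data_def)
    then obtain \<gamma> where f: "f = [:\<gamma>:]" using e by (auto simp: endo_data_def elim!: degree_eq_zeroE)
    \<comment> \<open>The finite fixed points of the fractional linear map are the roots of this
      quadratic, which exist over the closure.\<close>
    have "\<exists>r. poly [:- to_ac \<gamma>, to_ac \<beta> - to_ac \<alpha>, to_ac h:] r = 0"
      by (rule alg_closed_imp_poly_has_root) (use h in simp)
    then obtain r where r: "to_ac h * r * r + (to_ac \<beta> - to_ac \<alpha>) * r - to_ac \<gamma> = 0"
      by (auto simp: algebra_simps)
    \<comment> \<open>The second root, obtained from the sum of the roots; it may equal r.\<close>
    define s where "s = (to_ac \<alpha> - to_ac \<beta>) / to_ac h - r"
    have hs: "to_ac h * s = to_ac \<alpha> - to_ac \<beta> - to_ac h * r" using h by (simp add: s_def algebra_simps)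
    have val: "gval (L b) \<theta> = Some r \<or> gval (L b) \<theta> = Some s" if b: "b \<in> D" "conj_root b \<theta>" for b \<theta>
    proof -
      let ?x = "x b \<theta>" and ?y = "y b \<theta>"
      have p: "(to_ac \<alpha> * ?x + to_ac \<gamma> * ?y) * ?y = ?x * (to_ac h * ?x + to_ac \<beta> * ?y)"
        using pres[OF b] by (simp add: n0 f ac.map_poly_pCons_hom)
      have "to_ac h * ((?x - r * ?y) * (?x - s * ?y)) =
        to_ac h * ?x * ?x - to_ac h * r * ?x * ?y - to_ac h * s * ?x * ?y + r * (to_ac h * s) * ?y * ?y"
        by (simp add: algebra_simps)
      also have "\<dots> = ?x * (to_ac h * ?x + to_ac \<beta> * ?y) - (to_ac \<alpha> * ?x + to_ac \<gamma> * ?y) * ?y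
        - (to_ac h * r * r + (to_ac \<beta> - to_ac \<alpha>) * r - to_ac \<gamma>) * ?y * ?y"
        unfolding hs by (simp add: algebra_simps)
      also have "\<dots> = 0" unfolding p r by simp
      finally have "?x = r * ?y \<or> ?x = s * ?y" using h by simp
      thus ?thesis using nz[OF b] unfolding gv proj_def by auto
    qed
    show ?thesis
    proof (cases "r = s")
      case False
      show ?thesis unfolding split_config_def
        by (rule exI[of _ r], rule exI[of _ "[:s:]"], rule exI[of _ 1], rule exI[of _ 1])
           (use val False in \<open>auto simp: n0 endo_data_def\<close>)
    next
      case True
      \<comment> \<open>With a double fixed point all values equal r, and any other point serves as
        second column; here it is [1 : 0].\<close>
      show ?thesis unfolding split_config_def
        by (rule exI[of _ r], rule exI[of _ "[:1:]"], rule exI[of _ 1], rule exI[of _ 0])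
           (use val True in \<open>auto simp: n0 endo_data_def\<close>)
    qed
  next
    case h: True
    show ?thesis
    proof (cases "\<alpha> = \<beta>")
      case False
      \<comment> \<open>A triangular matrix with distinct eigenvalues has the eigenlines [1 : 0] and
        [f : \<beta> - \<alpha>].\<close>
      hence d: "to_ac \<beta> - to_ac \<alpha> \<noteq> 0" by simp
      show ?thesis
      proof (rule split_config_of_section)
        show "degree (Polynomial.smult (1 / (to_ac \<beta> - to_ac \<alpha>)) (map_poly to_ac f)) \<le> n"
          using e d by (simp add: endo_data_def)
        fix b \<theta> assume b: "b \<in> D" "conj_root b \<theta>"
        let ?x = "x b \<theta>" and ?y = "y b \<theta>" and ?F = "fev n (map_poly to_ac f) (point_at b \<theta>)"
        have "?y = 0 \<or> to_ac \<alpha> * ?x + ?F * ?y = ?x * to_ac \<beta>"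
          using pres[OF b] h by (auto simp: mult.assoc[symmetric])
        hence "?y = 0 \<or> ?x * (to_ac \<beta> - to_ac \<alpha>) = ?F * ?y" by (auto simp: algebra_simps)
        hence "?y = 0 \<or> ?x / ?y = ?F / (to_ac \<beta> - to_ac \<alpha>)" using frac_eq_eq[OF _ d] by blast
        thus "gval (L b) \<theta> = None \<or> gval (L b) \<theta> = Some (fev n (Polynomial.smult (1 / (to_ac \<beta> - to_ac \<alpha>)) (map_poly to_ac f)) (point_at b \<theta>))"
          unfolding gv proj_def fev_smult by auto
      qed
    next
      case True
      \<comment> \<open>Now the automorphism translates finite values by a multiple of f, so fixing
        a finite value forces f to vanish there.\<close>
      hence f0: "f \<noteq> 0" using contr h by simp
      have "\<not> n + 1 \<le> card (finite_values D (\<lambda>b. gval (L b)))"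
      proof
        assume card: "n + 1 \<le> card (finite_values D (\<lambda>b. gval (L b)))"
        have "map_poly to_ac f = 0"
        proof (rule section_eq_zero[OF D card])
          show "degree (map_poly to_ac f) \<le> n" using e by (simp add: endo_data_def)
          fix b \<theta> assume "(b, \<theta>) \<in> finite_values D (\<lambda>b. gval (L b))"
          hence b: "b \<in> D" "conj_root b \<theta>" and y0: "y b \<theta> \<noteq> 0" by (auto simp: finite_values_def gv proj_def)
          have "fev n (map_poly to_ac f) (point_at b \<theta>) * y b \<theta> * y b \<theta> = 0"
            using pres[OF b] h True by (simp add: algebra_simps)
          thus "fev n (map_poly to_ac f) (point_at b \<theta>) = 0" using y0 by simp
        qed
        thus False using f0 by simp
      qed
      thus ?thesis by (intro split_config_of_card_le[OF D]) simp
    qed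
  qed
  thus False using ns by contradiction
qed

lemma gval_inj:
  assumes "L \<in> structures" "L' \<in> structures" "\<And>b. b \<in> D \<Longrightarrow> gval (L b) (some_root b) = gval (L' b) (some_root b)"
  shows "L = L'"
proof (rule PiE_ext[where k = D and s = "fibre_lines 2"])
  show "L \<in> Pi\<^sub>E D (fibre_lines 2)" "L' \<in> Pi\<^sub>E D (fibre_lines 2)" using assms by (auto simp: line_structures_def)
  fix b' assume b': "b' \<in> D"
  have "inj_on (\<lambda>L. gval L (some_root b')) (fibre_lines 2 b')"
    using bij_betw_gval[OF conj_root_some_root[OF closed_D[OF b']]] by (simp add: bij_betw_def)
  thus "L b' = L' b'" by (rule inj_onD) (use assms structuresD b' in auto)
qed

lemma scalar_aut: "c \<noteq> 0 \<Longrightarrow> endo n c 0 0 c \<in> bundle_aut g"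
  unfolding aut_iff endo_eq_iff by (auto simp: endo_data_def)

lemma scalar_act:
  assumes "c \<noteq> 0" "L \<in> structures"
  shows "line_act D (endo n c 0 0 c) L = L"
proof (rule gval_inj[OF line_act_structures[OF scalar_aut[OF assms(1)] assms(2)] assms(2)])
  fix b' assume b': "b' \<in> D"
  let ?x = "xv (rep_vec (L b')) (some_root b')" and ?y = "yv (rep_vec (L b')) (some_root b')"
  have "gval (line_act D (endo n c 0 0 c) L b') (some_root b') = proj (to_ac c * ?x) (to_ac c * ?y)"
    unfolding gval_line_act[OF scalar_aut[OF assms(1)] assms(2) b' conj_root_some_root[OF closed_D[OF b']]] by simp
  also have "\<dots> = proj ?x ?y" using assms(1) by (simp add: proj_def)
  finally show "gval (line_act D (endo n c 0 0 c) L b') (some_root b') = gval (L b') (some_root b')"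
    by (simp add: gval_def)
qed

text \<open>The fibres of the orbit map are cosets of the stabilizer, which consists of the q - 1
  nonzero scalars.\<close>

lemma card_same_image:
  assumes \<psi>: "\<psi> \<in> bundle_aut g" and L: "L \<in> geom_indec"
  shows "card {\<phi> \<in> bundle_aut g. line_act D \<phi> L = line_act D \<psi> L} = card (UNIV :: 'k set) - 1"
proof -
  have Ls: "L \<in> structures" using L by (simp add: geom_indec_iff)
  let ?s = "\<lambda>c. bundle_comp \<psi> (endo n c 0 0 c)"
  have "{\<phi> \<in> bundle_aut g. line_act D \<phi> L = line_act D \<psi> L} = ?s ` (UNIV - {0})"
  proof (intro Set.set_eqI iffI)
    fix \<phi> assume "\<phi> \<in> {\<phi> \<in> bundle_aut g. line_act D \<phi> L = line_act D \<psi> L}"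
    hence \<phi>: "\<phi> \<in> bundle_aut g" "line_act D \<phi> L = line_act D \<psi> L" by auto
    obtain \<psi>' where \<psi>': "\<psi>' \<in> bundle_aut g" "bundle_comp \<psi>' \<psi> = bundle_id g" "bundle_comp \<psi> \<psi>' = bundle_id g"
      using aut_inverse[OF \<psi>] .
    have \<chi>: "bundle_comp \<psi>' \<phi> \<in> bundle_aut g" by (rule aut_comp[OF \<psi>'(1) \<phi>(1)])
    have "line_act D (bundle_comp \<psi>' \<phi>) L = line_act D (bundle_comp \<psi>' \<psi>) L"
      unfolding line_act_comp[OF aut_hom[OF \<phi>(1)] aut_hom[OF \<psi>'(1)] Ls]
        line_act_comp[OF aut_hom[OF \<psi>] aut_hom[OF \<psi>'(1)] Ls] \<phi>(2) ..
    hence fx: "line_act D (bundle_comp \<psi>' \<phi>) L = L" by (simp add: \<psi>'(2) line_act_id[OF Ls])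
    obtain \<alpha> f h \<beta> where ch: "bundle_comp \<psi>' \<phi> = endo n \<alpha> f h \<beta>" and det: "\<alpha> * \<beta> - poly.coeff f 0 * h \<noteq> 0"
      using \<chi> unfolding aut_iff by blast
    have st: "f = 0 \<and> h = 0 \<and> \<alpha> = \<beta>" using stabilizer_scalar[OF _ L] \<chi> fx by (simp add: ch)
    have "\<phi> = bundle_comp (bundle_comp \<psi> \<psi>') \<phi>" using bundle_comp_id_left[OF aut_hom[OF \<phi>(1)]] by (simp add: \<psi>'(3))
    also have "\<dots> = ?s \<alpha>" using bundle_comp_assoc[of \<psi> g \<psi>' \<phi>] aut_hom \<psi> \<psi>'(1) \<phi>(1) ch st by simp
    finally show "\<phi> \<in> ?s ` (UNIV - {0})" using det st by auto
  next
    fix \<phi> assume "\<phi> \<in> ?s ` (UNIV - {0})"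
    then obtain c where c: "c \<noteq> 0" "\<phi> = ?s c" by auto
    have "line_act D \<phi> L = line_act D \<psi> L"
      unfolding c(2) using line_act_comp[OF _ _ Ls] aut_hom \<psi> scalar_aut[OF c(1)] scalar_act[OF c(1) Ls] by simp
    thus "\<phi> \<in> {\<phi> \<in> bundle_aut g. line_act D \<phi> L = line_act D \<psi> L}"
      unfolding c(2) using aut_comp[OF \<psi> scalar_aut[OF c(1)]] by simp
  qed
  moreover have "inj_on ?s (UNIV - {0})"
  proof (rule inj_onI)
    fix c c' assume eq: "?s c = ?s c'"
    obtain \<alpha> f h \<beta> where p: "\<psi> = endo n \<alpha> f h \<beta>" "endo_data n f h" "\<alpha> * \<beta> - poly.coeff f 0 * h \<noteq> 0"
      using \<psi> unfolding aut_iff by blast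
    have e0: "endo_data n 0 0" by (simp add: endo_data_def)
    have "\<alpha> * c = \<alpha> * c'" "h * c = h * c'"
      using eq unfolding p(1) endo_comp[OF p(2) e0] endo_eq_iff by auto
    thus "c = c'" using p(3) by auto
  qed
  ultimately show ?thesis by (simp add: card_image)
qed

lemma finite_structures: "finite structures"
  unfolding line_structures_def rank_g
proof (rule finite_PiE[OF finite_D])
  fix b' assume "b' \<in> D"
  hence cr: "conj_root b' (some_root b')" by (rule conj_root_some_root[OF closed_D])
  show "finite (fibre_lines 2 b')"
    using bij_betw_finite[OF bij_betw_gval[OF cr]] card_option_fixed(2)[OF cr] by simp
qed

lemma finite_geom_indec: "finite geom_indec"
  by (rule finite_subset[OF _ finite_structures]) (auto simp: geom_indec_iff)

text \<open>All orbits have the common size |Aut| / (q - 1), because every stabilizer is the group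
  of scalars, and they partition the nonsplit configurations. The multiplied-out form avoids
  division of natural numbers.\<close>

theorem num_geom_indecomposable_mult:
  assumes fin: "finite (bundle_aut g)"
  shows "num_geom_indecomposable D g * card (bundle_aut g) = (card (UNIV :: 'k set) - 1) * card geom_indec"
proof -
  define orb where "orb L = (\<lambda>\<phi>. line_act D \<phi> L) ` bundle_aut g" for L
  have id_aut: "bundle_id g \<in> bundle_aut g"
    unfolding g bundle_id_twist[where n = n] using scalar_aut[of 1] by (simp add: g)
  have num: "num_geom_indecomposable D g = card (orb ` geom_indec)"
    unfolding num_geom_indecomposable_def orb_def geom_indec_def by (rule arg_cong[of _ _ card]) blast
  have orb_card: "(card (UNIV :: 'k set) - 1) * card (orb L) = card (bundle_aut g)" if L: "L \<in> geom_indec" for L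
  proof -
    have "card (bundle_aut g) = (\<Sum>y\<in>orb L. card {\<phi> \<in> bundle_aut g. line_act D \<phi> L = y})"
      unfolding orb_def using sum.image_gen[OF fin, of "\<lambda>_. 1 :: nat" "\<lambda>\<phi>. line_act D \<phi> L"] by (simp only: card_eq_sum)
    also have "\<dots> = (\<Sum>y\<in>orb L. card (UNIV :: 'k set) - 1)"
      by (rule sum.cong) (auto simp: orb_def card_same_image[OF _ L])
    finally show ?thesis by simp
  qed
  have orb_sub: "orb L \<subseteq> geom_indec" if "L \<in> geom_indec" for L
    unfolding orb_def using line_act_geom_indec[OF _ that] by auto
  have self: "L \<in> orb L" if "L \<in> geom_indec" for L
  proof -
    have "L = line_act D (bundle_id g) L" using that by (simp add: line_act_id geom_indec_iff)
    thus ?thesis unfolding orb_def using id_aut by blast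
  qed
  have trans: "orb L \<subseteq> orb L'" if L: "L \<in> geom_indec" "L' \<in> geom_indec" and meet: "orb L \<inter> orb L' \<noteq> {}" for L L'
  proof -
    obtain \<phi> \<psi> where \<phi>\<psi>: "\<phi> \<in> bundle_aut g" "\<psi> \<in> bundle_aut g" "line_act D \<phi> L = line_act D \<psi> L'"
      using meet unfolding orb_def by auto
    have Ls: "L \<in> structures" "L' \<in> structures" using L by (auto simp: geom_indec_iff)
    obtain \<phi>' where \<phi>': "\<phi>' \<in> bundle_aut g" "bundle_comp \<phi>' \<phi> = bundle_id g" using aut_inverse[OF \<phi>\<psi>(1)] .
    have "L = line_act D \<phi>' (line_act D \<phi> L)"
      using line_act_comp[OF aut_hom[OF \<phi>\<psi>(1)] aut_hom[OF \<phi>'(1)] Ls(1)] line_act_id[OF Ls(1)] \<phi>'(2) by simp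
    also have "\<dots> = line_act D (bundle_comp \<phi>' \<psi>) L'"
      unfolding \<phi>\<psi>(3) by (rule line_act_comp[symmetric]) (use aut_hom \<phi>\<psi> \<phi>' Ls in auto)
    finally have eq: "L = line_act D (bundle_comp \<phi>' \<psi>) L'" .
    show ?thesis
    proof
      fix M assume "M \<in> orb L"
      then obtain \<chi> where \<chi>: "\<chi> \<in> bundle_aut g" "M = line_act D \<chi> L" by (auto simp: orb_def)
      have c: "bundle_comp \<phi>' \<psi> \<in> bundle_aut g" by (rule aut_comp[OF \<phi>'(1) \<phi>\<psi>(2)])
      have "M = line_act D (bundle_comp \<chi> (bundle_comp \<phi>' \<psi>)) L'"
        unfolding line_act_comp[OF aut_hom[OF c] aut_hom[OF \<chi>(1)] Ls(2)] eq[symmetric] by (rule \<chi>(2))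
      thus "M \<in> orb L'" unfolding orb_def using aut_comp[OF \<chi>(1) c] by blast
    qed
  qed
  have union: "\<Union>(orb ` geom_indec) = geom_indec" using orb_sub self by blast
  have pos: "card (UNIV :: 'k set) - 1 > 0" using card_UNIV_gt_1[where ?'k = 'k] by simp
  define k where "k = card (bundle_aut g) div (card (UNIV :: 'k set) - 1)"
  have k: "card (orb L) = k" if "L \<in> geom_indec" for L
    using orb_card[OF that] pos unfolding k_def by (metis nonzero_mult_div_cancel_left less_numeral_extra(3))
  have "k * card (orb ` geom_indec) = card (\<Union>(orb ` geom_indec))"
  proof (rule card_partition)
    show "finite (orb ` geom_indec)" using finite_geom_indec by simp
    show "finite (\<Union>(orb ` geom_indec))" unfolding union by (rule finite_geom_indec)
    show "card c = k" if "c \<in> orb ` geom_indec" for c using that k by auto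
    show "c1 \<inter> c2 = {}" if "c1 \<in> orb ` geom_indec" "c2 \<in> orb ` geom_indec" "c1 \<noteq> c2" for c1 c2
      using that trans by (metis Int_commute image_iff subset_antisym)
  qed
  hence k_eq: "k * num_geom_indecomposable D g = card geom_indec" by (simp add: num union)
  show ?thesis
  proof (cases "geom_indec = {}")
    case True thus ?thesis by (simp add: num)
  next
    case False
    then obtain L where "L \<in> geom_indec" by blast
    hence "card (bundle_aut g) = (card (UNIV :: 'k set) - 1) * k" using orb_card k by metis
    thus ?thesis using k_eq by (simp add: mult_ac)
  qed
qed

section \<open>Orders of the automorphism groups\<close>

lemma card_aut_pos:
  assumes "n > 0"
  shows "card (bundle_aut g) = (card (UNIV :: 'k set) - 1) ^ 2 * card (UNIV :: 'k set) ^ (n + 1)"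
    and "finite (bundle_aut g)"
proof -
  let ?A = "(UNIV - {0 :: 'k}) \<times> {f :: 'k poly. degree f \<le> n} \<times> (UNIV - {0 :: 'k})"
  let ?e = "\<lambda>(\<alpha>, f, \<beta>). endo n \<alpha> f 0 \<beta>"
  have eq: "bundle_aut g = ?e ` ?A"
  proof (intro Set.set_eqI iffI)
    fix \<phi> assume "\<phi> \<in> bundle_aut g"
    then obtain \<alpha> f h \<beta> where p: "\<phi> = endo n \<alpha> f h \<beta>" "endo_data n f h" "\<alpha> * \<beta> - poly.coeff f 0 * h \<noteq> 0"
      unfolding aut_iff by blast
    hence "h = 0" "degree f \<le> n" "\<alpha> \<noteq> 0" "\<beta> \<noteq> 0" using assms by (auto simp: endo_data_def)
    thus "\<phi> \<in> ?e ` ?A" by (auto simp: p(1) intro!: image_eqI[of _ _ "(\<alpha>, f, \<beta>)"])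
  next
    fix \<phi> assume "\<phi> \<in> ?e ` ?A"
    then obtain \<alpha> f \<beta> where p: "\<phi> = endo n \<alpha> f 0 \<beta>" "\<alpha> \<noteq> 0" "\<beta> \<noteq> 0" "degree f \<le> n" by auto
    have "endo_data n f 0" "\<alpha> * \<beta> - poly.coeff f 0 * 0 \<noteq> 0" using p by (auto simp: endo_data_def)
    thus "\<phi> \<in> bundle_aut g" unfolding aut_iff p(1) by blast
  qed
  have inj: "inj_on ?e ?A" by (rule inj_onI) (auto simp: endo_eq_iff)
  show "finite (bundle_aut g)" unfolding eq by (intro finite_imageI finite_cartesian_product finite_degree_le) auto
  show "card (bundle_aut g) = (card (UNIV :: 'k set) - 1) ^ 2 * card (UNIV :: 'k set) ^ (n + 1)"
    unfolding eq card_image[OF inj] card_cartesian_product card_degree_le by (simp add: power2_eq_square)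
qed

text \<open>The order of GL_2(k) by columns: the first one is any nonzero vector, the second any
  vector outside the line spanned by the first.\<close>

lemma card_aut_zero:
  assumes "n = 0"
  shows "card (bundle_aut g) = (card (UNIV :: 'k set) ^ 2 - 1) * (card (UNIV :: 'k set) ^ 2 - card (UNIV :: 'k set))"
    and "finite (bundle_aut g)"
proof -
  let ?q = "card (UNIV :: 'k set)"
  define B where "B = (\<lambda>(\<alpha>, h). {(\<gamma>, \<beta>). \<alpha> * \<beta> - \<gamma> * h \<noteq> (0 :: 'k)})"
  let ?A = "Sigma (UNIV - {(0 :: 'k, 0 :: 'k)}) B"
  let ?e = "\<lambda>((\<alpha>, h), (\<gamma>, \<beta>)). endo 0 \<alpha> [:\<gamma>:] h \<beta>"
  have eq: "bundle_aut g = ?e ` ?A"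
  proof (intro Set.set_eqI iffI)
    fix \<phi> assume "\<phi> \<in> bundle_aut g"
    then obtain \<alpha> f h \<beta> where p: "\<phi> = endo n \<alpha> f h \<beta>" "endo_data n f h" "\<alpha> * \<beta> - poly.coeff f 0 * h \<noteq> 0"
      unfolding aut_iff by blast
    obtain \<gamma> where f: "f = [:\<gamma>:]" using p(2) assms by (auto simp: endo_data_def elim!: degree_eq_zeroE)
    have "((\<alpha>, h), (\<gamma>, \<beta>)) \<in> ?A" using p(3) by (auto simp: f B_def)
    thus "\<phi> \<in> ?e ` ?A" by (rule rev_image_eqI) (simp add: p(1) f assms)
  next
    fix \<phi> assume "\<phi> \<in> ?e ` ?A"
    then obtain \<alpha> \<gamma> h \<beta> where p: "\<phi> = endo 0 \<alpha> [:\<gamma>:] h \<beta>" "\<alpha> * \<beta> - \<gamma> * h \<noteq> 0" by (auto simp: B_def)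
    have "endo_data n [:\<gamma>:] h" "\<alpha> * \<beta> - poly.coeff [:\<gamma>:] 0 * h \<noteq> 0" using p(2) assms by (auto simp: endo_data_def)
    thus "\<phi> \<in> bundle_aut g" unfolding aut_iff p(1) using assms by blast
  qed
  have inj: "inj_on ?e ?A" by (rule inj_onI) (auto simp: endo_eq_iff)
  have cU: "card (UNIV :: ('k \<times> 'k) set) = ?q * ?q"
    by (simp only: UNIV_Times_UNIV[symmetric] card_cartesian_product)
  have cB: "card (B p) = ?q ^ 2 - ?q" if "p \<in> UNIV - {(0, 0)}" for p
  proof -
    obtain \<alpha> h where p: "p = (\<alpha>, h)" "\<alpha> \<noteq> 0 \<or> h \<noteq> 0" using \<open>p \<in> UNIV - {(0, 0)}\<close> by (cases p) auto
    have "{(\<gamma>, \<beta>). \<alpha> * \<beta> - \<gamma> * h = 0} = range (\<lambda>t. (t * \<alpha>, t * h))"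
    proof (intro Set.set_eqI iffI)
      fix v assume "v \<in> {(\<gamma>, \<beta>). \<alpha> * \<beta> - \<gamma> * h = 0}"
      then obtain \<gamma> \<beta> where v: "v = (\<gamma>, \<beta>)" "\<alpha> * \<beta> = \<gamma> * h" by auto
      show "v \<in> range (\<lambda>t. (t * \<alpha>, t * h))"
      proof (cases "\<alpha> = 0")
        case True
        thus ?thesis using v p(2) by (intro range_eqI[of _ _ "\<beta> / h"]) auto
      next
        case False
        thus ?thesis using v by (intro range_eqI[of _ _ "\<gamma> / \<alpha>"]) (auto simp: field_simps)
      qed
    qed (auto simp: algebra_simps)
    moreover have "inj (\<lambda>t. (t * \<alpha>, t * h))" by (rule injI) (use p(2) in auto)
    ultimately have c0: "card {(\<gamma>, \<beta>). \<alpha> * \<beta> - \<gamma> * h = 0} = ?q" by (simp add: card_image)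
    have "B p = UNIV - {(\<gamma>, \<beta>). \<alpha> * \<beta> - \<gamma> * h = 0}" by (auto simp: B_def p(1))
    hence "card (B p) = card (UNIV :: ('k \<times> 'k) set) - ?q" by (simp only: card_Diff_subset[OF finite subset_UNIV] c0)
    thus ?thesis by (simp only: cU power2_eq_square)
  qed
  show "finite (bundle_aut g)" unfolding eq by (intro finite_imageI finite_SigmaI) auto
  have "card ?A = (\<Sum>p\<in>UNIV - {(0, 0)}. card (B p))" by (rule card_SigmaI) auto
  also have "\<dots> = (\<Sum>p\<in>UNIV - {(0 :: 'k, 0 :: 'k)}. ?q ^ 2 - ?q)" by (rule sum.cong[OF refl cB])
  also have "\<dots> = (?q ^ 2 - 1) * (?q ^ 2 - ?q)"
    by (simp add: card_Diff_subset cU power2_eq_square)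
  finally show "card (bundle_aut g) = (?q ^ 2 - 1) * (?q ^ 2 - ?q)" unfolding eq card_image[OF inj] .
qed

end

section \<open>Counting configurations\<close>

lemma map_option_frob_inj: "map_option frob z = map_option frob z' \<longleftrightarrow> z = z'"
  by (cases z; cases z') auto

lemma map_option_frob_eq_None [simp]: "(map_option frob ^^ j) z = None \<longleftrightarrow> z = None"
  by (induction j) auto

lemma gval_funpow: "gval L ((frob ^^ j) \<theta>) = (map_option frob ^^ j) (gval L \<theta>)"
  by (induction j) (simp_all add: gval_frob)

lemma fev_frob:
  assumes "conj_root b \<theta>"
  shows "fev n (map_poly frob f) (point_at b (frob \<theta>)) = frob (fev n f (point_at b \<theta>))"
  using fev_point_at[OF assms] fev_point_at[OF conj_root_frob[OF assms]] by auto

lemma conj_root_frob_preimage: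
  assumes "conj_root b \<theta>"
  obtains \<theta>' where "conj_root b \<theta>'" "\<theta> = frob \<theta>'"
proof -
  have pos: "point_degree b > 0"
    using geometric_root.degree_pos[OF conj_root_geometric_root[OF assms]] by (simp add: point_degree_def)
  then obtain d where d: "point_degree b = Suc d" by (cases "point_degree b") auto
  have "conj_root b ((frob ^^ d) \<theta>)" using conj_root_iff_orbit[OF assms] by blast
  moreover have "\<theta> = frob ((frob ^^ d) \<theta>)" using frob_funpow_point_degree[OF assms] by (simp add: d)
  ultimately show ?thesis by (rule that)
qed

definition deg_sum :: "'k::field point set \<Rightarrow> nat" where
  "deg_sum S = (\<Sum>b\<in>S. point_degree b)"

text \<open>The base point b0 breaks the symmetry between the two values: A is the value at b0, B
  the other one, and U the nonempty set, avoiding b0, where B is taken. Constant maps are counted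
  apart, since they leave B undetermined.\<close>

lemma two_valued_exact_count:
  fixes Q :: "'q set" and D :: "'d set"
  assumes "finite D" "b0 \<in> D" "finite Q"
  shows "card {y \<in> PiE D (\<lambda>_. Q). \<exists>A B. \<forall>b\<in>D. y b \<in> {A, B}} =
    card Q + card Q * (card Q - 1) * (2 ^ (card D - 1) - 1)"
proof -
  define c where "c A = (\<lambda>b\<in>D. A)" for A :: 'q
  define e where "e = (\<lambda>(A, B, U). \<lambda>b\<in>D. if b \<in> U then B else (A :: 'q))"
  let ?P = "Sigma Q (\<lambda>A. (Q - {A}) \<times> (Pow (D - {b0}) - {{}}))"
  have "{y \<in> PiE D (\<lambda>_. Q). \<exists>A B. \<forall>b\<in>D. y b \<in> {A, B}} = c ` Q \<union> e ` ?P"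
  proof (intro Set.set_eqI iffI)
    fix y assume "y \<in> {y \<in> PiE D (\<lambda>_. Q). \<exists>A B. \<forall>b\<in>D. y b \<in> {A, B}}"
    then obtain A B where y: "y \<in> PiE D (\<lambda>_. Q)" "\<forall>b\<in>D. y b \<in> {A, B}" by blast
    define A' where "A' = y b0"
    have A': "A' \<in> Q" using y assms(2) by (auto simp: A'_def)
    show "y \<in> c ` Q \<union> e ` ?P"
    proof (cases "\<forall>b\<in>D. y b = A'")
      case True
      have "y = c A'" unfolding c_def by (rule extensionalityI[of _ D]) (use y True in \<open>auto simp: PiE_def\<close>)
      thus ?thesis using A' by blast
    next
      case False
      then obtain b1 where b1: "b1 \<in> D" "y b1 \<noteq> A'" by blast
      define B' where "B' = y b1"
      define U where "U = {b \<in> D. y b = B'}"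
      have vals: "y b = A' \<or> y b = B'" if "b \<in> D" for b
        using y(2) that assms(2) b1 unfolding A'_def B'_def by (metis insertE singletonD)
      have "y = e (A', B', U)" unfolding e_def prod.case
        by (rule extensionalityI[of _ D]) (use y vals in \<open>auto simp: PiE_def U_def\<close>)
      moreover have "(A', B', U) \<in> ?P"
        using A' b1 y by (auto simp: U_def B'_def A'_def)
      ultimately show ?thesis by blast
    qed
  next
    fix y assume "y \<in> c ` Q \<union> e ` ?P"
    thus "y \<in> {y \<in> PiE D (\<lambda>_. Q). \<exists>A B. \<forall>b\<in>D. y b \<in> {A, B}}"
    proof
      assume "y \<in> c ` Q"
      thus ?thesis by (auto simp: c_def)
    next
      assume "y \<in> e ` ?P"
      then obtain A B U where y: "y = e (A, B, U)" "A \<in> Q" "B \<in> Q" by blast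
      have "y \<in> PiE D (\<lambda>_. Q)" "\<forall>b\<in>D. y b \<in> {A, B}" using y by (auto simp: e_def)
      thus ?thesis by blast
    qed
  qed
  moreover have "inj_on c Q"
  proof (rule inj_onI)
    fix A A' assume "c A = c A'"
    from fun_cong[OF this, of b0] show "A = A'" using assms(2) by (simp add: c_def)
  qed
  moreover have "inj_on e ?P"
  proof (rule inj_onI)
    fix p p' assume p: "p \<in> ?P" "p' \<in> ?P" and eq: "e p = e p'"
    obtain A B U A' B' U' where pp: "p = (A, B, U)" "p' = (A', B', U')" by (cases p, cases p')
    have U: "U \<subseteq> D" "b0 \<notin> U" "U \<noteq> {}" "A \<noteq> B" and U': "U' \<subseteq> D" "b0 \<notin> U'" "U' \<noteq> {}" "A' \<noteq> B'"
      using p by (auto simp: pp)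
    have v: "(if b \<in> U then B else A) = (if b \<in> U' then B' else A')" if "b \<in> D" for b
      using fun_cong[OF eq, of b] that by (simp add: pp e_def)
    have A: "A = A'" using v[OF assms(2)] U U' by simp
    have "U = U'"
    proof (intro Set.set_eqI)
      fix b show "b \<in> U \<longleftrightarrow> b \<in> U'"
        using v[of b] U U' A by (cases "b \<in> D") (auto split: if_splits)
    qed
    moreover obtain b where "b \<in> U" using U(3) by blast
    ultimately have "B = B'" using v[of b] U(1) by auto
    thus "p = p'" using A \<open>U = U'\<close> by (simp add: pp)
  qed
  moreover have "c ` Q \<inter> e ` ?P = {}"
  proof -
    have "c A \<noteq> e (A', B', U)" if "(A', B', U) \<in> ?P" for A A' B' U
    proof
      assume eq: "c A = e (A', B', U)"
      have "U \<noteq> {}" "U \<subseteq> D" using that by auto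
      then obtain b where b: "b \<in> U" "b \<in> D" by blast
      have "A = A'" using fun_cong[OF eq, of b0] assms(2) that by (auto simp: c_def e_def)
      moreover have "A = B'" using fun_cong[OF eq, of b] b by (simp add: c_def e_def)
      ultimately show False using that by auto
    qed
    thus ?thesis by blast
  qed
  moreover have "finite ?P" using assms by auto
  ultimately have "card {y \<in> PiE D (\<lambda>_. Q). \<exists>A B. \<forall>b\<in>D. y b \<in> {A, B}} = card Q + card ?P"
    using assms(3) by (simp add: card_Un_disjoint card_image)
  also have "card ?P = (\<Sum>A\<in>Q. card ((Q - {A}) \<times> (Pow (D - {b0}) - {{}})))"
    using assms by (intro card_SigmaI) auto
  also have "\<dots> = (\<Sum>A\<in>Q. (card Q - 1) * (2 ^ (card D - 1) - 1))"
    using assms by (intro sum.cong refl) (simp add: card_cartesian_product card_Pow)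
  finally show ?thesis by (simp add: mult.assoc)
qed

text \<open>The second value F A is forced by the first, so a map is given by its value A at b0 and
  the set where F A is taken. This set may be empty, and constant maps are thus included.\<close>

lemma two_conj_count:
  fixes F :: "'q \<Rightarrow> 'q" and D :: "'d set"
  assumes "finite D" "b0 \<in> D" and R: "finite R" "\<And>A. A \<in> R \<Longrightarrow> F A \<noteq> A \<and> F (F A) = A"
    and FR: "\<And>A. A \<in> R \<Longrightarrow> F A \<in> R"
  shows "card {y \<in> extensional D. \<exists>A\<in>R. \<forall>b\<in>D. y b \<in> {A, F A}} = card R * 2 ^ (card D - 1)"
proof -
  define e where "e = (\<lambda>(A, U). \<lambda>b\<in>D. if b \<in> U then F A else A)"
  have "{y \<in> extensional D. \<exists>A\<in>R. \<forall>b\<in>D. y b \<in> {A, F A}} = e ` (R \<times> Pow (D - {b0}))"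
  proof (intro Set.set_eqI iffI)
    fix y assume "y \<in> {y \<in> extensional D. \<exists>A\<in>R. \<forall>b\<in>D. y b \<in> {A, F A}}"
    then obtain A where y: "y \<in> extensional D" "A \<in> R" "\<forall>b\<in>D. y b \<in> {A, F A}" by blast
    define A' where "A' = y b0"
    have A': "A' \<in> R" "{A, F A} = {A', F A'}" using y assms(2) R(2)[OF y(2)] FR[OF y(2)] by (auto simp: A'_def)
    define U where "U = {b \<in> D. y b = F A'}"
    have "b0 \<notin> U" using R(2)[OF A'(1)] by (auto simp: U_def A'_def)
    hence "(A', U) \<in> R \<times> Pow (D - {b0})" using A' by (auto simp: U_def)
    moreover have "y = e (A', U)" unfolding e_def prod.case
      by (rule extensionalityI[of _ D]) (use y A' in \<open>auto simp: U_def\<close>)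
    ultimately show "y \<in> e ` (R \<times> Pow (D - {b0}))" by blast
  next
    fix y assume "y \<in> e ` (R \<times> Pow (D - {b0}))"
    thus "y \<in> {y \<in> extensional D. \<exists>A\<in>R. \<forall>b\<in>D. y b \<in> {A, F A}}" by (auto simp: e_def)
  qed
  moreover have "inj_on e (R \<times> Pow (D - {b0}))"
  proof (rule inj_onI)
    fix p p' assume p: "p \<in> R \<times> Pow (D - {b0})" "p' \<in> R \<times> Pow (D - {b0})" and eq: "e p = e p'"
    obtain A U A' U' where pp: "p = (A, U)" "p' = (A', U')" by (cases p, cases p')
    have U: "U \<subseteq> D" "b0 \<notin> U" "A \<in> R" and U': "U' \<subseteq> D" "b0 \<notin> U'" "A' \<in> R" using p by (auto simp: pp)
    have v: "(if b \<in> U then F A else A) = (if b \<in> U' then F A' else A')" if "b \<in> D" for b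
      using fun_cong[OF eq, of b] that by (simp add: pp e_def)
    have A: "A = A'" using v[OF assms(2)] U U' by simp
    have "U = U'"
    proof (intro Set.set_eqI)
      fix b show "b \<in> U \<longleftrightarrow> b \<in> U'"
        using v[of b] U U' A R(2)[OF U(3)] by (cases "b \<in> D") (auto split: if_splits)
    qed
    thus "p = p'" using A by (simp add: pp)
  qed
  ultimately show ?thesis using assms by (simp add: card_image card_cartesian_product card_Pow)
qed

lemma rep_of_distinct:
  assumes "A \<noteq> (B :: 'l::field option)"
  obtains \<alpha> \<gamma> h \<beta> where "\<alpha> * \<beta> - \<gamma> * h \<noteq> 0" "proj \<alpha> h = A" "proj \<gamma> \<beta> = B"
proof -
  define u where "u z = (case z of None \<Rightarrow> 1 | Some (r :: 'l) \<Rightarrow> r)" for z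
  define v where "v z = (case z of None \<Rightarrow> 0 | Some (r :: 'l) \<Rightarrow> (1 :: 'l))" for z
  have p: "proj (u z) (v z) = z" for z by (cases z) (auto simp: u_def v_def)
  have "u A * v B - u B * v A \<noteq> 0" using assms by (cases A; cases B) (auto simp: u_def v_def)
  thus ?thesis using that p by blast
qed

section \<open>Configurations described by one coordinate for each closed point\<close>

context rank2_bundle
begin

definition coords :: "('k point \<Rightarrow> 'k poly vec set) \<Rightarrow> 'k point \<Rightarrow> 'k alg_closure option" where
  "coords L = (\<lambda>b\<in>D. gval (L b) (some_root b))"

definition coord_range :: "'k point \<Rightarrow> 'k alg_closure option set" where
  "coord_range p = {z. (map_option frob ^^ point_degree p) z = z}"

lemma some_root_D: "b' \<in> D \<Longrightarrow> conj_root b' (some_root b')"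
  by (rule conj_root_some_root[OF closed_D])

lemma card_coord_range: "b' \<in> D \<Longrightarrow> card (coord_range b') = (card (UNIV :: 'k set)) ^ point_degree b' + 1"
  and finite_coord_range: "b' \<in> D \<Longrightarrow> finite (coord_range b')"
  unfolding coord_range_def using card_option_fixed[OF some_root_D] by auto

lemma bij_betw_coords: "bij_betw coords structures (PiE D coord_range)"
  unfolding bij_betw_def
proof
  show "inj_on coords structures"
  proof (rule inj_onI)
    fix L L' assume L: "L \<in> structures" "L' \<in> structures" and eq: "coords L = coords L'"
    show "L = L'"
    proof (rule gval_inj[OF L])
      fix b' assume "b' \<in> D"
      thus "gval (L b') (some_root b') = gval (L' b') (some_root b')"
        using fun_cong[OF eq, of b'] by (simp add: coords_def)
    qed
  qed
  show "coords ` structures = PiE D coord_range"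
  proof (intro Set.set_eqI iffI)
    fix y assume "y \<in> coords ` structures"
    then obtain L where L: "L \<in> structures" "y = coords L" by blast
    have "gval (L b') (some_root b') \<in> coord_range b'" if "b' \<in> D" for b'
      using bij_betw_imp_surj_on[OF bij_betw_gval[OF some_root_D[OF that]]] structuresD[OF L(1) that]
      unfolding coord_range_def by blast
    thus "y \<in> PiE D coord_range" by (auto simp: L(2) coords_def)
  next
    fix y assume y: "y \<in> PiE D coord_range"
    have "\<exists>l. l \<in> fibre_lines 2 b' \<and> gval l (some_root b') = y b'" if b': "b' \<in> D" for b'
    proof -
      have "y b' \<in> coord_range b'" using y b' by blast
      hence "y b' \<in> (\<lambda>L. gval L (some_root b')) ` fibre_lines 2 b'"
        unfolding coord_range_def bij_betw_imp_surj_on[OF bij_betw_gval[OF some_root_D[OF b']]] .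
      thus ?thesis by auto
    qed
    then obtain l where l: "\<And>b'. b' \<in> D \<Longrightarrow> l b' \<in> fibre_lines 2 b' \<and> gval (l b') (some_root b') = y b'" by metis
    have "restrict l D \<in> structures" using l by (auto simp: line_structures_def)
    moreover have "coords (restrict l D) = y"
      by (rule extensionalityI[of _ D]) (use l y in \<open>auto simp: coords_def PiE_def\<close>)
    ultimately show "y \<in> coords ` structures" by blast
  qed
qed

lemma card_structures: "card structures = (\<Prod>b\<in>D. (card (UNIV :: 'k set)) ^ point_degree b + 1)"
  using bij_betw_same_card[OF bij_betw_coords] card_coord_range by (simp add: card_PiE finite_D)

lemma card_by_coords: "card {L \<in> structures. P (coords L)} = card {y \<in> PiE D coord_range. P y}"
proof (rule bij_betw_same_card[of coords])
  have "coords ` {L \<in> structures. P (coords L)} = {y \<in> coords ` structures. P y}" by auto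
  also have "\<dots> = {y \<in> PiE D coord_range. P y}" unfolding bij_betw_imp_surj_on[OF bij_betw_coords] ..
  finally have "coords ` {L \<in> structures. P (coords L)} = {y \<in> PiE D coord_range. P y}" .
  thus "bij_betw coords {L \<in> structures. P (coords L)} {y \<in> PiE D coord_range. P y}"
    using bij_betw_coords inj_on_subset[of coords structures "{L \<in> structures. P (coords L)}"] by (auto simp: bij_betw_def)
qed

text \<open>The roots over b' are the Frobenius iterates of the chosen one, and values transform
  equivariantly, so a condition at all roots becomes a condition on the iterates of a single
  coordinate.\<close>

lemma conj_values:
  assumes "b' \<in> D"
  shows "(\<forall>\<theta>. conj_root b' \<theta> \<longrightarrow> P \<theta> (gval (L b') \<theta>)) \<longleftrightarrow>
    (\<forall>j. P ((frob ^^ j) (some_root b')) ((map_option frob ^^ j) (coords L b')))"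
  unfolding conj_root_iff_orbit[OF some_root_D[OF assms]] using assms
  by (auto simp: coords_def gval_funpow)

section \<open>Split configurations on \<open>O(a)^2\<close>\<close>

lemma split_zero_iff:
  assumes n0: "n = 0"
  shows "split_config n D (\<lambda>b. gval (L b)) \<longleftrightarrow> (\<exists>A B. \<forall>b\<in>D. \<forall>j. (map_option frob ^^ j) (coords L b) \<in> {A, B})"
proof
  assume "split_config n D (\<lambda>b. gval (L b))"
  then obtain \<alpha> f h \<beta> where e: "endo_data n f h"
    and z: "\<forall>b\<in>D. \<forall>\<theta>. conj_root b \<theta> \<longrightarrow> gval (L b) \<theta> = proj \<alpha> h \<or> gval (L b) \<theta> = proj (fev n f (point_at b \<theta>)) \<beta>"
    unfolding split_config_def by blast
  obtain \<gamma> where f: "f = [:\<gamma>:]" using e n0 by (auto simp: endo_data_def elim!: degree_eq_zeroE)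
  have "\<forall>b\<in>D. \<forall>\<theta>. conj_root b \<theta> \<longrightarrow> gval (L b) \<theta> \<in> {proj \<alpha> h, proj \<gamma> \<beta>}" using z by (simp add: f n0)
  hence "\<forall>b\<in>D. \<forall>j. (map_option frob ^^ j) (coords L b) \<in> {proj \<alpha> h, proj \<gamma> \<beta>}"
    using conj_values[where P = "\<lambda>_ v. v \<in> {proj \<alpha> h, proj \<gamma> \<beta>}" and L = L] by blast
  thus "\<exists>A B. \<forall>b\<in>D. \<forall>j. (map_option frob ^^ j) (coords L b) \<in> {A, B}" by blast
next
  assume "\<exists>A B. \<forall>b\<in>D. \<forall>j. (map_option frob ^^ j) (coords L b) \<in> {A, B}"
  then obtain A B0 where AB0: "\<forall>b\<in>D. \<forall>j. (map_option frob ^^ j) (coords L b) \<in> {A, B0}" by blast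
  \<comment> \<open>A nonzero determinant requires two distinct points, so if A and B0 coincide an
    arbitrary different second point is chosen.\<close>
  define B where "B = (if A = B0 then (if A = None then Some 0 else None) else B0)"
  have B: "A \<noteq> B" "B0 = A \<or> B0 = B" unfolding B_def by (auto split: if_splits)
  from rep_of_distinct[OF B(1)] obtain \<alpha> \<gamma> h \<beta> where r: "\<alpha> * \<beta> - \<gamma> * h \<noteq> 0" "proj \<alpha> h = A" "proj \<gamma> \<beta> = B"
    by metis
  have "\<forall>b\<in>D. \<forall>j. (map_option frob ^^ j) (coords L b) \<in> {A, B}" using AB0 B(2) by auto
  hence v: "\<forall>b\<in>D. \<forall>\<theta>. conj_root b \<theta> \<longrightarrow> gval (L b) \<theta> \<in> {A, B}"
    using conj_values[where P = "\<lambda>_ v. v \<in> {A, B}" and L = L] by blast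
  show "split_config n D (\<lambda>b. gval (L b))" unfolding split_config_def
    by (rule exI[of _ \<alpha>], rule exI[of _ "[:\<gamma>:]"], rule exI[of _ h], rule exI[of _ \<beta>])
       (use r n0 v in \<open>simp add: endo_data_def\<close>)
qed

text \<open>The set of values is stable under Frobenius. If some value moves, then A and B are this
  value and its conjugate, exchanged by Frobenius, and the splitting lives over the quadratic
  extension; otherwise all values are rational.\<close>

lemma two_valued_iff:
  fixes y :: "'k point \<Rightarrow> 'k alg_closure option"
  shows "(\<exists>A B. \<forall>b\<in>D. \<forall>j. (map_option frob ^^ j) (y b) \<in> {A, B}) \<longleftrightarrow>
    (\<forall>b\<in>D. map_option frob (y b) = y b) \<and> (\<exists>A B. \<forall>b\<in>D. y b \<in> {A, B}) \<or>
    (\<exists>A\<in>{A. map_option frob A \<noteq> A \<and> map_option frob (map_option frob A) = A}. \<forall>b\<in>D. y b \<in> {A, map_option frob A})"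
    (is "?L \<longleftrightarrow> ?R1 \<or> ?R2")
proof
  let ?F = "map_option frob :: 'k alg_closure option \<Rightarrow> _"
  assume ?L
  then obtain A B where AB: "\<And>b j. b \<in> D \<Longrightarrow> (?F ^^ j) (y b) \<in> {A, B}" by blast
  have v0: "y b \<in> {A, B}" if "b \<in> D" for b using AB[OF that, of 0] by simp
  have v1: "?F (y b) \<in> {A, B}" if "b \<in> D" for b using AB[OF that, of 1] by simp
  have v2: "?F (?F (y b)) \<in> {A, B}" if "b \<in> D" for b using AB[OF that, of 2] by (simp add: numeral_2_eq_2)
  show "?R1 \<or> ?R2"
  proof (cases "\<forall>b\<in>D. ?F (y b) = y b")
    case True
    thus ?thesis using v0 by blast
  next
    case False
    then obtain b where b: "b \<in> D" "?F (y b) \<noteq> y b" by blast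
    have eq: "{A, B} = {y b, ?F (y b)}" using v0[OF b(1)] v1[OF b(1)] b(2) by auto
    have "?F (?F (y b)) \<noteq> ?F (y b)" using b(2) by (simp add: map_option_frob_inj)
    hence "?F (?F (y b)) = y b" using v2[OF b(1)] unfolding eq by simp
    hence ?R2 using b(2) v0 unfolding eq by blast
    thus ?thesis ..
  qed
next
  let ?F = "map_option frob :: 'k alg_closure option \<Rightarrow> _"
  assume "?R1 \<or> ?R2"
  thus ?L
  proof
    assume R: ?R1
    have "(?F ^^ j) (y b) = y b" if "b \<in> D" for b j using R that by (induction j) auto
    thus ?L using R by auto
  next
    assume ?R2
    then obtain A where A: "?F (?F A) = A" "\<And>b. b \<in> D \<Longrightarrow> y b \<in> {A, ?F A}" by blast
    have "(?F ^^ j) (y b) \<in> {A, ?F A}" if "b \<in> D" for b j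
    proof (induction j)
      case (Suc j)
      thus ?case using A(1) by auto
    qed (use A(2)[OF that] in simp)
    thus ?L by blast
  qed
qed

lemma card_fixed_values: "card {z :: 'k alg_closure option. map_option frob z = z} = card (UNIV :: 'k set) + 1"
  and finite_fixed_values: "finite {z :: 'k alg_closure option. map_option frob z = z}"
proof -
  have eq: "{z :: 'k alg_closure option. map_option frob z = z} = insert None (Some ` range to_ac)"
  proof (rule Set.set_eqI)
    fix z :: "'k alg_closure option"
    show "z \<in> {z. map_option frob z = z} \<longleftrightarrow> z \<in> insert None (Some ` range to_ac)"
      by (cases z) (auto simp: frob_eq_self_iff)
  qed
  have "card (Some ` range (to_ac :: 'k \<Rightarrow> _)) = card (UNIV :: 'k set)"
    by (subst card_image) (simp_all add: card_range_to_ac)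
  moreover have fin: "finite (Some ` range (to_ac :: 'k \<Rightarrow> _))" by (intro finite_imageI) simp
  ultimately show "card {z :: 'k alg_closure option. map_option frob z = z} = card (UNIV :: 'k set) + 1"
    unfolding eq by (subst card_insert_disjoint) auto
  show "finite {z :: 'k alg_closure option. map_option frob z = z}" unfolding eq using fin by simp
qed

lemma card_conj_values:
  "card {A :: 'k alg_closure option. map_option frob A \<noteq> A \<and> map_option frob (map_option frob A) = A} =
    card (UNIV :: 'k set) ^ 2 - card (UNIV :: 'k set)"
  and finite_conj_values:
  "finite {A :: 'k alg_closure option. map_option frob A \<noteq> A \<and> map_option frob (map_option frob A) = A}"
proof -
  have q2: "card (UNIV :: 'k set) ^ 2 > 0" using card_UNIV_gt_1[where ?'k = 'k] by simp
  have fin: "finite {y :: 'k alg_closure. frob (frob y) = y}"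
    by (rule card_ge_0_finite) (simp only: card_frob2_fixed q2)
  have eq: "{A :: 'k alg_closure option. map_option frob A \<noteq> A \<and> map_option frob (map_option frob A) = A} =
    Some ` ({y. frob (frob y) = y} - range to_ac)"
  proof (rule Set.set_eqI)
    fix z :: "'k alg_closure option"
    show "z \<in> {A. map_option frob A \<noteq> A \<and> map_option frob (map_option frob A) = A} \<longleftrightarrow> z \<in> Some ` ({y. frob (frob y) = y} - range to_ac)"
      by (cases z) (auto simp: frob_eq_self_iff[symmetric])
  qed
  show "finite {A :: 'k alg_closure option. map_option frob A \<noteq> A \<and> map_option frob (map_option frob A) = A}"
    unfolding eq using fin by simp
  have "card ({y :: 'k alg_closure. frob (frob y) = y} - range to_ac) = card (UNIV :: 'k set) ^ 2 - card (UNIV :: 'k set)"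
    by (subst card_Diff_subset) (auto simp: card_frob2_fixed card_range_to_ac)
  moreover have "card (Some ` ({y :: 'k alg_closure. frob (frob y) = y} - range to_ac)) =
      card ({y :: 'k alg_closure. frob (frob y) = y} - range to_ac)"
    by (rule card_image) simp
  ultimately show "card {A :: 'k alg_closure option. map_option frob A \<noteq> A \<and> map_option frob (map_option frob A) = A} =
    card (UNIV :: 'k set) ^ 2 - card (UNIV :: 'k set)"
    unfolding eq by (simp only:)
qed

text \<open>From all configurations are removed the q + 1 rational constants, those with two
  rational values, and those inside a conjugate pair. The last kind exists only if all degrees are
  even: a value moved by Frobenius but fixed by its square is fixed by the d-th power only for even
  d. The additive form avoids truncated subtraction.\<close>

theorem card_geom_indec_zero:
  assumes n0: "n = 0" and b0: "b0 \<in> D" and q: "q = card (UNIV :: 'k set)"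
  shows "card geom_indec + (q + 1 + (q + 1) * q * (2 ^ (card D - 1) - 1) +
      (if \<forall>b\<in>D. even (point_degree b) then (q ^ 2 - q) * 2 ^ (card D - 1) else 0)) =
    (\<Prod>b\<in>D. q ^ point_degree b + 1)"
proof -
  let ?F = "map_option frob :: 'k alg_closure option \<Rightarrow> _"
  let ?Q = "{z. ?F z = z}" and ?R = "{A. ?F A \<noteq> A \<and> ?F (?F A) = A}"
  define bad where "bad y \<longleftrightarrow> (\<exists>A B. \<forall>b\<in>D. \<forall>j. (?F ^^ j) (y b) \<in> {A, B})" for y :: "'k point \<Rightarrow> 'k alg_closure option"
  have bad_iff: "bad y \<longleftrightarrow> (\<forall>b\<in>D. ?F (y b) = y b) \<and> (\<exists>A B. \<forall>b\<in>D. y b \<in> {A, B}) \<or> (\<exists>A\<in>?R. \<forall>b\<in>D. y b \<in> {A, ?F A})" for y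
    unfolding bad_def by (rule two_valued_iff)
  have gi: "geom_indec = {L \<in> structures. \<not> bad (coords L)}"
    using split_zero_iff[OF n0] by (auto simp: geom_indec_iff bad_def)
  have "structures = geom_indec \<union> {L \<in> structures. bad (coords L)}" "geom_indec \<inter> {L \<in> structures. bad (coords L)} = {}"
    by (auto simp: gi)
  hence sum: "card structures = card geom_indec + card {L \<in> structures. bad (coords L)}"
    using card_Un_disjoint[of geom_indec "{L \<in> structures. bad (coords L)}"] finite_structures finite_geom_indec by simp
  let ?Y1 = "{y \<in> PiE D (\<lambda>_. ?Q). \<exists>A B. \<forall>b\<in>D. y b \<in> {A, B}}"
  let ?Y2 = "{y \<in> PiE D coord_range. \<exists>A\<in>?R. \<forall>b\<in>D. y b \<in> {A, ?F A}}"
  have Qsub: "z \<in> coord_range b" if "z \<in> ?Q" for z b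
  proof -
    have "(?F ^^ j) z = z" for j using that by (induction j) auto
    thus ?thesis by (simp add: coord_range_def)
  qed
  have "{y \<in> PiE D coord_range. bad y} = ?Y1 \<union> ?Y2"
  proof (intro Set.set_eqI iffI)
    fix y assume y: "y \<in> {y \<in> PiE D coord_range. bad y}"
    hence "(\<forall>b\<in>D. ?F (y b) = y b) \<and> (\<exists>A B. \<forall>b\<in>D. y b \<in> {A, B}) \<or> (\<exists>A\<in>?R. \<forall>b\<in>D. y b \<in> {A, ?F A})"
      by (simp only: mem_Collect_eq bad_iff)
    thus "y \<in> ?Y1 \<union> ?Y2" using y by (auto simp: PiE_iff)
  next
    fix y assume y: "y \<in> ?Y1 \<union> ?Y2"
    hence "y \<in> PiE D coord_range" using Qsub by (auto simp: PiE_iff)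
    moreover have "(\<forall>b\<in>D. ?F (y b) = y b) \<and> (\<exists>A B. \<forall>b\<in>D. y b \<in> {A, B}) \<or> (\<exists>A\<in>?R. \<forall>b\<in>D. y b \<in> {A, ?F A})"
      using y by (auto simp: PiE_iff)
    ultimately show "y \<in> {y \<in> PiE D coord_range. bad y}"
      unfolding mem_Collect_eq bad_iff[of y] by (rule conjI)
  qed
  moreover have disj: "?Y1 \<inter> ?Y2 = {}"
  proof -
    have False if "y \<in> ?Y1" "y \<in> ?Y2" for y
    proof -
      obtain A where A: "A \<in> ?R" "y b0 \<in> {A, ?F A}" using \<open>y \<in> ?Y2\<close> b0 by blast
      have "?F (y b0) = y b0" using \<open>y \<in> ?Y1\<close> b0 by (auto simp: PiE_iff)
      thus False using A by auto
    qed
    thus ?thesis by blast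
  qed
  moreover have fin: "finite (PiE D coord_range)" using finite_D finite_coord_range by (intro finite_PiE) auto
  moreover have "finite (PiE D (\<lambda>_. ?Q))" using finite_D finite_fixed_values by (intro finite_PiE) auto
  ultimately have bad_card: "card {y \<in> PiE D coord_range. bad y} = card ?Y1 + card ?Y2"
    by (simp add: card_Un_disjoint)
  have Y1: "card ?Y1 = q + 1 + (q + 1) * q * (2 ^ (card D - 1) - 1)"
    using two_valued_exact_count[OF finite_D b0 finite_fixed_values] by (simp only: card_fixed_values add_diff_cancel_right' q)
  have parity: "(?F ^^ j) z = (if even j then z else ?F z)" if "?F (?F z) = z" for z j
    using that by (induction j) auto
  have Y2: "card ?Y2 = (if \<forall>b\<in>D. even (point_degree b) then (q ^ 2 - q) * 2 ^ (card D - 1) else 0)"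
  proof (cases "\<forall>b\<in>D. even (point_degree b)")
    case True
    have "?Y2 = {y \<in> extensional D. \<exists>A\<in>?R. \<forall>b\<in>D. y b \<in> {A, ?F A}}"
    proof (intro Set.set_eqI iffI)
      fix y assume "y \<in> {y \<in> extensional D. \<exists>A\<in>?R. \<forall>b\<in>D. y b \<in> {A, ?F A}}"
      then obtain A where y: "y \<in> extensional D" "A \<in> ?R" "\<forall>b\<in>D. y b \<in> {A, ?F A}" by blast
      have "y b \<in> coord_range b" if "b \<in> D" for b
      proof -
        have "y b = A \<or> y b = ?F A" using y(3) that by auto
        hence "?F (?F (y b)) = y b" using y(2) by auto
        from parity[OF this, of "point_degree b"] show ?thesis using True that by (simp add: coord_range_def)
      qed
      thus "y \<in> ?Y2" using y by (auto simp: PiE_iff)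
    qed (auto simp: PiE_iff)
    moreover have "card {y \<in> extensional D. \<exists>A\<in>?R. \<forall>b\<in>D. y b \<in> {A, ?F A}} = card ?R * 2 ^ (card D - 1)"
      by (rule two_conj_count[OF finite_D b0 finite_conj_values]) auto
    ultimately show ?thesis unfolding if_P[OF True] by (simp only: card_conj_values q)
  next
    case False
    then obtain b where b: "b \<in> D" "odd (point_degree b)" by blast
    have "?Y2 = {}"
    proof -
      have False if "y \<in> ?Y2" for y
      proof -
        obtain A where A: "A \<in> ?R" "y b \<in> {A, ?F A}" using \<open>y \<in> ?Y2\<close> b by blast
        have yb: "?F (?F (y b)) = y b" using A by auto
        have "y b \<in> coord_range b" using \<open>y \<in> ?Y2\<close> b by blast
        hence "?F (y b) = y b" using parity[OF yb, of "point_degree b"] b(2) by (simp add: coord_range_def)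
        thus False using A by (auto simp: map_option_frob_inj)
      qed
      thus ?thesis by blast
    qed
    thus ?thesis unfolding if_not_P[OF False] by (simp only: card.empty)
  qed
  show ?thesis
    using sum card_by_coords[of bad] bad_card Y1 Y2 card_structures by (simp only: q)
qed

section \<open>Split configurations on O(a) + O(b) with a > b\<close>

definition coord_support :: "('k point \<Rightarrow> 'k alg_closure option) \<Rightarrow> 'k point set" where
  "coord_support y = {p \<in> D. y p \<noteq> None}"

lemma gval_eq_None_iff:
  assumes "b' \<in> D" "conj_root b' \<theta>"
  shows "gval (L b') \<theta> = None \<longleftrightarrow> coords L b' = None"
proof -
  obtain j where "\<theta> = (frob ^^ j) (some_root b')"
    using conj_root_iff_orbit[OF some_root_D[OF assms(1)]] assms(2) by blast
  thus ?thesis using assms(1) by (simp add: gval_funpow coords_def)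
qed

lemma card_conj_roots_over:
  assumes "S \<subseteq> D"
  shows "card (Sigma S (\<lambda>p. {\<theta>. conj_root p \<theta>})) = deg_sum S"
proof -
  have "finite S" by (rule finite_subset[OF assms finite_D])
  hence "card (Sigma S (\<lambda>p. {\<theta>. conj_root p \<theta>})) = (\<Sum>p\<in>S. card {\<theta>. conj_root p \<theta>})"
    using assms closed_D finite_conj_root by (intro card_SigmaI) auto
  also have "\<dots> = deg_sum S" unfolding deg_sum_def
    using assms closed_D by (intro sum.cong refl card_conj_root) auto
  finally show ?thesis .
qed

lemma finite_values_gval: "finite_values D (\<lambda>b. gval (L b)) = Sigma (coord_support (coords L)) (\<lambda>p. {\<theta>. conj_root p \<theta>})"
proof (rule Set.set_eqI)
  fix x :: "'k point \<times> 'k alg_closure"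
  obtain p \<theta> where x: "x = (p, \<theta>)" by (cases x)
  show "x \<in> finite_values D (\<lambda>b. gval (L b)) \<longleftrightarrow> x \<in> Sigma (coord_support (coords L)) (\<lambda>p. {\<theta>. conj_root p \<theta>})"
    unfolding x finite_values_def coord_support_def mem_Collect_eq case_prod_conv mem_Sigma_iff
    using gval_eq_None_iff[of p \<theta> L] by (cases "p \<in> D \<and> conj_root p \<theta>") (simp_all only: simp_thms, argo)
qed

lemma card_finite_values_gval: "card (finite_values D (\<lambda>b. gval (L b))) = deg_sum (coord_support (coords L))"
  unfolding finite_values_gval by (rule card_conj_roots_over) (auto simp: coord_support_def)

definition section_coords :: "'k poly \<Rightarrow> 'k point \<Rightarrow> 'k alg_closure option" where
  "section_coords f p = Some (fev n (map_poly to_ac f) (point_at p (some_root p)))"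

lemma fev_funpow:
  assumes "conj_root p \<theta>"
  shows "fev n (map_poly to_ac f) (point_at p ((frob ^^ j) \<theta>)) = (frob ^^ j) (fev n (map_poly to_ac f) (point_at p \<theta>))"
proof (induction j)
  case (Suc j)
  have "conj_root p ((frob ^^ j) \<theta>)" using conj_root_iff_orbit[OF assms] by blast
  from fev_frob[OF this, of n "map_poly to_ac f"] show ?case using Suc by simp
qed simp

lemma funpow_Some: "(map_option frob ^^ j) (Some x) = Some ((frob ^^ j) x)"
  by (induction j) auto

text \<open>A splitting is unique as soon as the support is large enough, so it is fixed by the Frobenius
  and therefore defined over the ground field.\<close>

lemma split_pos_iff:
  assumes npos: "n > 0" and L: "L \<in> structures" and large: "deg_sum (coord_support (coords L)) \<ge> n + 1"
  shows "split_config n D (\<lambda>b. gval (L b)) \<longleftrightarrow>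
    (\<exists>f. degree f \<le> n \<and> (\<forall>p\<in>coord_support (coords L). coords L p = section_coords f p))"
proof
  assume "split_config n D (\<lambda>b. gval (L b))"
  then obtain \<alpha> f h \<beta> where e: "endo_data n f h" and det: "\<alpha> * \<beta> - poly.coeff f 0 * h \<noteq> 0"
    and z: "\<And>p \<theta>. p \<in> D \<Longrightarrow> conj_root p \<theta> \<Longrightarrow> gval (L p) \<theta> = proj \<alpha> h \<or> gval (L p) \<theta> = proj (fev n f (point_at p \<theta>)) \<beta>"
    unfolding split_config_def by blast
  have h: "h = 0" "\<beta> \<noteq> 0" using e det npos by (auto simp: endo_data_def)
  define f1 where "f1 = Polynomial.smult (1 / \<beta>) f"
  have deg1: "degree f1 \<le> n" using e by (simp add: f1_def endo_data_def)
  have val: "gval (L p) \<theta> = Some (fev n f1 (point_at p \<theta>))" if "(p, \<theta>) \<in> finite_values D (\<lambda>b. gval (L b))" for p \<theta>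
    using that z[of p \<theta>] h by (auto simp: finite_values_def proj_def f1_def fev_smult)
  \<comment> \<open>The section and its Frobenius twist take the same values at the at least n + 1
    geometric points of the support. The twist is known at images under Frobenius, so each root is
    first written as frob \<theta>'.\<close>
  have "map_poly frob f1 - f1 = 0"
  proof (rule section_eq_zero[OF D])
    show "n + 1 \<le> card (finite_values D (\<lambda>b. gval (L b)))" using large by (simp add: card_finite_values_gval)
    show "degree (map_poly frob f1 - f1) \<le> n" using deg1 by (intro degree_diff_le) auto
    fix p \<theta> assume p: "(p, \<theta>) \<in> finite_values D (\<lambda>b. gval (L b))"
    hence pD: "p \<in> D" and cr: "conj_root p \<theta>" and nn: "gval (L p) \<theta> \<noteq> None" by (auto simp: finite_values_def)
    obtain \<theta>' where t: "conj_root p \<theta>'" "\<theta> = frob \<theta>'" using conj_root_frob_preimage[OF cr] .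
    have "gval (L p) \<theta>' \<noteq> None" using nn by (auto simp: t(2) gval_frob)
    hence p': "(p, \<theta>') \<in> finite_values D (\<lambda>b. gval (L b))" using pD t(1) by (simp add: finite_values_def)
    have "gval (L p) \<theta> = map_option frob (gval (L p) \<theta>')" unfolding t(2) by (rule gval_frob)
    hence "Some (fev n f1 (point_at p \<theta>)) = map_option frob (gval (L p) \<theta>')"
      unfolding val[OF p] .
    also have "\<dots> = Some (fev n (map_poly frob f1) (point_at p \<theta>))"
      unfolding val[OF p'] t(2) fev_frob[OF t(1)] by simp
    finally have "fev n f1 (point_at p \<theta>) = fev n (map_poly frob f1) (point_at p \<theta>)" by simp
    thus "fev n (map_poly frob f1 - f1) (point_at p \<theta>) = 0"
      unfolding fev_point_at[OF cr] by (cases "p = Infinity") auto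
  qed
  hence "map_poly frob f1 = f1" by simp
  then obtain f0 where f0: "f1 = map_poly to_ac f0" by (rule map_poly_frob_eq_self)
  show "\<exists>f. degree f \<le> n \<and> (\<forall>p\<in>coord_support (coords L). coords L p = section_coords f p)"
  proof (intro exI conjI ballI)
    show "degree f0 \<le> n" using deg1 by (simp add: f0)
    fix p assume p: "p \<in> coord_support (coords L)"
    hence pD: "p \<in> D" by (simp add: coord_support_def)
    have "(p, some_root p) \<in> finite_values D (\<lambda>b. gval (L b))"
      unfolding finite_values_gval using p some_root_D[OF pD] by simp
    from val[OF this] show "coords L p = section_coords f0 p" using pD by (simp add: coords_def section_coords_def f0)
  qed
next
  assume "\<exists>f. degree f \<le> n \<and> (\<forall>p\<in>coord_support (coords L). coords L p = section_coords f p)"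
  then obtain f where f: "degree f \<le> n" "\<And>p. p \<in> coord_support (coords L) \<Longrightarrow> coords L p = section_coords f p" by blast
  show "split_config n D (\<lambda>b. gval (L b))"
  proof (rule split_config_of_section)
    show "degree (map_poly to_ac f) \<le> n" using f(1) by simp
    fix p \<theta> assume p: "p \<in> D" "conj_root p \<theta>"
    obtain j where j: "\<theta> = (frob ^^ j) (some_root p)"
      using conj_root_iff_orbit[OF some_root_D[OF p(1)]] p(2) by blast
    have g: "gval (L p) \<theta> = (map_option frob ^^ j) (coords L p)"
      unfolding j gval_funpow using p(1) by (simp add: coords_def)
    show "gval (L p) \<theta> = None \<or> gval (L p) \<theta> = Some (fev n (map_poly to_ac f) (point_at p \<theta>))"
    proof (cases "p \<in> coord_support (coords L)")
      case True
      have "fev n (map_poly to_ac f) (point_at p \<theta>) = (frob ^^ j) (fev n (map_poly to_ac f) (point_at p (some_root p)))"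
        unfolding j by (rule fev_funpow[OF some_root_D[OF p(1)]])
      thus ?thesis by (simp only: g f(2)[OF True] section_coords_def funpow_Some simp_thms)
    next
      case False
      hence "coords L p = None" using p(1) by (simp add: coord_support_def)
      thus ?thesis by (simp add: g)
    qed
  qed
qed

lemma card_coords_support:
  assumes "S \<subseteq> D"
  shows "card {y \<in> PiE D coord_range. coord_support y = S} = card (UNIV :: 'k set) ^ deg_sum S"
proof -
  have "{y \<in> PiE D coord_range. coord_support y = S} = PiE D (\<lambda>p. if p \<in> S then coord_range p - {None} else {None})"
  proof (intro Set.set_eqI iffI)
    fix y assume "y \<in> {y \<in> PiE D coord_range. coord_support y = S}"
    thus "y \<in> PiE D (\<lambda>p. if p \<in> S then coord_range p - {None} else {None})"
      by (auto simp: PiE_iff coord_support_def)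
  next
    fix y assume y: "y \<in> PiE D (\<lambda>p. if p \<in> S then coord_range p - {None} else {None})"
    have yp: "y p \<in> (if p \<in> S then coord_range p - {None} else {None})" if "p \<in> D" for p using y that by blast
    have "y p \<in> coord_range p" if "p \<in> D" for p
      using yp[OF that] by (cases "p \<in> S") (auto simp: coord_range_def)
    moreover have "coord_support y = S"
    proof (intro Set.set_eqI iffI)
      fix p assume "p \<in> coord_support y"
      hence p: "p \<in> D" "y p \<noteq> None" by (auto simp: coord_support_def)
      show "p \<in> S" using yp[OF p(1)] p(2) by (cases "p \<in> S") auto
    next
      fix p assume p: "p \<in> S"
      hence "p \<in> D" using assms by blast
      thus "p \<in> coord_support y" using yp[of p] p by (auto simp: coord_support_def)
    qed
    ultimately show "y \<in> {y \<in> PiE D coord_range. coord_support y = S}" using y by (auto simp: PiE_iff)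
  qed
  hence "card {y \<in> PiE D coord_range. coord_support y = S} = (\<Prod>p\<in>D. card (if p \<in> S then coord_range p - {None} else {None}))"
    by (simp add: card_PiE finite_D)
  also have "\<dots> = (\<Prod>p\<in>D. if p \<in> S then card (UNIV :: 'k set) ^ point_degree p else 1)"
  proof (rule prod.cong[OF refl])
    fix p assume p: "p \<in> D"
    have "None \<in> coord_range p" by (simp add: coord_range_def)
    thus "card (if p \<in> S then coord_range p - {None} else {None}) = (if p \<in> S then card (UNIV :: 'k set) ^ point_degree p else 1)"
      using card_coord_range[OF p] by simp
  qed
  also have "\<dots> = (\<Prod>p\<in>S. card (UNIV :: 'k set) ^ point_degree p)"
    using assms finite_D by (subst prod.inter_restrict[symmetric]) (auto intro!: prod.cong simp: Int_absorb1)
  also have "\<dots> = card (UNIV :: 'k set) ^ deg_sum S" by (simp add: deg_sum_def power_sum)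
  finally show ?thesis .
qed

text \<open>A section of O(n) is determined by its values on S once the degree of S exceeds n, so
  split configurations with support S correspond to polynomials of degree at most n.\<close>

lemma card_section_coords:
  assumes S: "S \<subseteq> D" "deg_sum S \<ge> n + 1"
  shows "card {y \<in> PiE D coord_range. coord_support y = S \<and> (\<exists>f. degree f \<le> n \<and> (\<forall>p\<in>S. y p = section_coords f p))} =
    card (UNIV :: 'k set) ^ (n + 1)"
proof -
  define e where "e f = (\<lambda>p\<in>D. if p \<in> S then section_coords f p else None)" for f
  have "{y \<in> PiE D coord_range. coord_support y = S \<and> (\<exists>f. degree f \<le> n \<and> (\<forall>p\<in>S. y p = section_coords f p))} =
    e ` {f. degree f \<le> n}"
  proof (intro Set.set_eqI iffI)
    fix y assume "y \<in> {y \<in> PiE D coord_range. coord_support y = S \<and> (\<exists>f. degree f \<le> n \<and> (\<forall>p\<in>S. y p = section_coords f p))}"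
    then obtain f where y: "y \<in> PiE D coord_range" "coord_support y = S" and f: "degree f \<le> n" "\<forall>p\<in>S. y p = section_coords f p"
      by blast
    have "y = e f" unfolding e_def
      by (rule extensionalityI[of _ D]) (use y f in \<open>auto simp: PiE_iff coord_support_def\<close>)
    thus "y \<in> e ` {f. degree f \<le> n}" using f(1) by blast
  next
    fix y assume "y \<in> e ` {f. degree f \<le> n}"
    then obtain f where f: "degree f \<le> n" "y = e f" by blast
    have "y p \<in> coord_range p" if p: "p \<in> D" for p
    proof (cases "p \<in> S")
      case True
      have "(frob ^^ point_degree p) (fev n (map_poly to_ac f) (point_at p (some_root p))) = fev n (map_poly to_ac f) (point_at p (some_root p))"
        using fev_funpow[OF some_root_D[OF p], of f "point_degree p"] frob_funpow_point_degree[OF some_root_D[OF p]] by simp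
      thus ?thesis using True p by (simp add: f(2) e_def section_coords_def coord_range_def funpow_Some)
    next
      case False
      thus ?thesis using p by (simp add: f(2) e_def coord_range_def)
    qed
    moreover have "y \<in> extensional D" by (simp add: f(2) e_def)
    moreover have "coord_support y = S" using S(1) by (auto simp: coord_support_def f(2) e_def section_coords_def)
    moreover have "\<forall>p\<in>S. y p = section_coords f p" using S(1) by (auto simp: f(2) e_def)
    ultimately show "y \<in> {y \<in> PiE D coord_range. coord_support y = S \<and> (\<exists>f. degree f \<le> n \<and> (\<forall>p\<in>S. y p = section_coords f p))}"
      using f(1) by (auto simp: PiE_iff)
  qed
  moreover have "inj_on e {f. degree f \<le> n}"
  proof (rule inj_onI)
    fix f f' assume f: "f \<in> {f. degree f \<le> n}" "f' \<in> {f. degree f \<le> n}" and eq: "e f = e f'"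
    \<comment> \<open>An auxiliary configuration with support S, so that
      \<open>section_eq_zero\<close> can be applied to the geometric points above S.\<close>
    define z where "z p = (\<lambda>\<theta> :: 'k alg_closure. if p \<in> S then Some (0 :: 'k alg_closure) else None)" for p :: "'k point"
    have fv: "finite_values D z = Sigma S (\<lambda>p. {\<theta>. conj_root p \<theta>})" using S(1) by (auto simp: finite_values_def z_def split: if_splits)
    have "map_poly to_ac (f - f') = 0"
    proof (rule section_eq_zero[OF D])
      show "n + 1 \<le> card (finite_values D z)" unfolding fv card_conj_roots_over[OF S(1)] by (rule S(2))
      show "degree (map_poly to_ac (f - f')) \<le> n" using f by (simp add: degree_diff_le)
      fix p \<theta> assume "(p, \<theta>) \<in> finite_values D z"
      hence p: "p \<in> S" "conj_root p \<theta>" "p \<in> D" using S(1) unfolding fv by auto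
      obtain j where j: "\<theta> = (frob ^^ j) (some_root p)"
        using conj_root_iff_orbit[OF some_root_D[OF p(3)]] p(2) by blast
      have "section_coords f p = section_coords f' p" using fun_cong[OF eq, of p] p by (simp add: e_def)
      hence "fev n (map_poly to_ac f) (point_at p \<theta>) = fev n (map_poly to_ac f') (point_at p \<theta>)"
        unfolding j fev_funpow[OF some_root_D[OF p(3)]] by (simp add: section_coords_def)
      thus "fev n (map_poly to_ac (f - f')) (point_at p \<theta>) = 0"
        using fev_point_at[OF p(2)] by (simp add: ac_poly.hom_minus split: if_splits)
    qed
    thus "f = f'" by simp
  qed
  ultimately show ?thesis by (simp add: card_image card_degree_le)
qed

text \<open>Configurations are sorted by support S. If deg S \<ge> n + 1, then
  \<open>q^(n + 1)\<close> of the \<open>q^deg_sum S\<close> split; if deg S \<le> n, all of them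
  do, and truncated subtraction gives the required 0.\<close>

theorem card_geom_indec_pos:
  assumes npos: "n > 0"
  shows "card geom_indec = (\<Sum>S\<in>Pow D. card (UNIV :: 'k set) ^ deg_sum S - card (UNIV :: 'k set) ^ (n + 1))"
proof -
  let ?q = "card (UNIV :: 'k set)"
  define GS where "GS S = {L \<in> geom_indec. coord_support (coords L) = S}" for S
  have "geom_indec = (\<Union>S\<in>Pow D. GS S)" by (auto simp: GS_def coord_support_def)
  hence "card geom_indec = card (\<Union>S\<in>Pow D. GS S)" by simp
  also have "\<dots> = (\<Sum>S\<in>Pow D. card (GS S))"
    by (rule card_UN_disjoint) (use finite_D finite_geom_indec in \<open>auto simp: GS_def\<close>)
  also have "\<dots> = (\<Sum>S\<in>Pow D. ?q ^ deg_sum S - ?q ^ (n + 1))"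
  proof (rule sum.cong[OF refl])
    fix S assume "S \<in> Pow D"
    hence S: "S \<subseteq> D" by simp
    show "card (GS S) = ?q ^ deg_sum S - ?q ^ (n + 1)"
    proof (cases "deg_sum S \<ge> n + 1")
      case False
      have "GS S = {}"
      proof -
        have False if "L \<in> GS S" for L
        proof -
          have "split_config n D (\<lambda>b. gval (L b))"
            by (rule split_config_of_card_le[OF D]) (use False that in \<open>simp add: card_finite_values_gval GS_def\<close>)
          thus False using that by (simp add: GS_def geom_indec_iff)
        qed
        thus ?thesis by blast
      qed
      moreover have "?q ^ deg_sum S \<le> ?q ^ (n + 1)"
        using False card_UNIV_gt_1[where ?'k = 'k] by (intro power_increasing) auto
      ultimately show ?thesis by simp
    next
      case True
      define ex where "ex y \<longleftrightarrow> (\<exists>f. degree f \<le> n \<and> (\<forall>p\<in>S. y p = section_coords f p))" for y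
      have "GS S = {L \<in> structures. coord_support (coords L) = S \<and> \<not> ex (coords L)}"
      proof (rule Set.set_eqI)
        fix L
        have "split_config n D (\<lambda>b. gval (L b)) \<longleftrightarrow> ex (coords L)" if "L \<in> structures" "coord_support (coords L) = S"
          using split_pos_iff[OF npos that(1)] True unfolding that(2) ex_def by blast
        thus "L \<in> GS S \<longleftrightarrow> L \<in> {L \<in> structures. coord_support (coords L) = S \<and> \<not> ex (coords L)}"
          unfolding GS_def mem_Collect_eq geom_indec_iff by blast
      qed
      hence c: "card (GS S) = card {y \<in> PiE D coord_range. coord_support y = S \<and> \<not> ex y}"
        using card_by_coords[of "\<lambda>y. coord_support y = S \<and> \<not> ex y"] by simp
      have fin: "finite (PiE D coord_range)" using finite_D finite_coord_range by (intro finite_PiE) auto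
      have "{y \<in> PiE D coord_range. coord_support y = S \<and> \<not> ex y} =
        {y \<in> PiE D coord_range. coord_support y = S} - {y \<in> PiE D coord_range. coord_support y = S \<and> ex y}" by blast
      hence "card {y \<in> PiE D coord_range. coord_support y = S \<and> \<not> ex y} =
        card {y \<in> PiE D coord_range. coord_support y = S} - card {y \<in> PiE D coord_range. coord_support y = S \<and> ex y}"
        using fin by (simp add: card_Diff_subset Collect_mono_iff)
      thus ?thesis unfolding c card_coords_support[OF S] ex_def card_section_coords[OF S True] .
    qed
  qed
  finally show ?thesis .
qed

end

section \<open>Permutation characters on subsets\<close>

lemma permutation_orbit_eq:
  assumes "permutation w" "y \<in> orbit w x"
  shows "orbit w y = orbit w x"
  using orbit_cyclic_eq3[OF cyclic_on_orbit'[OF assms(1)] assms(2)] .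

text \<open>A stable set is the union of the orbits it meets. Stability is expressed by preimages
  because \<open>subset_rep\<close> acts through them.\<close>

lemma bij_betw_invariant_subsets:
  assumes w: "w permutes Y" and Y: "finite Y"
  shows "bij_betw \<Union> (Pow (orbit w ` Y)) {A. A \<subseteq> Y \<and> w -` A = A}"
proof -
  have perm: "permutation w" using w Y by (auto simp: permutation_permutes)
  have self: "x \<in> orbit w x" for x by (rule permutation_self_in_orbit[OF perm])
  have closed: "orbit w x \<subseteq> A" if "w -` A = A" "x \<in> A" for A x
  proof
    fix y assume "y \<in> orbit w x"
    thus "y \<in> A"
    proof induction
      case base
      show ?case using that by blast
    next
      case (step y)
      thus ?case using that(1) by blast
    qed
  qed
  have rep: "T = orbit w y" if "T \<in> orbit w ` Y" "y \<in> T" for T y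
  proof -
    from that(1) obtain x where x: "T = orbit w x" by (elim imageE)
    show ?thesis using permutation_orbit_eq[OF perm, of y x] that(2) by (simp only: x)
  qed
  have inv: "orbit w ` (\<Union>U) = U" if U: "U \<subseteq> orbit w ` Y" for U
  proof (intro Set.set_eqI iffI)
    fix T assume "T \<in> orbit w ` (\<Union>U)"
    then obtain T' y where T: "T' \<in> U" "y \<in> T'" "T = orbit w y" by (elim imageE UnionE)
    have "T' = T" unfolding T(3) by (rule rep[OF subsetD[OF U T(1)] T(2)])
    thus "T \<in> U" using T(1) by (simp only:)
  next
    fix T assume T: "T \<in> U"
    obtain x where x: "T = orbit w x" using subsetD[OF U T] by (elim imageE)
    have "x \<in> \<Union>U" using T self[of x] unfolding x[symmetric] by (rule UnionI)
    hence "orbit w x \<in> orbit w ` (\<Union>U)" by (rule imageI)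
    thus "T \<in> orbit w ` (\<Union>U)" by (simp only: x)
  qed
  have uni: "\<Union>(orbit w ` A) = A" if "w -` A = A" for A
  proof (intro Set.set_eqI iffI)
    fix x assume "x \<in> \<Union>(orbit w ` A)"
    then obtain y where "y \<in> A" "x \<in> orbit w y" by (elim UnionE imageE) simp
    thus "x \<in> A" using closed[OF that] by (elim subsetD[rotated])
  next
    fix x assume "x \<in> A"
    thus "x \<in> \<Union>(orbit w ` A)" using self[of x] by (intro UnionI[of "orbit w x"] imageI)
  qed
  have sub: "\<Union>U \<subseteq> Y" if U: "U \<subseteq> orbit w ` Y" for U
  proof (rule Union_least)
    fix T assume "T \<in> U"
    from subsetD[OF U this] obtain x where "x \<in> Y" "T = orbit w x" by (elim imageE) simp
    thus "T \<subseteq> Y" using permutes_orbit_subset[OF w] by simp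
  qed
  have vim: "w -` (\<Union>U) = \<Union>U" if U: "U \<subseteq> orbit w ` Y" for U
  proof (intro Set.set_eqI iffI)
    fix x assume "x \<in> w -` (\<Union>U)"
    hence "w x \<in> \<Union>U" by (rule vimageD)
    then obtain T where T: "T \<in> U" "w x \<in> T" by (elim UnionE)
    have "T = orbit w (w x)" by (rule rep[OF subsetD[OF U T(1)] T(2)])
    also have "\<dots> = orbit w x" by (rule permutation_orbit_eq[OF perm orbit.base])
    finally show "x \<in> \<Union>U" using T(1) self[of x] by (intro UnionI[of T]) simp_all
  next
    fix x assume "x \<in> \<Union>U"
    then obtain T where T: "T \<in> U" "x \<in> T" by (elim UnionE)
    have "T = orbit w x" by (rule rep[OF subsetD[OF U T(1)] T(2)])
    hence "w x \<in> T" by (simp only: orbit.base)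
    thus "x \<in> w -` (\<Union>U)" by (intro vimageI2 UnionI[OF T(1)])
  qed
  show ?thesis
  proof (rule bij_betw_byWitness[where f' = "\<lambda>A. orbit w ` A"])
    show "\<forall>U\<in>Pow (orbit w ` Y). orbit w ` \<Union>U = U" by (simp add: inv)
    show "\<forall>A\<in>{A. A \<subseteq> Y \<and> w -` A = A}. \<Union>(orbit w ` A) = A" by (simp add: uni)
    show "\<Union> ` Pow (orbit w ` Y) \<subseteq> {A. A \<subseteq> Y \<and> w -` A = A}"
      by (rule image_subsetI) (simp add: sub vim)
    show "(\<lambda>A. orbit w ` A) ` {A. A \<subseteq> Y \<and> w -` A = A} \<subseteq> Pow (orbit w ` Y)"
      by (rule image_subsetI) (simp add: image_mono)
  qed
qed

lemma card_Union_orbits: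
  assumes w: "w permutes Y" and Y: "finite Y" and U: "U \<subseteq> orbit w ` Y"
  shows "card (\<Union>U) = sum card U"
proof (rule card_Union_disjoint)
  have perm: "permutation w" using w Y by (auto simp: permutation_permutes)
  show "pairwise disjnt U"
  proof (rule pairwiseI)
    fix S T assume ST: "S \<in> U" "T \<in> U" "S \<noteq> T"
    obtain x y where xy: "S = orbit w x" "T = orbit w y" using U ST by blast
    show "disjnt S T" unfolding disjnt_def
    proof (rule ccontr)
      assume "S \<inter> T \<noteq> {}"
      then obtain z where "z \<in> S" "z \<in> T" by blast
      hence z: "z \<in> orbit w x" "z \<in> orbit w y" by (simp_all only: xy)
      have "S = T" unfolding xy using permutation_orbit_eq[OF perm z(1)] permutation_orbit_eq[OF perm z(2)] by simp
      thus False using ST by blast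
    qed
  qed
  fix S assume "S \<in> U"
  then obtain x where x: "x \<in> Y" "S = orbit w x" using U by blast
  show "finite S" unfolding x(2) by (rule finite_subset[OF permutes_orbit_subset[OF w x(1)] Y])
qed

lemma sum_Pow_insert:
  assumes "finite A" "a \<notin> A"
  shows "(\<Sum>U\<in>Pow (insert a A). g U) = (\<Sum>U\<in>Pow A. g U) + (\<Sum>U\<in>Pow A. g (insert a U) :: 'b::comm_monoid_add)"
proof -
  have "(\<Sum>U\<in>Pow (insert a A). g U) = (\<Sum>U\<in>Pow A. g U) + (\<Sum>U\<in>insert a ` Pow A. g U)"
    unfolding Pow_insert using assms by (intro sum.union_disjoint) auto
  also have "(\<Sum>U\<in>insert a ` Pow A. g U) = (\<Sum>U\<in>Pow A. g (insert a U))"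
    by (rule sum.reindex_cong[of "insert a"]) (use assms(2) in \<open>auto intro!: inj_onI\<close>)
  finally show ?thesis .
qed

text \<open>Orbits of w and closed points of D are linked only by the multiset of their sizes. The
  induction removes one element from each side with the same size; G must vary, because subsets
  containing that element see G shifted by its size.\<close>

lemma sum_Pow_cong_mset:
  fixes G :: "nat \<Rightarrow> 'c::comm_monoid_add"
  assumes "finite A" "finite B" "image_mset f (mset_set A) = image_mset h (mset_set B)"
  shows "(\<Sum>U\<in>Pow A. G (sum f U)) = (\<Sum>U\<in>Pow B. G (sum h U))"
  using assms
proof (induction A arbitrary: B G rule: finite_induct)
  case empty
  hence "B = {}" by (simp add: mset_set_empty_iff)
  thus ?case by simp
next
  case (insert a A)
  have "f a \<in># image_mset h (mset_set B)" unfolding insert.prems(2)[symmetric] using insert.hyps by simp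
  then obtain b where b: "b \<in> B" "h b = f a" using insert.prems(1) by auto
  define B' where "B' = B - {b}"
  have B: "B = insert b B'" "b \<notin> B'" "finite B'" using b insert.prems(1) by (auto simp: B'_def)
  have "image_mset f (mset_set A) = image_mset h (mset_set B')"
  proof -
    have "image_mset f (mset_set (insert a A)) = image_mset h (mset_set (insert b B'))"
      using insert.prems(2) by (simp only: B(1))
    thus ?thesis using insert.hyps B(2,3) b(2) by simp
  qed
  note IH = insert.IH[OF B(3) this]
  have fU: "sum f (insert a U) = f a + sum f U" if "U \<in> Pow A" for U
    using that insert.hyps finite_subset[of U A] by (subst sum.insert) auto
  have hU: "sum h (insert b U) = f a + sum h U" if "U \<in> Pow B'" for U
    using that B finite_subset[of U B'] b(2) by (subst sum.insert) auto
  have "(\<Sum>U\<in>Pow (insert a A). G (sum f U)) = (\<Sum>U\<in>Pow A. G (sum f U)) + (\<Sum>U\<in>Pow A. G (f a + sum f U))"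
    unfolding sum_Pow_insert[OF insert.hyps] using fU by simp
  also have "\<dots> = (\<Sum>U\<in>Pow B'. G (sum h U)) + (\<Sum>U\<in>Pow B'. G (f a + sum h U))"
    using IH[of G] IH[of "\<lambda>s. G (f a + s)"] by simp
  also have "\<dots> = (\<Sum>U\<in>Pow B. G (sum h U))"
    unfolding B(1) sum_Pow_insert[OF B(3,2)] using hU by simp
  finally show ?case .
qed

lemma subset_char_eq_card: "subset_char l s w = of_nat (card {A \<in> subsets_of_size l s. w -` A = A})"
proof -
  have fin: "finite (subsets_of_size l s)"
    unfolding subsets_of_size_def by (rule finite_subset[of _ "Pow {1..l}"]) auto
  have "subset_char l s w = (\<Sum>A\<in>subsets_of_size l s. if w -` A = A then 1 else 0)"
    unfolding subset_char_def subset_rep_def subset_basis_def ..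
  also have "\<dots> = of_nat (card {A \<in> subsets_of_size l s. w -` A = A})"
    using fin by (simp add: sum.inter_filter[symmetric])
  finally show ?thesis .
qed

text \<open>A character value counts stable subsets, stable subsets are sets of orbits, and orbits
  match closed points in size. Leaving the weight G arbitrary lets both formulas of the theorem pass
  through the same translation.\<close>

lemma sum_subset_char:
  fixes D :: "'k::field point set" and G :: "nat \<Rightarrow> complex"
  assumes "finite D" "w permutes {1..l}" "cycle_type {1..l} w = image_mset point_degree (mset_set D)"
  shows "(\<Sum>s = 0..l. subset_char l s w * G s) = (\<Sum>S\<in>Pow D. G (deg_sum S))"
proof -
  let ?I = "{A. A \<subseteq> {1..l} \<and> w -` A = A}"
  have finI: "finite ?I" by (rule finite_subset[of _ "Pow {1..l}"]) auto
  have "(\<Sum>A\<in>?I. G (card A)) = (\<Sum>s\<in>{0..l}. \<Sum>A\<in>{A \<in> ?I. card A = s}. G (card A))"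
  proof (rule sum.group[symmetric])
    show "card ` ?I \<subseteq> {0..l}"
    proof (rule image_subsetI)
      fix A assume "A \<in> ?I"
      hence "card A \<le> card {1..l}" by (intro card_mono) auto
      thus "card A \<in> {0..l}" by simp
    qed
  qed (use finI in auto)
  also have "\<dots> = (\<Sum>s = 0..l. subset_char l s w * G s)"
  proof (rule sum.cong[OF refl])
    fix s
    have "{A \<in> ?I. card A = s} = {A \<in> subsets_of_size l s. w -` A = A}" by (auto simp: subsets_of_size_def)
    hence "(\<Sum>A\<in>{A \<in> ?I. card A = s}. G (card A)) = (\<Sum>A\<in>{A \<in> subsets_of_size l s. w -` A = A}. G s)"
      by (intro sum.cong) (auto simp: subsets_of_size_def)
    thus "(\<Sum>A\<in>{A \<in> ?I. card A = s}. G (card A)) = subset_char l s w * G s" by (simp add: subset_char_eq_card)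
  qed
  finally have 1: "(\<Sum>s = 0..l. subset_char l s w * G s) = (\<Sum>A\<in>?I. G (card A))" ..
  also have "\<dots> = (\<Sum>U\<in>Pow (orbit w ` {1..l}). G (card (\<Union>U)))"
    by (rule sum.reindex_bij_betw[symmetric, OF bij_betw_invariant_subsets[OF assms(2)]]) simp
  also have "\<dots> = (\<Sum>U\<in>Pow (orbit w ` {1..l}). G (sum card U))"
    by (rule sum.cong[OF refl]) (simp add: card_Union_orbits[OF assms(2)])
  also have "\<dots> = (\<Sum>S\<in>Pow D. G (sum point_degree S))"
    by (rule sum_Pow_cong_mset) (use assms in \<open>auto simp: cycle_type_def\<close>)
  finally show ?thesis by (simp add: deg_sum_def)
qed

section \<open>From subsets of the divisor to geometric sums\<close>

lemma prod_one_plus_power: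
  fixes x :: "'a::comm_semiring_1"
  assumes "finite D"
  shows "(\<Prod>b\<in>D. x ^ point_degree b + 1) = (\<Sum>S\<in>Pow D. x ^ deg_sum S)"
  using prod_add[OF assms, of "\<lambda>b. x ^ point_degree b" "\<lambda>_. 1"] by (simp add: deg_sum_def power_sum)

text \<open>An exchange of summation, m + t \<le> s being the same as m < Suc s - t. For s < t the
  truncated difference is 0 and the inner sum empty, which absorbs the case distinction on
  l.\<close>

lemma sum_swap_geometric:
  fixes \<chi> :: "nat \<Rightarrow> complex" and q :: complex
  shows "(if l \<ge> t then \<Sum>m = 0..l - t. (\<Sum>s = m + t..l. \<chi> s) * q ^ m else 0) =
    (\<Sum>s = 0..l. \<chi> s * (\<Sum>m<Suc s - t. q ^ m))"
proof (cases "l \<ge> t")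
  case True
  have "(\<Sum>m = 0..l - t. (\<Sum>s = m + t..l. \<chi> s) * q ^ m) = (\<Sum>m = 0..l - t. \<Sum>s = m + t..l. \<chi> s * q ^ m)"
    by (simp add: sum_distrib_right)
  also have "\<dots> = (\<Sum>(m, s)\<in>Sigma {0..l - t} (\<lambda>m. {m + t..l}). \<chi> s * q ^ m)"
    by (rule sum.Sigma) auto
  also have "\<dots> = (\<Sum>(s, m)\<in>Sigma {0..l} (\<lambda>s. {..<Suc s - t}). \<chi> s * q ^ m)"
    by (rule sum.reindex_bij_witness[of _ "\<lambda>(s, m). (m, s)" "\<lambda>(m, s). (s, m)"]) auto
  also have "\<dots> = (\<Sum>s = 0..l. \<chi> s * (\<Sum>m<Suc s - t. q ^ m))"
    by (subst sum.Sigma[symmetric]) (auto simp: sum_distrib_left)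
  finally show ?thesis using True by simp
qed (auto intro!: sum.neutral[symmetric])

text \<open>The substitution s = m + 2 i + 1; the upper bound (s - 1) div 2 on i expresses m \<ge>
  0.\<close>

lemma sum_reindex_step2:
  fixes \<chi> :: "nat \<Rightarrow> complex" and q :: complex
  shows "(if l \<ge> 3 then \<Sum>m = 0..l - 3. (\<Sum>i = 1..(l - m - 1) div 2. \<chi> (m + 2 * i + 1)) * q ^ m else 0) =
    (\<Sum>s = 0..l. \<chi> s * (\<Sum>i = 1..(s - 1) div 2. q ^ (s - 2 * i - 1)))"
proof (cases "l \<ge> 3")
  case True
  have "(\<Sum>m = 0..l - 3. (\<Sum>i = 1..(l - m - 1) div 2. \<chi> (m + 2 * i + 1)) * q ^ m) =
    (\<Sum>m = 0..l - 3. \<Sum>i = 1..(l - m - 1) div 2. \<chi> (m + 2 * i + 1) * q ^ m)"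
    by (simp add: sum_distrib_right)
  also have "\<dots> = (\<Sum>(m, i)\<in>Sigma {0..l - 3} (\<lambda>m. {1..(l - m - 1) div 2}). \<chi> (m + 2 * i + 1) * q ^ m)"
    by (rule sum.Sigma) auto
  also have "\<dots> = (\<Sum>(s, i)\<in>Sigma {0..l} (\<lambda>s. {1..(s - 1) div 2}). \<chi> s * q ^ (s - 2 * i - 1))"
    by (rule sum.reindex_bij_witness[of _ "\<lambda>(s, i). (s - 2 * i - 1, i)" "\<lambda>(m, i). (m + 2 * i + 1, i)"])
       (use True in auto)
  also have "\<dots> = (\<Sum>s = 0..l. \<chi> s * (\<Sum>i = 1..(s - 1) div 2. q ^ (s - 2 * i - 1)))"
    by (subst sum.Sigma[symmetric]) (auto simp: sum_distrib_left)
  finally show ?thesis using True by simp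
next
  case False
  hence "(s - 1) div 2 = 0" if "s \<le> l" for s using that by simp
  hence "(\<Sum>s = 0..l. \<chi> s * (\<Sum>i = 1..(s - 1) div 2. q ^ (s - 2 * i - 1))) = 0"
    by (intro sum.neutral) auto
  thus ?thesis using False by simp
qed

text \<open>For s \<ge> 3 the exponents descend from s - 3 in steps of 2 to 0 or 1 by the parity of
  s, so multiplication by \<open>q (q^2 - 1)\<close> telescopes to \<open>q^s - q\<close> or
  \<open>q^s - q^2\<close>. Only s = 0 departs from this pattern.\<close>

lemma step2_geometric_sum:
  fixes q :: complex
  shows "q * (q ^ 2 - 1) * (\<Sum>i = 1..(s - 1) div 2. q ^ (s - 2 * i - 1)) =
    q ^ s - (if s = 0 then 1 else if odd s then q else q ^ 2)"
proof (induction s rule: less_induct)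
  case (less s)
  consider "s = 0" | "s = 1" | "s = 2" | "s \<ge> 3" by linarith
  thus ?case
  proof cases
    case 4
    define t where "t = s - 2"
    have s: "s = t + 2" "t \<ge> 1" "t < s" using 4 by (auto simp: t_def)
    have d: "(s - 1) div 2 = Suc ((t - 1) div 2)" using s by simp
    have "(\<Sum>i = 1..(s - 1) div 2. q ^ (s - 2 * i - 1)) = q ^ (t - 1) + (\<Sum>i = Suc 1..Suc ((t - 1) div 2). q ^ (s - 2 * i - 1))"
      unfolding d by (subst sum.atLeast_Suc_atMost) (auto simp: s)
    also have "(\<Sum>i = Suc 1..Suc ((t - 1) div 2). q ^ (s - 2 * i - 1)) = (\<Sum>i = 1..(t - 1) div 2. q ^ (t - 2 * i - 1))"
      by (subst sum.shift_bounds_cl_Suc_ivl) (auto simp: s)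
    finally have "q * (q ^ 2 - 1) * (\<Sum>i = 1..(s - 1) div 2. q ^ (s - 2 * i - 1)) =
      q * q ^ (t - 1) * (q ^ 2 - 1) + (q ^ t - (if t = 0 then 1 else if odd t then q else q ^ 2))"
      using less.IH[OF s(3)] by (simp add: algebra_simps)
    also have "q * q ^ (t - 1) = q ^ t" using s(2) by (cases t) auto
    finally show ?thesis using s by (simp add: algebra_simps power_add power2_eq_square)
  qed auto
qed

section \<open>The counting formulas\<close>

context rank2_bundle
begin

text \<open>Automorphisms modulo scalars number \<open>(q - 1) q^(n + 1)\<close>, and dividing
  \<open>q^deg_sum S - q^(n + 1)\<close> by this leaves a geometric sum of length deg S - (n +
  1).\<close>

lemma num_geom_indecomposable_pos:
  assumes npos: "n > 0" and q: "q = card (UNIV :: 'k set)"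
  shows "of_nat (num_geom_indecomposable D g) = (\<Sum>S\<in>Pow D. \<Sum>m<deg_sum S - (n + 1). (of_nat q :: complex) ^ m)"
proof -
  let ?N = "num_geom_indecomposable D g"
  have q1: "q > 1" unfolding q by (rule card_UNIV_gt_1)
  have "?N * ((q - 1) ^ 2 * q ^ (n + 1)) = (q - 1) * card geom_indec"
    using num_geom_indecomposable_mult[OF card_aut_pos(2)[OF npos]] card_aut_pos(1)[OF npos] by (simp only: q)
  hence "(q - 1) * (?N * ((q - 1) * q ^ (n + 1))) = (q - 1) * card geom_indec"
    by (simp add: power2_eq_square mult_ac)
  hence "?N * ((q - 1) * q ^ (n + 1)) = card geom_indec" using q1 by simp
  hence "of_nat (?N * ((q - 1) * q ^ (n + 1))) = (of_nat (card geom_indec) :: complex)" by (rule arg_cong)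
  hence "of_nat ?N * ((of_nat q - 1) * of_nat q ^ (n + 1)) = (of_nat (card geom_indec) :: complex)"
    using q1 by (simp add: of_nat_diff)
  also have "\<dots> = (\<Sum>S\<in>Pow D. of_nat (q ^ deg_sum S - q ^ (n + 1)))"
    unfolding card_geom_indec_pos[OF npos] q by simp
  also have "\<dots> = (\<Sum>S\<in>Pow D. (\<Sum>m<deg_sum S - (n + 1). of_nat q ^ m) * ((of_nat q - 1) * of_nat q ^ (n + 1)))"
  proof (rule sum.cong[OF refl])
    fix S
    show "(of_nat (q ^ deg_sum S - q ^ (n + 1)) :: complex) =
      (\<Sum>m<deg_sum S - (n + 1). of_nat q ^ m) * ((of_nat q - 1) * of_nat q ^ (n + 1))"
    proof (cases "deg_sum S \<ge> n + 1")
      case True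
      then obtain k where k: "deg_sum S = k + (n + 1)" by (metis le_add_diff_inverse2)
      have "q ^ (n + 1) \<le> q ^ deg_sum S" using True q1 by (intro power_increasing) auto
      hence "(of_nat (q ^ deg_sum S - q ^ (n + 1)) :: complex) = of_nat q ^ deg_sum S - of_nat q ^ (n + 1)"
        by (simp add: of_nat_diff)
      also have "\<dots> = (of_nat q ^ k - 1) * of_nat q ^ (n + 1)" by (simp add: k power_add algebra_simps)
      also have "\<dots> = (\<Sum>m<k. of_nat q ^ m) * ((of_nat q - 1) * of_nat q ^ (n + 1))"
        unfolding power_diff_1_eq[of "of_nat q :: complex" k] by (simp add: mult_ac)
      finally show ?thesis by (simp add: k)
    next
      case False
      hence "q ^ deg_sum S \<le> q ^ (n + 1)" using q1 by (intro power_increasing) auto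
      thus ?thesis using False by simp
    qed
  qed
  finally have "of_nat ?N * ((of_nat q - 1) * of_nat q ^ (n + 1)) =
      (\<Sum>S\<in>Pow D. \<Sum>m<deg_sum S - (n + 1). (of_nat q :: complex) ^ m) * ((of_nat q - 1) * of_nat q ^ (n + 1))"
    by (simp only: sum_distrib_right)
  moreover have "(of_nat q - 1) * of_nat q ^ (n + 1) \<noteq> (0 :: complex)" using q1 by simp
  ultimately show ?thesis by simp
qed

text \<open>The count for n = 0 normalises configurations at a point b0 of D, so the empty divisor
  is treated apart.\<close>

lemma num_geom_indecomposable_empty:
  assumes "D = {}" "n = 0"
  shows "num_geom_indecomposable D g = 0"
proof -
  have "geom_indec = {}"
  proof -
    have "split_config n D (\<lambda>b. gval (L b))" for L
      by (rule split_config_of_card_le[OF D]) (simp add: finite_values_def assms)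
    thus ?thesis by (auto simp: geom_indec_iff)
  qed
  moreover have "card (bundle_aut g) > 0"
    using card_aut_zero(2)[OF assms(2)] scalar_aut[of 1] by (auto simp: card_gt_0_iff)
  ultimately show ?thesis
    using num_geom_indecomposable_mult[OF card_aut_zero(2)[OF assms(2)]] by simp
qed

text \<open>Summed over the subsets of D, the correction terms of \<open>step2_geometric_sum\<close>
  have to reproduce the number of split configurations. They depend only on the numbers E and Od of
  subsets of even and odd degree. E + Od counts all subsets, and E - Od is the product of the
  \<open>1 + (-1)^d\<close>, nonzero exactly when all degrees are even; this is the condition under
  which conjugate pairs contribute.\<close>

lemma num_geom_indecomposable_zero:
  assumes n0: "n = 0" and b0: "b0 \<in> D" and q: "q = card (UNIV :: 'k set)"
  shows "of_nat (num_geom_indecomposable D g) =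
    (\<Sum>S\<in>Pow D. \<Sum>i = 1..(deg_sum S - 1) div 2. (of_nat q :: complex) ^ (deg_sum S - 2 * i - 1))"
proof -
  let ?N = "num_geom_indecomposable D g" and ?q = "of_nat q :: complex" and ?I = "card geom_indec"
  have q1: "q > 1" unfolding q by (rule card_UNIV_gt_1)
  \<comment> \<open>Half the number of subsets of D, as D contains b0; it is also the number of
    subsets of D avoiding b0, which enters both counts of split configurations.\<close>
  define t where "t = (2 :: nat) ^ (card D - 1)"
  have t1: "t \<ge> 1" by (simp add: t_def)
  have cD: "card D \<ge> 1" using b0 finite_D by (metis One_nat_def Suc_leI card_gt_0_iff empty_iff)
  have two: "2 ^ card D = 2 * (of_nat t :: complex)"
    unfolding t_def using cD by (simp flip: power_Suc)
  let ?all_even = "\<forall>b\<in>D. even (point_degree b)"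
  have qq: "(of_nat (q ^ 2 - q) :: complex) = ?q ^ 2 - ?q"
    using q1 by (subst of_nat_diff) (auto simp: power2_eq_square)
  have qq1: "(of_nat (q ^ 2 - 1) :: complex) = ?q ^ 2 - 1"
    using q1 by (subst of_nat_diff) (auto simp: power2_eq_square)

  have "of_nat (?I + (q + 1 + (q + 1) * q * (t - 1) + (if ?all_even then (q ^ 2 - q) * t else 0))) =
      (of_nat (\<Prod>b\<in>D. q ^ point_degree b + 1) :: complex)"
    using card_geom_indec_zero[OF n0 b0 q] unfolding t_def by (rule arg_cong)
  hence I: "of_nat ?I + (?q + 1 + (?q + 1) * ?q * (of_nat t - 1) + (if ?all_even then (?q ^ 2 - ?q) * of_nat t else 0)) =
      (\<Sum>S\<in>Pow D. ?q ^ deg_sum S)"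
    unfolding of_nat_add of_nat_mult qq of_nat_prod of_nat_power of_nat_1 prod_one_plus_power[OF finite_D, symmetric]
    using t1 qq by (auto simp: of_nat_diff split: if_splits)

  have "?N * ((q ^ 2 - 1) * (q ^ 2 - q)) = (q - 1) * ?I"
    using num_geom_indecomposable_mult[OF card_aut_zero(2)[OF n0]] card_aut_zero(1)[OF n0] by (simp only: q)
  hence "(of_nat (?N * ((q ^ 2 - 1) * (q ^ 2 - q))) :: complex) = of_nat ((q - 1) * ?I)" by (rule arg_cong)
  hence "of_nat ?N * ((?q ^ 2 - 1) * (?q ^ 2 - ?q)) = (?q - 1) * of_nat ?I"
    unfolding of_nat_mult qq qq1 using q1 by (simp add: of_nat_diff)
  hence "(?q - 1) * (of_nat ?N * (?q * (?q ^ 2 - 1))) = (?q - 1) * of_nat ?I"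
    by (simp add: algebra_simps power2_eq_square)
  moreover have "?q - 1 \<noteq> 0" using q1 by simp
  ultimately have N: "of_nat ?N * (?q * (?q ^ 2 - 1)) = of_nat ?I" by simp

  define E where "E = (\<Sum>S\<in>Pow D. if even (deg_sum S) then 1 else 0 :: complex)"
  define Od where "Od = (\<Sum>S\<in>Pow D. if odd (deg_sum S) then 1 else 0 :: complex)"
  have "E + Od = (\<Sum>S\<in>Pow D. 1)" unfolding E_def Od_def sum.distrib[symmetric] by (rule sum.cong) auto
  hence EO: "E + Od = 2 * of_nat t" using finite_D by (simp add: card_Pow two)
  \<comment> \<open>The expansion \<open>prod_one_plus_power\<close> is now used at -1; a single
    point of odd degree makes the product vanish.\<close>
  have "E - Od = (\<Sum>S\<in>Pow D. (- 1) ^ deg_sum S)"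
    unfolding E_def Od_def sum_subtractf[symmetric] by (rule sum.cong) auto
  also have "\<dots> = (\<Prod>b\<in>D. (- 1) ^ point_degree b + 1)" by (rule prod_one_plus_power[OF finite_D, symmetric])
  also have "\<dots> = (if ?all_even then 2 * of_nat t else 0)"
  proof (cases ?all_even)
    case True
    have "(\<Prod>b\<in>D. (- 1) ^ point_degree b + 1) = (\<Prod>b\<in>D. (2 :: complex))" by (rule prod.cong) (use True in auto)
    thus ?thesis using True by (simp add: two)
  next
    case False
    then obtain p where p: "p \<in> D" "odd (point_degree p)" by blast
    hence "(- 1) ^ point_degree p + 1 = (0 :: complex)" by simp
    hence "(\<Prod>b\<in>D. (- 1) ^ point_degree b + 1) = (0 :: complex)"
      using p(1) by (intro prod_zero[OF finite_D]) blast
    thus ?thesis by (simp only: if_not_P[OF False])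
  qed
  finally have EmO: "E - Od = (if ?all_even then 2 * of_nat t else 0)" .

  \<comment> \<open>All degrees are positive, so only the empty set has degree 0. Its correction
    term is 1, whereas the rule for even degrees would give \<open>q^2\<close>; the difference is
    accounted for separately.\<close>
  have "(\<Sum>S\<in>Pow D. if S = {} then 1 - ?q ^ 2 else 0) = 1 - ?q ^ 2" using finite_D by (simp add: sum.delta)
  moreover have "(if deg_sum S = 0 then 1 else if odd (deg_sum S) then ?q else ?q ^ 2) =
      ?q * (if odd (deg_sum S) then 1 else 0) + ?q ^ 2 * (if even (deg_sum S) then 1 else 0) + (if S = {} then 1 - ?q ^ 2 else 0)"
    if "S \<in> Pow D" for S
  proof -
    have "deg_sum S = 0 \<longleftrightarrow> S = {}"
    proof
      assume z: "deg_sum S = 0"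
      have "finite S" using that finite_D finite_subset by blast
      show "S = {}"
      proof (rule ccontr)
        assume "S \<noteq> {}"
        then obtain p where p: "p \<in> S" by blast
        hence pd: "point_degree p = 0" using z \<open>finite S\<close> by (simp add: deg_sum_def)
        have "p \<in> D" using p that by blast
        thus False using geometric_root.degree_pos[OF conj_root_geometric_root[OF some_root_D]] pd
          by (metis point_degree_def less_irrefl)
      qed
    qed (simp add: deg_sum_def)
    thus ?thesis by auto
  qed
  ultimately have corr: "(\<Sum>S\<in>Pow D. if deg_sum S = 0 then 1 else if odd (deg_sum S) then ?q else ?q ^ 2) =
      ?q * Od + ?q ^ 2 * E + (1 - ?q ^ 2)"
    unfolding E_def Od_def by (simp add: sum.distrib sum_distrib_left)

  have "?q * (?q ^ 2 - 1) * (\<Sum>S\<in>Pow D. \<Sum>i = 1..(deg_sum S - 1) div 2. ?q ^ (deg_sum S - 2 * i - 1)) =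
      (\<Sum>S\<in>Pow D. ?q ^ deg_sum S) - (\<Sum>S\<in>Pow D. if deg_sum S = 0 then 1 else if odd (deg_sum S) then ?q else ?q ^ 2)"
    unfolding sum_distrib_left[of "?q * (?q ^ 2 - 1)" _ "Pow D"] step2_geometric_sum sum_subtractf ..
  also have "\<dots> = of_nat ?I"
  proof (cases ?all_even)
    case True
    have "E - Od = 2 * of_nat t" using EmO unfolding if_P[OF True] .
    hence EO': "Od = 0" "E = 2 * of_nat t" using EO by (simp_all add: algebra_simps)
    show ?thesis unfolding corr I[symmetric] if_P[OF True] EO' by (simp add: algebra_simps power2_eq_square)
  next
    case False
    have "E - Od = 0" using EmO unfolding if_not_P[OF False] .
    hence EO': "Od = of_nat t" "E = of_nat t" using EO by (simp_all add: algebra_simps)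
    show ?thesis unfolding corr I[symmetric] if_not_P[OF False] EO' by (simp add: algebra_simps power2_eq_square)
  qed
  finally have "?q * (?q ^ 2 - 1) * of_nat ?N =
      ?q * (?q ^ 2 - 1) * (\<Sum>S\<in>Pow D. \<Sum>i = 1..(deg_sum S - 1) div 2. ?q ^ (deg_sum S - 2 * i - 1))"
    using N by (simp add: mult_ac)
  moreover have "?q * (?q ^ 2 - 1) \<noteq> 0"
  proof -
    have "q ^ 2 - 1 \<noteq> 0" using one_less_power[OF q1, of 2] by simp
    hence "?q ^ 2 - 1 \<noteq> 0" unfolding qq1[symmetric] by (simp only: of_nat_eq_0_iff simp_thms)
    thus ?thesis using q1 by simp
  qed
  ultimately show ?thesis by simp
qed

end

theorem theorem1p3p1:
  fixes D :: "'k::{field,finite} point set"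
    and w :: "nat \<Rightarrow> nat"
    and l q :: nat
    and a b :: int
  assumes "q = card (UNIV :: 'k set)"
    and "reduced_divisor D"
    and "l = divisor_degree D"
    and "w permutes {1..l}"
    and "cycle_type {1..l} w = image_mset point_degree (mset_set D)"
  shows
    "of_nat (num_geom_indecomposable D (bundle_sum (twist a) (twist a))) =
       (if l \<ge> 3
        then \<Sum>m = 0..l - 3. (\<Sum>i = 1..(l - m - 1) div 2. subset_char l (m + 2 * i + 1) w) * of_nat q ^ m
        else 0)
     \<and>
     (a > b \<longrightarrow>
       of_nat (num_geom_indecomposable D (bundle_sum (twist a) (twist b))) =
       (if int l \<ge> a - b + 2
        then \<Sum>m = 0..l - nat (a - b + 2).
               (\<Sum>s = m + nat (a - b + 2)..l. subset_char l s w) * of_nat q ^ m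
        else 0))"
proof (intro conjI impI)
  have finD: "finite D" using assms(2) by (simp add: reduced_divisor_def)
  note char = sum_subset_char[OF finD assms(4,5)]
  let ?q = "of_nat q :: complex"
  show "of_nat (num_geom_indecomposable D (bundle_sum (twist a) (twist a))) =
       (if l \<ge> 3
        then \<Sum>m = 0..l - 3. (\<Sum>i = 1..(l - m - 1) div 2. subset_char l (m + 2 * i + 1) w) * of_nat q ^ m
        else 0)"
  proof -
    interpret rank2_bundle a a 0 "bundle_sum (twist a) (twist a)" D
      by unfold_locales (simp_all add: assms(2))
    show ?thesis
    proof (cases "D = {}")
      case True
      hence "l = 0" by (simp add: assms(3) divisor_degree_def)
      thus ?thesis using num_geom_indecomposable_empty[OF True refl] by simp
    next
      case False
      then obtain b0 where b0: "b0 \<in> D" by blast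
      show ?thesis
        unfolding num_geom_indecomposable_zero[OF refl b0 assms(1)]
          char[of "\<lambda>s. \<Sum>i = 1..(s - 1) div 2. ?q ^ (s - 2 * i - 1)", symmetric]
        by (rule sum_reindex_step2[symmetric])
    qed
  qed
  assume ab: "a > b"
  define n where "n = nat (a - b)"
  \<comment> \<open>The index shift between the two counts: supports of degree n + 1 still split, so
    the first degree that contributes is n + 2 = a - b + 2.\<close>
  have n_facts: "n > 0" "nat (a - b + 2) = n + 2" "int l \<ge> a - b + 2 \<longleftrightarrow> l \<ge> n + 2"
    using ab by (auto simp: n_def nat_add_distrib)
  interpret rank2_bundle a b n "bundle_sum (twist a) (twist b)" D
    by unfold_locales (use ab assms(2) in \<open>simp_all add: n_def\<close>)
  have "of_nat (num_geom_indecomposable D (bundle_sum (twist a) (twist b))) =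
      (\<Sum>s = 0..l. subset_char l s w * (\<Sum>m<s - (n + 1). ?q ^ m))"
    unfolding num_geom_indecomposable_pos[OF n_facts(1) assms(1)] char ..
  also have "\<dots> = (\<Sum>s = 0..l. subset_char l s w * (\<Sum>m<Suc s - (n + 2). ?q ^ m))" by simp
  finally show "of_nat (num_geom_indecomposable D (bundle_sum (twist a) (twist b))) =
       (if int l \<ge> a - b + 2
        then \<Sum>m = 0..l - nat (a - b + 2).
               (\<Sum>s = m + nat (a - b + 2)..l. subset_char l s w) * of_nat q ^ m
        else 0)"
    unfolding n_facts(2,3) sum_swap_geometric[symmetric] .
qed

end
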